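(* Let $\phi$ be an essentially linear fractional selfmap of $\mathbb{U}$ such that $\phi(1)=1$, and suppose that for some $\delta>0$, $\phi'$ is continuous on (extends continuously to) $\{z: |z-1|<\delta \text{ and } |z|\le 1\}$. Let $g\in H^\infty(\mathbb{U})$ have radial limit function (also denoted $g$) that is defined on some open arc $A$ of the unit circle including $1$, and suppose that $g$ restricted to $A$ is differentiable at $1$. Suppose that $\phi'(1)<1$. Then, for the weighted composition operator $C_{g,\phi}: H^2(\mathbb{U})\to H^2(\mathbb{U})$, $$\mathrm{Sp}(C_{g,\phi}) = \mathrm{Sp}_e(C_{g,\phi}) = \{z: |z| \le |g(1)|\,\phi'(1)^{-1/2}\}.$$
   Context: $\mathbb{U}$ is the open unit disc in $\mathbb{C}$, $H^2(\mathbb{U})$ is the classical Hardy space of analytic functions on $\mathbb{U}$ with square-summable Maclaurin coefficients, and $H^\infty(\mathbb{U})$ is the algebra of bounded analytic functions on $\mathbb{U}$. An (analytic) selfmap of $\mathbb{U}$ is an analytic function $\phi$ on $\mathbb{U}$ with $\phi(\mathbb{U})\subseteq\mathbb{U}$. For $g\in H^\infty(\mathbb{U})$, $C_{g,\phi}f = g\cdot(f\circ\phi)$ is the weighted composition operator, which is bounded on $H^2(\mathbb{U})$. For a bounded operator $T$ on a Hilbert space, $\mathrm{Sp}(T)$ is its spectrum and $\mathrm{Sp}_e(T)$ is its essential spectrum, $\{\lambda : T-\lambda I \text{ is not Fredholm}\}$. A selfmap $\phi$ is essentially linear fractional if there is $\eta\in\partial\mathbb{U}$ such that: (a) $\phi(\mathbb{U})$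 is contained in a proper subdisc of $\mathbb{U}$ internally tangent to the unit circle at $\eta$; (b) the set $\phi^{-1}(\{\eta\}) := \{\zeta\in\partial\mathbb{U} : \eta \text{ belongs to the cluster set of } \phi \text{ at } \zeta\}$ consists of exactly one element, say $\zeta_0$; (c) $\phi'''$ extends continuously to $\mathbb{U}\cup\{\zeta_0\}$. Consequently $\phi,\phi',\phi''$ also extend continuously to $\zeta_0$, and values at $\zeta_0$ denote values of these extensions. If $\phi(1)=1$, then $\eta=\zeta_0=1$. *)

theory Defs
  imports "HOL-Complex_Analysis.Complex_Analysis"
begin

class complex_normed_vector = real_normed_vector +
  fixes scaleC :: "complex \<Rightarrow> 'a \<Rightarrow> 'a"  (infixr "*\<^sub>C" 75)
  assumes scaleC_add_right: "c *\<^sub>C (x + y) = c *\<^sub>C x + c *\<^sub>C y"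
    and scaleC_add_left: "(c + d) *\<^sub>C x = c *\<^sub>C x + d *\<^sub>C x"
    and scaleC_scaleC: "c *\<^sub>C (d *\<^sub>C x) = (c * d) *\<^sub>C x"
    and scaleC_one: "1 *\<^sub>C x = x"
    and scaleR_scaleC: "r *\<^sub>R x = complex_of_real r *\<^sub>C x"
    and norm_scaleC: "norm (c *\<^sub>C x) = cmod c * norm x"

global_interpretation complex_vector:
  vector_space "scaleC :: complex \<Rightarrow> 'a \<Rightarrow> 'a::complex_normed_vector"
  by unfold_locales
    (simp_all add: scaleC_add_right scaleC_add_left scaleC_scaleC scaleC_one)

definition bounded_clinear ::
    "('a::complex_normed_vector \<Rightarrow> 'b::complex_normed_vector) \<Rightarrow> bool" where
  "bounded_clinear T \<longleftrightarrow> bounded_linear T \<and> (\<forall>c x. T (c *\<^sub>C x) = c *\<^sub>C T x)"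

definition invertible_operator :: "('a::complex_normed_vector \<Rightarrow> 'a) \<Rightarrow> bool" where
  "invertible_operator T \<longleftrightarrow>
     bounded_clinear T \<and> (\<exists>S. bounded_clinear S \<and> S \<circ> T = id \<and> T \<circ> S = id)"

definition Fredholm :: "('a::complex_normed_vector \<Rightarrow> 'a) \<Rightarrow> bool" where
  "Fredholm T \<longleftrightarrow> bounded_clinear T
     \<and> (\<exists>B. finite B \<and> {x. T x = 0} \<subseteq> complex_vector.span B)
     \<and> closed (range T)
     \<and> (\<exists>B. finite B \<and> complex_vector.span (range T \<union> B) = UNIV)"

definition Sp :: "('a::complex_normed_vector \<Rightarrow> 'a) \<Rightarrow> complex set" where
  "Sp T = {l. \<not> invertible_operator (\<lambda>x. T x - l *\<^sub>C x)}"

definition Sp_ess :: "('a::complex_normed_vector \<Rightarrow> 'a) \<Rightarrow> complex set" where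
  "Sp_ess T = {l. \<not> Fredholm (\<lambda>x. T x - l *\<^sub>C x)}"

abbreviation unit_disc :: "complex set" where
  "unit_disc \<equiv> ball 0 1"

definition maclaurin_coeff :: "(complex \<Rightarrow> complex) \<Rightarrow> nat \<Rightarrow> complex" where
  "maclaurin_coeff f n = (deriv ^^ n) f 0 / fact n"

text \<open>A function on the disc is represented by its extension by zero, so that equality of
  representatives is equality on the disc.\<close>

typedef hardy2 = "{f. f holomorphic_on unit_disc
    \<and> summable (\<lambda>n. (cmod (maclaurin_coeff f n))\<^sup>2) \<and> (\<forall>z. z \<notin> unit_disc \<longrightarrow> f z = 0)}"
  morphisms h2_fun Abs_hardy2
proof
  have "maclaurin_coeff (\<lambda>_. 0) n = 0" for n
    by (simp add: maclaurin_coeff_def)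
  then show "(\<lambda>_. 0) \<in> {f. f holomorphic_on unit_disc
    \<and> summable (\<lambda>n. (cmod (maclaurin_coeff f n))\<^sup>2) \<and> (\<forall>z. z \<notin> unit_disc \<longrightarrow> f z = 0)}"
    by simp
qed

setup_lifting type_definition_hardy2

lemma maclaurin_coeff_zero [simp]: "maclaurin_coeff (\<lambda>_. 0) n = 0"
  by (simp add: maclaurin_coeff_def)

lemma maclaurin_coeff_add:
  assumes "f holomorphic_on unit_disc" "g holomorphic_on unit_disc"
  shows "maclaurin_coeff (\<lambda>z. f z + g z) n = maclaurin_coeff f n + maclaurin_coeff g n"
  using higher_deriv_add[OF assms, of 0 n] by (simp add: maclaurin_coeff_def add_divide_distrib)

lemma maclaurin_coeff_cmult:
  assumes "f holomorphic_on unit_disc"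
  shows "maclaurin_coeff (\<lambda>z. c * f z) n = c * maclaurin_coeff f n"
  using higher_deriv_cmult[OF assms, of 0 n c] by (simp add: maclaurin_coeff_def)

lemma maclaurin_coeff_uminus:
  assumes "f holomorphic_on unit_disc"
  shows "maclaurin_coeff (\<lambda>z. - f z) n = - maclaurin_coeff f n"
  using higher_deriv_uminus[OF assms, of 0 n] by (simp add: maclaurin_coeff_def)

lemma square_summable_add:
  fixes a b :: "nat \<Rightarrow> complex"
  assumes "summable (\<lambda>n. (cmod (a n))\<^sup>2)" "summable (\<lambda>n. (cmod (b n))\<^sup>2)"
  shows "summable (\<lambda>n. (cmod (a n + b n))\<^sup>2)"
proof (rule summable_comparison_test')
  show "summable (\<lambda>n. 2 * (cmod (a n))\<^sup>2 + 2 * (cmod (b n))\<^sup>2)"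
    using assms by (intro summable_add summable_mult)
  fix n
  have "(cmod (a n + b n))\<^sup>2 \<le> (cmod (a n) + cmod (b n))\<^sup>2"
    by (intro power_mono norm_triangle_ineq) auto
  also have "\<dots> \<le> 2 * (cmod (a n))\<^sup>2 + 2 * (cmod (b n))\<^sup>2"
    using zero_le_power2[of "cmod (a n) - cmod (b n)"]
    by (simp add: power2_sum power2_diff)
  finally show "norm ((cmod (a n + b n))\<^sup>2) \<le> 2 * (cmod (a n))\<^sup>2 + 2 * (cmod (b n))\<^sup>2"
    by simp
qed

lemma square_summable_inner:
  fixes a b :: "nat \<Rightarrow> complex"
  assumes "summable (\<lambda>n. (cmod (a n))\<^sup>2)" "summable (\<lambda>n. (cmod (b n))\<^sup>2)"
  shows "summable (\<lambda>n. inner (a n) (b n))"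
proof (rule summable_comparison_test')
  show "summable (\<lambda>n. (cmod (a n))\<^sup>2 + (cmod (b n))\<^sup>2)"
    using assms by (rule summable_add)
  fix n
  have "\<bar>inner (a n) (b n)\<bar> \<le> cmod (a n) * cmod (b n)"
    by (rule Cauchy_Schwarz_ineq2)
  also have "\<dots> \<le> (cmod (a n))\<^sup>2 + (cmod (b n))\<^sup>2"
  proof -
    have "2 * (cmod (a n) * cmod (b n)) \<le> (cmod (a n))\<^sup>2 + (cmod (b n))\<^sup>2"
      using zero_le_power2[of "cmod (a n) - cmod (b n)"] by (simp add: power2_diff)
    moreover have "0 \<le> cmod (a n) * cmod (b n)"
      by simp
    ultimately show ?thesis
      by linarith
  qed
  finally show "norm (inner (a n) (b n)) \<le> (cmod (a n))\<^sup>2 + (cmod (b n))\<^sup>2"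
    by simp
qed

lemma square_summable_cmult:
  fixes a :: "nat \<Rightarrow> complex"
  assumes "summable (\<lambda>n. (cmod (a n))\<^sup>2)"
  shows "summable (\<lambda>n. (cmod (c * a n))\<^sup>2)"
  using summable_mult[OF assms, of "(cmod c)\<^sup>2"] by (simp add: norm_mult power_mult_distrib)

lemma maclaurin_coeff_eq_zeroD:
  assumes "f holomorphic_on unit_disc" "\<And>n. maclaurin_coeff f n = 0" "z \<in> unit_disc"
  shows "f z = 0"
  using holomorphic_power_series[OF assms(1,3)] assms(2)
  by (simp add: maclaurin_coeff_def sums_iff)

instantiation hardy2 :: real_inner
begin

lift_definition zero_hardy2 :: hardy2 is "\<lambda>_. 0"
  by simp

lift_definition plus_hardy2 :: "hardy2 \<Rightarrow> hardy2 \<Rightarrow> hardy2" is "\<lambda>f g z. f z + g z"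
  by (auto simp: maclaurin_coeff_add intro: holomorphic_intros square_summable_add)

lift_definition uminus_hardy2 :: "hardy2 \<Rightarrow> hardy2" is "\<lambda>f z. - f z"
  by (auto simp: maclaurin_coeff_uminus intro: holomorphic_intros)

definition minus_hardy2 :: "hardy2 \<Rightarrow> hardy2 \<Rightarrow> hardy2" where
  "minus_hardy2 f g = f + - g"

lift_definition scaleR_hardy2 :: "real \<Rightarrow> hardy2 \<Rightarrow> hardy2" is "\<lambda>r f z. complex_of_real r * f z"
  by (auto simp: maclaurin_coeff_cmult intro!: holomorphic_on_mult square_summable_cmult)

text \<open>The real part of the usual inner product; its norm is the \<open>\<ell>\<^sup>2\<close> norm of the Maclaurin
  coefficients.\<close>

lift_definition inner_hardy2 :: "hardy2 \<Rightarrow> hardy2 \<Rightarrow> real" is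
  "\<lambda>f g. \<Sum>n. inner (maclaurin_coeff f n) (maclaurin_coeff g n)" .

definition norm_hardy2 :: "hardy2 \<Rightarrow> real" where
  "norm_hardy2 f = sqrt (inner f f)"

definition sgn_hardy2 :: "hardy2 \<Rightarrow> hardy2" where
  "sgn_hardy2 f = scaleR (inverse (norm f)) f"

definition dist_hardy2 :: "hardy2 \<Rightarrow> hardy2 \<Rightarrow> real" where
  "dist_hardy2 f g = norm (f - g)"

definition uniformity_hardy2 :: "(hardy2 \<times> hardy2) filter" where
  "uniformity_hardy2 = (INF e\<in>{0<..}. principal {(f, g). dist f g < e})"

definition open_hardy2 :: "hardy2 set \<Rightarrow> bool" where
  "open_hardy2 U \<longleftrightarrow> (\<forall>f\<in>U. eventually (\<lambda>(f', g). f' = f \<longrightarrow> g \<in> U) uniformity)"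

instance
proof
  fix f g h :: hardy2 and r s :: real
  show "f + g + h = f + (g + h)" "f + g = g + f" "0 + f = f" "- f + f = 0"
    by (transfer; simp add: add_ac)+
  show "f - g = f + - g"
    by (rule minus_hardy2_def)
  show "r *\<^sub>R (f + g) = r *\<^sub>R f + r *\<^sub>R g" "(r + s) *\<^sub>R f = r *\<^sub>R f + s *\<^sub>R f"
    "r *\<^sub>R s *\<^sub>R f = (r * s) *\<^sub>R f" "1 *\<^sub>R f = f"
    by (transfer; simp add: algebra_simps)+
  show "sgn f = scaleR (inverse (norm f)) f"
    by (rule sgn_hardy2_def)
  show "dist f g = norm (f - g)"
    by (rule dist_hardy2_def)
  show "uniformity = (INF e\<in>{0<..}. principal {(f, g :: hardy2). dist f g < e})"
    by (rule uniformity_hardy2_def)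
  show "open U \<longleftrightarrow> (\<forall>f\<in>U. eventually (\<lambda>(f', g). f' = f \<longrightarrow> g \<in> U) uniformity)"
    for U :: "hardy2 set"
    by (rule open_hardy2_def)
  show "inner f g = inner g f"
    by transfer (simp add: inner_commute)
  show "inner (f + g) h = inner f h + inner g h"
    by transfer
      (auto simp: maclaurin_coeff_add inner_add_left intro!: suminf_add[symmetric] square_summable_inner)
  show "inner (r *\<^sub>R f) g = r * inner f g"
  proof (transfer, clarify)
    fix r :: real and f g :: "complex \<Rightarrow> complex"
    assume *: "f holomorphic_on unit_disc"
      "summable (\<lambda>n. (cmod (maclaurin_coeff f n))\<^sup>2)" "summable (\<lambda>n. (cmod (maclaurin_coeff g n))\<^sup>2)"
    have "inner (complex_of_real r * a) b = r * inner a b" for a b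
      by (metis inner_scaleR_left scaleR_conv_of_real)
    then show "(\<Sum>n. inner (maclaurin_coeff (\<lambda>z. complex_of_real r * f z) n) (maclaurin_coeff g n))
        = r * (\<Sum>n. inner (maclaurin_coeff f n) (maclaurin_coeff g n))"
      using * by (simp add: maclaurin_coeff_cmult suminf_mult[OF square_summable_inner])
  qed
  show "0 \<le> inner f f"
    by transfer (auto intro!: suminf_nonneg square_summable_inner)
  show "inner f f = 0 \<longleftrightarrow> f = 0"
  proof (transfer, clarify)
    fix f :: "complex \<Rightarrow> complex"
    assume *: "f holomorphic_on unit_disc" "summable (\<lambda>n. (cmod (maclaurin_coeff f n))\<^sup>2)"
      "\<forall>z. z \<notin> unit_disc \<longrightarrow> f z = 0"
    show "(\<Sum>n. inner (maclaurin_coeff f n) (maclaurin_coeff f n)) = 0 \<longleftrightarrow> f = (\<lambda>_. 0)"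
    proof
      assume "(\<Sum>n. inner (maclaurin_coeff f n) (maclaurin_coeff f n)) = 0"
      then have "maclaurin_coeff f n = 0" for n
        using suminf_eq_zero_iff[OF square_summable_inner[OF *(2,2)]] by simp
      then have "f z = 0" for z
        using maclaurin_coeff_eq_zeroD[OF *(1)] *(3) by metis
      then show "f = (\<lambda>_. 0)"
        by blast
    qed simp
  qed
  show "norm f = sqrt (inner f f)"
    by (rule norm_hardy2_def)
qed

end

instantiation hardy2 :: complex_normed_vector
begin

lift_definition scaleC_hardy2 :: "complex \<Rightarrow> hardy2 \<Rightarrow> hardy2" is "\<lambda>c f z. c * f z"
  by (auto simp: maclaurin_coeff_cmult intro!: holomorphic_on_mult square_summable_cmult)

instance
proof
  fix f g :: hardy2 and c d :: complex and r :: real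
  show "c *\<^sub>C (f + g) = c *\<^sub>C f + c *\<^sub>C g" "(c + d) *\<^sub>C f = c *\<^sub>C f + d *\<^sub>C f"
    "c *\<^sub>C d *\<^sub>C f = (c * d) *\<^sub>C f" "1 *\<^sub>C f = f" "r *\<^sub>R f = complex_of_real r *\<^sub>C f"
    by (transfer; simp add: algebra_simps)+
  have "inner (c *\<^sub>C f) (c *\<^sub>C f) = (cmod c)\<^sup>2 * inner f f"
  proof (transfer, clarify)
    fix c and f :: "complex \<Rightarrow> complex"
    assume *: "f holomorphic_on unit_disc" "summable (\<lambda>n. (cmod (maclaurin_coeff f n))\<^sup>2)"
    then show "(\<Sum>n. inner (maclaurin_coeff (\<lambda>z. c * f z) n) (maclaurin_coeff (\<lambda>z. c * f z) n))
        = (cmod c)\<^sup>2 * (\<Sum>n. inner (maclaurin_coeff f n) (maclaurin_coeff f n))"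
      by (simp add: maclaurin_coeff_cmult dot_square_norm norm_mult power_mult_distrib suminf_mult)
  qed
  then show "norm (c *\<^sub>C f) = cmod c * norm f"
    by (simp add: norm_eq_sqrt_inner real_sqrt_mult)
qed

end

definition hardy_inf :: "(complex \<Rightarrow> complex) set" where
  "hardy_inf = {g. g holomorphic_on unit_disc \<and> bounded (g ` unit_disc)}"

text \<open>For a bounded analytic weight and an analytic selfmap, the function below lies in the Hardy
  space (Littlewood's subordination theorem), so \<^const>\<open>Abs_hardy2\<close> is applied inside its
  intended domain.\<close>

definition weighted_comp_op ::
    "(complex \<Rightarrow> complex) \<Rightarrow> (complex \<Rightarrow> complex) \<Rightarrow> hardy2 \<Rightarrow> hardy2" where
  "weighted_comp_op g \<phi> f =
     Abs_hardy2 (\<lambda>z. if z \<in> unit_disc then g z * h2_fun f (\<phi> z) else 0)"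

definition analytic_selfmap :: "(complex \<Rightarrow> complex) \<Rightarrow> bool" where
  "analytic_selfmap \<phi> \<longleftrightarrow> \<phi> holomorphic_on unit_disc \<and> \<phi> ` unit_disc \<subseteq> unit_disc"

text \<open>Functions on the disc are total functions whose values off the disc carry no meaning, so
  all boundary behaviour is expressed through limits taken inside the disc.\<close>

definition cluster_set :: "(complex \<Rightarrow> complex) \<Rightarrow> complex \<Rightarrow> complex set" where
  "cluster_set f \<zeta> =
     {w. \<exists>z. (\<forall>n. z n \<in> unit_disc) \<and> z \<longlonglongrightarrow> \<zeta> \<and> (\<lambda>n. f (z n)) \<longlonglongrightarrow> w}"

definition extends_continuously :: "(complex \<Rightarrow> complex) \<Rightarrow> complex set \<Rightarrow> bool" where
  "extends_continuously f S \<longleftrightarrow>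
     (\<exists>h. continuous_on S h \<and> (\<forall>z\<in>S \<inter> unit_disc. h z = f z))"

text \<open>Meaningful only where the limit exists. For an essentially linear fractional \<open>\<phi>\<close> tending
  to 1 at 1, the boundary value of \<open>deriv \<phi>\<close> at 1 exists and is a positive real number
  (Julia-Caratheodory), so its real part is the number itself.\<close>

definition boundary_value :: "(complex \<Rightarrow> complex) \<Rightarrow> complex \<Rightarrow> complex" where
  "boundary_value f \<zeta> = Lim (at \<zeta> within unit_disc) f"

definition tangent_subdisc :: "complex set \<Rightarrow> complex \<Rightarrow> bool" where
  "tangent_subdisc D \<eta> \<longleftrightarrow>
     (\<exists>c r. r > 0 \<and> D = ball c r \<and> D \<subset> unit_disc \<and> sphere c r \<inter> sphere 0 1 = {\<eta>})"

definition essentially_linear_fractional :: "(complex \<Rightarrow> complex) \<Rightarrow> bool" where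
  "essentially_linear_fractional \<phi> \<longleftrightarrow> analytic_selfmap \<phi> \<and>
     (\<exists>\<eta>\<in>sphere 0 1. (\<exists>D. tangent_subdisc D \<eta> \<and> \<phi> ` unit_disc \<subseteq> D) \<and>
       (\<exists>\<zeta>\<^sub>0. {\<zeta> \<in> sphere 0 1. \<eta> \<in> cluster_set \<phi> \<zeta>} = {\<zeta>\<^sub>0} \<and>
         extends_continuously ((deriv ^^ 3) \<phi>) (unit_disc \<union> {\<zeta>\<^sub>0})))"

definition open_arc :: "complex set \<Rightarrow> bool" where
  "open_arc A \<longleftrightarrow> (\<exists>a b. a < b \<and> b \<le> a + 2 * pi \<and> A = cis ` {a<..<b})"

definition radial_limit_on :: "complex set \<Rightarrow> (complex \<Rightarrow> complex) \<Rightarrow> (complex \<Rightarrow> complex) \<Rightarrow> bool" where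
  "radial_limit_on A g gs \<longleftrightarrow>
     (\<forall>\<zeta>\<in>A. ((\<lambda>r. g (complex_of_real r * \<zeta>)) \<longlongrightarrow> gs \<zeta>) (at_left 1))"

end

theory Submission
  imports Defs
begin

text \<open>
  \<open>\<phi>\<close> has its Denjoy--Wolff point at 1 with multiplier \<open>a = \<phi>'(1) < 1\<close>, and all iterates beyond the first
  map the disc into horodiscs shrinking to 1. Poisson's formula gives \<open>g \<rightarrow> L = gs 1\<close> at 1, so the weights
  \<open>g \<circ> \<phi>\<^sup>k\<close> tend to \<open>L\<close> uniformly on the disc; with Littlewood's bound for composition operators the
  \<open>n\<close>-th power of the operator has norm at most about \<open>(\<bar>L\<bar> a\<^sup>-\<^sup>1\<^sup>/\<^sup>2)\<^sup>n\<close>, which bounds the spectrum.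

  Conversely let \<open>\<nu>\<close> be the Koenigs map into the right half-plane, \<open>\<nu> \<circ> \<phi> = \<nu> / a\<close>. The powers \<open>\<nu>\<^sup>s\<close> with
  \<open>Re s < 1/2\<close> lie in \<open>H\<^sup>2\<close> and satisfy \<open>\<nu>\<^sup>s \<circ> \<phi> = a\<^sup>-\<^sup>s \<nu>\<^sup>s\<close>; multiplying by polynomials in the
  \<open>\<phi>\<close>-invariant function \<open>\<nu>\<close> to the power \<open>2 \<pi> \<i> / ln a\<close> and by finite products of the \<open>g \<circ> \<phi>\<^sup>k\<close> gives
  infinite-dimensional spaces of approximate eigenvectors, which a Fredholm operator cannot have. If \<open>L = 0\<close>
  the operator is quasinilpotent, and an injective Fredholm operator is bounded below.
\<close>

section \<open>Circle means and the Poisson integral\<close>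

text \<open>Exponents with real part strictly below 1/2 give only values of modulus below R = |L|
  a^(-1/2), and 0 is not of the form L a^(-s) at all. Approximate eigenvectors settle both: a point
  of the closed disc is replaced by a nearby nonzero one inside the open disc, and the displacement
  goes into the tolerance. One approximate eigenvector for each tolerance would only give points of
  the spectrum; the polynomials in the invariant function give, with the same estimate, a space that
  meets the orthogonal complement of every finite set, and on such a complement a Fredholm operator
  is bounded below. The power 1/2 has two sources. Along the orbit of 0 both the real part and the
  modulus in the half-plane grow like a^(-n), which limits the norm of composition with the n-th
  iterate to order a^(-n/2). And w^(2x) keeps a real part comparable with its modulus on the
  half-plane for 0 <= 2x < 1. The smoothness of \<open>\<phi>\<close> at 1 yields a quadratic error
  for its tangent map. In the half-plane this is a bounded error of the dilation, and rescaling by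
  a^n makes the errors summable; the Koenigs map is their sum.\<close>

lemma circle_Cauchy:
  fixes f :: "complex \<Rightarrow> complex" and r R :: real
  assumes f: "f holomorphic_on ball 0 R" and r: "0 < r" "r < R" and w: "cmod w < r"
  shows "((\<lambda>t. f (r * cis t) * (r * cis t / (r * cis t - w))) has_integral 2 * pi * f w) {0..2*pi}"
proof -
  have "((\<lambda>u. f u / (u - w)) has_contour_integral 2 * of_real pi * \<i> * f w) (circlepath 0 r)"
  proof (rule Cauchy_integral_circlepath)
    have "cball 0 r \<subseteq> ball 0 R" "ball 0 r \<subseteq> ball 0 R"
      using r by auto
    then show "continuous_on (cball 0 r) f" "f holomorphic_on ball 0 r"
      by (metis f holomorphic_on_imp_continuous_on holomorphic_on_subset)+
  qed (use w in auto)
  then have "((\<lambda>t. f (r * cis t) / (r * cis t - w) * r * \<i> * cis t) has_integral 2 * of_real pi * \<i> * f w) {0..2*pi}"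
    unfolding circlepath_def using r by (subst (asm) has_contour_integral_part_circlepath_iff) auto
  from has_integral_mult_right[OF this, of "- \<i>"] show ?thesis
    by (simp add: mult_ac)
qed

corollary circle_mean_value:
  fixes f :: "complex \<Rightarrow> complex" and r R :: real
  assumes "f holomorphic_on ball 0 R" "0 < r" "r < R"
  shows "((\<lambda>t. f (r * cis t)) has_integral 2 * pi * f 0) {0..2*pi}"
  using circle_Cauchy[OF assms, of 0] assms by simp

section \<open>The Poisson kernel\<close>

definition poisson :: "real \<Rightarrow> complex \<Rightarrow> real \<Rightarrow> real" where
  "poisson r w t = (r\<^sup>2 - (cmod w)\<^sup>2) / (cmod (r * cis t - w))\<^sup>2"

lemma poisson_nonneg: "cmod w < r \<Longrightarrow> 0 \<le> poisson r w t"
  by (simp add: poisson_def power_mono)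

lemma circle_neq:
  fixes r :: real
  assumes "cmod w < r"
  shows "r * cis t \<noteq> w"
proof
  assume "r * cis t = w"
  then have "cmod w = \<bar>r\<bar>" by (metis norm_cis norm_mult norm_of_real mult.right_neutral)
  with assms show False by simp
qed

text \<open>Being the real part of a function holomorphic in \<open>w\<close>, the kernel stays
  harmonic after composition with an analytic map; \<open>Littlewood_subordination\<close> averages
  it in that form.\<close>

lemma poisson_eq_Re:
  fixes r :: real
  assumes "cmod w < r"
  shows "poisson r w t = Re ((r * cis t + w) / (r * cis t - w))"
proof -
  define z where "z = r * cis t"
  have z: "cmod z = r" using assms by (simp add: z_def norm_mult)
      (meson abs_of_nonneg le_less_trans less_imp_le norm_ge_zero)
  have "Re ((z + w) / (z - w)) = Re ((z + w) * cnj (z - w)) / (cmod (z - w))\<^sup>2"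
    by (simp add: complex_div_cnj[of "z+w"] Re_divide_of_real)
  also have "Re ((z + w) * cnj (z - w)) = (cmod z)\<^sup>2 - (cmod w)\<^sup>2"
    unfolding cmod_power2 by (simp add: algebra_simps power2_eq_square)
  finally show ?thesis by (simp add: poisson_def z z_def[symmetric])
qed

lemma continuous_on_circle:
  fixes f :: "complex \<Rightarrow> complex" and r R :: real
  assumes "f holomorphic_on ball 0 R" "0 < r" "r < R"
  shows "continuous_on A (\<lambda>t. f (r * cis t))"
proof (rule continuous_on_compose2[OF holomorphic_on_imp_continuous_on[OF assms(1)]])
  show "continuous_on A (\<lambda>t. complex_of_real r * cis t)" by (intro continuous_intros)
qed (use assms in \<open>auto simp: norm_mult\<close>)

lemma continuous_on_poisson:
  assumes "cmod w < r"
  shows "continuous_on A (poisson r w)"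
  unfolding poisson_def using circle_neq[OF assms] by (intro continuous_intros) auto

text \<open>Cauchy's formula applied to \<open>f\<close> times a factor that is 1 at
  \<open>w\<close> and, on the circle, turns the Cauchy kernel into the Poisson kernel. For
  \<open>w = 0\<close> both kernels are constantly 1.\<close>

lemma poisson_formula:
  fixes f :: "complex \<Rightarrow> complex" and r R :: real
  assumes f: "f holomorphic_on ball 0 R" and r: "0 < r" "r < R" and w: "cmod w < r"
  shows "((\<lambda>t. f (r * cis t) * poisson r w t) has_integral 2 * pi * f w) {0..2*pi}"
proof -
  have nz: "(of_real r)\<^sup>2 - cnj w * z \<noteq> 0" if "cmod z \<le> r" for z
  proof
    assume "(of_real r)\<^sup>2 - cnj w * z = 0"
    then have "r\<^sup>2 = cmod w * cmod z"
      by (metis eq_iff_diff_eq_0 norm_of_real of_real_power complex_mod_cnj norm_mult abs_power2)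
    also have "\<dots> \<le> cmod w * r" using that by (intro mult_left_mono) auto
    also have "\<dots> < r * r" using w r by (intro mult_strict_right_mono) auto
    finally show False by (simp add: power2_eq_square)
  qed
  show ?thesis
  proof (cases "w = 0")
    case True
    then show ?thesis using circle_mean_value[OF f r] r by (simp add: poisson_def norm_mult)
  next
    case False
    \<comment> \<open>The added factor has its pole at \<open>r\<^sup>2 / cnj w\<close>, of modulus
      greater than \<open>r\<close>, so the product is still holomorphic past the circle.\<close>
    define R' where "R' = min R (r\<^sup>2 / cmod w)"
    have R': "r < R'" using r w False by (auto simp: R'_def field_simps power2_eq_square)
    define F where "F z = f z * ((r\<^sup>2 - (cmod w)\<^sup>2) / ((of_real r)\<^sup>2 - cnj w * z))" for z
    have nz': "(of_real r)\<^sup>2 - cnj w * z \<noteq> 0" if "cmod z < R'" for z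
    proof
      assume "(of_real r)\<^sup>2 - cnj w * z = 0"
      then have "r\<^sup>2 = cmod w * cmod z"
        by (metis eq_iff_diff_eq_0 norm_of_real of_real_power complex_mod_cnj norm_mult abs_power2)
      moreover have "cmod z < r\<^sup>2 / cmod w" using that by (simp add: R'_def)
      ultimately show False using False by (simp add: field_simps)
    qed
    have "F holomorphic_on ball 0 R'"
      unfolding F_def using nz' by (intro holomorphic_intros holomorphic_on_subset[OF f]) (auto simp: R'_def)
    from circle_Cauchy[OF this r(1) R' w]
    have *: "((\<lambda>t. F (r * cis t) * (r * cis t / (r * cis t - w))) has_integral 2 * pi * F w) {0..2*pi}" .
    have Fw: "F w = f w"
    proof -
      have "(of_real r)\<^sup>2 - cnj w * w = of_real (r\<^sup>2 - (cmod w)\<^sup>2)"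
        by (metis complex_norm_square mult.commute of_real_diff of_real_power)
      then show ?thesis using nz[of w] w by (simp add: F_def)
    qed
    have "F (r * cis t) * (r * cis t / (r * cis t - w)) = f (r * cis t) * poisson r w t" for t
    proof -
      define z where "z = r * cis t"
      have z: "cmod z = r" using r by (simp add: z_def norm_mult)
      have rz: "(of_real r)\<^sup>2 = z * cnj z" using complex_norm_square[of z] z by simp
      have z0: "z \<noteq> 0" using z r by auto
      have zw: "z \<noteq> w" using z w by auto
      have den: "(of_real r)\<^sup>2 - cnj w * z = z * cnj (z - w)" by (simp add: rz algebra_simps)
      have "of_real ((cmod (z - w))\<^sup>2) = (z - w) * cnj (z - w)" using complex_norm_square[of "z - w"] by simp
      then have "complex_of_real (poisson r w t) = of_real (r\<^sup>2 - (cmod w)\<^sup>2) / ((z - w) * cnj (z - w))"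
        by (simp add: poisson_def z_def[symmetric])
      moreover have "F z * (z / (z - w)) = f z * (of_real (r\<^sup>2 - (cmod w)\<^sup>2) / ((z - w) * cnj (z - w)))"
        using z0 zw unfolding F_def den by (simp add: divide_simps)
      ultimately show ?thesis by (simp add: z_def)
    qed
    with * Fw show ?thesis by simp
  qed
qed

corollary poisson_norm_le:
  fixes f :: "complex \<Rightarrow> complex" and r R :: real
  assumes f: "f holomorphic_on ball 0 R" and r: "0 < r" "r < R" and w: "cmod w < r"
  shows "2 * pi * cmod (f w) \<le> integral {0..2*pi} (\<lambda>t. cmod (f (r * cis t)) * poisson r w t)"
proof -
  have "norm (integral {0..2*pi} (\<lambda>t. f (r * cis t) * poisson r w t))
      \<le> integral {0..2*pi} (\<lambda>t. cmod (f (r * cis t)) * poisson r w t)"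
  proof (rule integral_norm_bound_integral)
    show "(\<lambda>t. cmod (f (r * cis t)) * poisson r w t) integrable_on {0..2*pi}"
      using continuous_on_circle[OF f r] continuous_on_poisson[OF w]
      by (intro integrable_continuous_interval continuous_intros)
  qed (use poisson_formula[OF assms] poisson_nonneg[OF w] in \<open>auto simp: norm_mult\<close>)
  then show ?thesis using integral_unique[OF poisson_formula[OF assms]]
    by (simp add: norm_mult)
qed

lemma integral_poisson:
  assumes "cmod w < r"
  shows "(poisson r w has_integral 2 * pi) {0..2*pi}"
proof -
  have "0 < r" using assms norm_ge_zero[of w] by linarith
  have "((\<lambda>t. complex_of_real (poisson r w t)) has_integral complex_of_real (2 * pi)) {0..2*pi}"
    using poisson_formula[of "\<lambda>_. 1" "r + 1" r w] assms \<open>0 < r\<close> by simp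
  from has_integral_Re[OF this] show ?thesis by simp
qed

lemma poisson_le:
  assumes "cmod w < r"
  shows "poisson r w t \<le> (r + cmod w) / (r - cmod w)"
proof -
  have "0 < r" using assms norm_ge_zero[of w] by linarith
  have "r - cmod w \<le> cmod (r * cis t - w)"
    using norm_triangle_ineq2[of "r * cis t" w] \<open>0 < r\<close> by (simp add: norm_mult)
  then have "(r - cmod w)\<^sup>2 \<le> (cmod (r * cis t - w))\<^sup>2" using assms by (intro power_mono) auto
  then have "poisson r w t \<le> (r\<^sup>2 - (cmod w)\<^sup>2) / (r - cmod w)\<^sup>2"
    unfolding poisson_def using assms \<open>0 < r\<close>
    by (intro divide_left_mono) (auto intro!: mult_pos_pos zero_less_power simp: power_mono circle_neq[OF assms] less_imp_le)
  also have "\<dots> = (r + cmod w) / (r - cmod w)"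
    using assms by (simp add: divide_simps) (simp add: power2_eq_square algebra_simps)
  finally show ?thesis .
qed

section \<open>Parseval's identity and a criterion for membership in the Hardy space\<close>

lemma parseval_polynomial:
  fixes d :: "nat \<Rightarrow> complex"
  shows "((\<lambda>t. (cmod (\<Sum>k<n. d k * cis t ^ k))\<^sup>2) has_integral 2 * pi * (\<Sum>k<n. (cmod (d k))\<^sup>2)) {0..2*pi}"
proof (induction n)
  case (Suc n)
  \<comment> \<open>The cross term of the new top monomial with the earlier sum: on the circle
    conjugation inverts \<open>z\<close>, so the product is a polynomial without constant term and
    has mean zero.\<close>
  define q where "q z = d n * (\<Sum>k<n. cnj (d k) * z ^ (n - k))" for z
  have "q holomorphic_on ball 0 2" unfolding q_def by (intro holomorphic_intros)
  from circle_mean_value[OF this, of 1] have "((\<lambda>t. q (cis t)) has_integral 2 * pi * q 0) {0..2*pi}" by simp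
  moreover have "q 0 = 0" unfolding q_def by (auto intro!: sum.neutral)
  ultimately have "((\<lambda>t. q (cis t)) has_integral 0) {0..2*pi}" by simp
  from has_integral_mult_right[OF has_integral_Re[OF this], of 2]
  have cross: "((\<lambda>t. 2 * Re (q (cis t))) has_integral 0) {0..2*pi}" by simp
  have const: "((\<lambda>t. (cmod (d n))\<^sup>2) has_integral 2 * pi * (cmod (d n))\<^sup>2) {0..2*pi}"
    using has_integral_const_real[of "(cmod (d n))\<^sup>2" 0 "2*pi"] by simp
  have "(cmod (\<Sum>k<Suc n. d k * cis t ^ k))\<^sup>2
      = (cmod (\<Sum>k<n. d k * cis t ^ k))\<^sup>2 + 2 * Re (q (cis t)) + (cmod (d n))\<^sup>2" for t
  proof -
    define S where "S = (\<Sum>k<n. d k * cis t ^ k)"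
    have "cnj S * cis t ^ n = (\<Sum>k<n. cnj (d k) * cis t ^ (n - k))"
      unfolding S_def cnj_sum sum_distrib_right
    proof (intro sum.cong refl)
      fix k assume "k \<in> {..<n}"
      then have "cis t ^ n = cis t ^ k * cis t ^ (n - k)" by (simp flip: power_add)
      moreover have "cnj (cis t ^ k) * cis t ^ k = 1"
        by (metis complex_cnj_power complex_norm_square mult.commute norm_cis norm_power of_real_1 power_one)
      ultimately show "cnj (d k * cis t ^ k) * cis t ^ n = cnj (d k) * cis t ^ (n - k)"
        by (simp add: algebra_simps)
    qed
    then have q: "q (cis t) = d n * cis t ^ n * cnj S" unfolding q_def by (simp add: mult_ac)
    have "(cmod (S + d n * cis t ^ n))\<^sup>2 = (cmod S)\<^sup>2 + 2 * Re (q (cis t)) + (cmod (d n * cis t ^ n))\<^sup>2"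
      unfolding q cmod_power2 by (simp add: power2_eq_square algebra_simps)
    then show ?thesis by (simp add: S_def norm_mult norm_power)
  qed
  with has_integral_add[OF has_integral_add[OF Suc.IH cross] const]
  show ?case by (simp add: algebra_simps)
qed simp

lemma maclaurin_sums:
  assumes "f holomorphic_on unit_disc" "cmod z < 1"
  shows "(\<lambda>n. maclaurin_coeff f n * z ^ n) sums f z"
  using holomorphic_power_series[OF assms(1), of z] assms(2) by (simp add: maclaurin_coeff_def)

lemma maclaurin_abs_summable:
  fixes r :: real
  assumes "f holomorphic_on unit_disc" "0 \<le> r" "r < 1"
  shows "summable (\<lambda>n. cmod (maclaurin_coeff f n) * r ^ n)"
proof -
  obtain s where s: "r < s" "s < 1" using dense[OF assms(3)] by auto
  have "summable (\<lambda>n. maclaurin_coeff f n * complex_of_real s ^ n)"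
    using maclaurin_sums[OF assms(1), of s] s assms by (auto simp: sums_iff)
  from powser_insidea[OF this, of "complex_of_real r"] s assms show ?thesis
    by (simp add: norm_mult norm_power)
qed

lemma parseval_circle:
  fixes r :: real
  assumes f: "f holomorphic_on unit_disc" and r: "0 < r" "r < 1"
  shows "(\<lambda>n. 2 * pi * (cmod (maclaurin_coeff f n) * r ^ n)\<^sup>2) sums
           integral {0..2*pi} (\<lambda>t. (cmod (f (r * cis t)))\<^sup>2)"
proof -
  define c where "c = maclaurin_coeff f"
  define d where "d n = c n * of_real r ^ n" for n
  have sd: "summable (\<lambda>n. cmod (d n))"
    using maclaurin_abs_summable[OF f, of r] r by (simp add: d_def c_def norm_mult norm_power)
  have dc: "(\<lambda>N. integral {0..2*pi} (\<lambda>t. (cmod (\<Sum>k<N. d k * cis t ^ k))\<^sup>2))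
      \<longlonglongrightarrow> integral {0..2*pi} (\<lambda>t. (cmod (f (r * cis t)))\<^sup>2)"
  proof (rule dominated_convergence(2)[where h = "\<lambda>_. (\<Sum>n. cmod (d n))\<^sup>2"])
    show "(\<lambda>t. (cmod (\<Sum>k<N. d k * cis t ^ k))\<^sup>2) integrable_on {0..2*pi}" for N
      using parseval_polynomial[of d N] by (rule has_integral_integrable)
    fix N t
    have "cmod (\<Sum>k<N. d k * cis t ^ k) \<le> (\<Sum>k<N. cmod (d k))"
      by (rule norm_sum[THEN order_trans]) (simp add: norm_mult norm_power)
    also have "\<dots> \<le> (\<Sum>n. cmod (d n))" by (rule sum_le_suminf[OF sd]) auto
    finally show "norm ((cmod (\<Sum>k<N. d k * cis t ^ k))\<^sup>2) \<le> (\<Sum>n. cmod (d n))\<^sup>2"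
      by (simp add: power_mono)
  next
    fix t
    have "(\<lambda>n. d n * cis t ^ n) sums f (r * cis t)"
      using maclaurin_sums[OF f, of "r * cis t"] r
      by (simp add: d_def c_def norm_mult power_mult_distrib mult.assoc)
    then show "(\<lambda>N. (cmod (\<Sum>k<N. d k * cis t ^ k))\<^sup>2) \<longlonglongrightarrow> (cmod (f (r * cis t)))\<^sup>2"
      unfolding sums_def by (intro tendsto_intros)
  qed auto
  have "integral {0..2*pi} (\<lambda>t. (cmod (\<Sum>k<N. d k * cis t ^ k))\<^sup>2)
      = (\<Sum>k<N. 2 * pi * (cmod (c k) * r ^ k)\<^sup>2)" for N
    using integral_unique[OF parseval_polynomial[of d N]] r
    by (simp add: d_def norm_mult norm_power sum_distrib_left)
  with dc show ?thesis by (simp add: sums_def c_def)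
qed

text \<open>A finite partial sum is continuous in \<open>r\<close>, so the bound is carried to
  \<open>r = 1\<close> there, before the number of terms tends to infinity.\<close>

lemma hardy2_criterion:
  fixes B :: real
  assumes f: "f holomorphic_on unit_disc"
    and B: "\<forall>r. 0 < (r::real) \<longrightarrow> r < 1 \<longrightarrow> integral {0..2*pi} (\<lambda>t. (cmod (f (r * cis t)))\<^sup>2) \<le> 2 * pi * B"
  shows "summable (\<lambda>n. (cmod (maclaurin_coeff f n))\<^sup>2)" "(\<Sum>n. (cmod (maclaurin_coeff f n))\<^sup>2) \<le> B"
proof -
  define c where "c n = cmod (maclaurin_coeff f n)" for n
  have fin: "(\<Sum>k<N. (c k)\<^sup>2) \<le> B" for N
  proof (rule tendsto_upperbound)
    show "((\<lambda>r. \<Sum>k<N. (c k * r ^ k)\<^sup>2) \<longlongrightarrow> (\<Sum>k<N. (c k)\<^sup>2)) (at_left 1)"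
      by (rule tendsto_eq_intros refl | simp)+
    have "(\<Sum>k<N. (c k * r ^ k)\<^sup>2) \<le> B" if "r \<in> {0<..<1}" for r
    proof -
      from that have r: "0 < r" "r < 1" by auto
      have "(\<Sum>k<N. 2 * pi * (c k * r ^ k)\<^sup>2) \<le> integral {0..2*pi} (\<lambda>t. (cmod (f (r * cis t)))\<^sup>2)"
        using parseval_circle[OF f r] unfolding c_def sums_iff
        by (metis (no_types, lifting) sum_le_suminf finite_lessThan zero_le_power2 mult_nonneg_nonneg pi_ge_zero zero_le_numeral)
      also have "\<dots> \<le> 2 * pi * B" by (rule B[rule_format, OF r])
      finally show ?thesis by (simp flip: sum_distrib_left)
    qed
    then show "\<forall>\<^sub>F r in at_left 1. (\<Sum>k<N. (c k * r ^ k)\<^sup>2) \<le> B"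
      by (intro eventually_mono[OF eventually_at_left_real[of 0 1]]) auto
  qed simp
  show s: "summable (\<lambda>n. (cmod (maclaurin_coeff f n))\<^sup>2)"
    using summableI_nonneg_bounded[of "\<lambda>n. (c n)\<^sup>2" B] fin by (simp add: c_def)
  show "(\<Sum>n. (cmod (maclaurin_coeff f n))\<^sup>2) \<le> B"
    using suminf_le_const[OF s, of B] fin by (simp add: c_def)
qed

lemma h2_fun_holomorphic [simp]: "h2_fun f holomorphic_on unit_disc"
  using h2_fun[of f] by simp

lemma h2_fun_summable [simp]: "summable (\<lambda>n. (cmod (maclaurin_coeff (h2_fun f) n))\<^sup>2)"
  using h2_fun[of f] by simp

lemma norm_hardy2_power2: "(norm f)\<^sup>2 = (\<Sum>n. (cmod (maclaurin_coeff (h2_fun f) n))\<^sup>2)"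
  unfolding power2_norm_eq_inner inner_hardy2.rep_eq by (simp add: dot_square_norm)

lemma circle_mean_le_norm:
  fixes r :: real
  assumes "0 < r" "r < 1"
  shows "integral {0..2*pi} (\<lambda>t. (cmod (h2_fun f (r * cis t)))\<^sup>2) \<le> 2 * pi * (norm f)\<^sup>2"
proof -
  have s: "summable (\<lambda>n. 2 * pi * (cmod (maclaurin_coeff (h2_fun f) n))\<^sup>2)"
    by (intro summable_mult) simp
  have le: "2 * pi * (cmod (maclaurin_coeff (h2_fun f) n) * r ^ n)\<^sup>2 \<le> 2 * pi * (cmod (maclaurin_coeff (h2_fun f) n))\<^sup>2" for n
    using assms by (intro mult_left_mono power_mono) (auto simp: mult_left_le power_le_one)
  note p = parseval_circle[OF h2_fun_holomorphic[of f] assms]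
  have "integral {0..2*pi} (\<lambda>t. (cmod (h2_fun f (r * cis t)))\<^sup>2) \<le> (\<Sum>n. 2 * pi * (cmod (maclaurin_coeff (h2_fun f) n))\<^sup>2)"
    by (subst sums_unique[OF p], rule suminf_le[OF le]) (use p s in \<open>auto simp: sums_iff\<close>)
  then show ?thesis by (simp add: norm_hardy2_power2 suminf_mult)
qed

lemma maclaurin_coeff_cong:
  assumes "\<And>z. z \<in> unit_disc \<Longrightarrow> f z = h z"
  shows "maclaurin_coeff f n = maclaurin_coeff h n"
proof -
  have "\<forall>\<^sub>F z in nhds 0. f z = h z"
    using assms eventually_nhds_in_open[of unit_disc 0] by (auto elim: eventually_mono)
  then show ?thesis by (simp add: maclaurin_coeff_def higher_deriv_cong_ev)
qed

text \<open>The zero extension of a function on the disc; \<open>hardy2_of f\<close> is meaningful when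
  \<open>f\<close> has bounded quadratic circle means.\<close>

definition hardy2_of :: "(complex \<Rightarrow> complex) \<Rightarrow> hardy2" where
  "hardy2_of f = Abs_hardy2 (\<lambda>z. if z \<in> unit_disc then f z else 0)"

lemma hardy2_of:
  fixes B :: real
  assumes f: "f holomorphic_on unit_disc"
    and B: "\<forall>r. 0 < (r::real) \<longrightarrow> r < 1 \<longrightarrow> integral {0..2*pi} (\<lambda>t. (cmod (f (r * cis t)))\<^sup>2) \<le> 2 * pi * B"
  shows "h2_fun (hardy2_of f) = (\<lambda>z. if z \<in> unit_disc then f z else 0)"
    and "(norm (hardy2_of f))\<^sup>2 \<le> B"
proof -
  define F where "F = (\<lambda>z. if z \<in> unit_disc then f z else 0)"
  have c: "maclaurin_coeff F n = maclaurin_coeff f n" for n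
    by (rule maclaurin_coeff_cong) (simp add: F_def)
  have "F holomorphic_on unit_disc" by (rule holomorphic_transform[OF f]) (simp add: F_def)
  with hardy2_criterion[OF assms] c have "h2_fun (Abs_hardy2 F) = F"
    by (intro Abs_hardy2_inverse) (auto simp: F_def)
  then have 1: "h2_fun (hardy2_of f) = F" by (simp add: hardy2_of_def F_def)
  show "h2_fun (hardy2_of f) = (\<lambda>z. if z \<in> unit_disc then f z else 0)" by (simp add: 1 F_def)
  show "(norm (hardy2_of f))\<^sup>2 \<le> B" unfolding norm_hardy2_power2 1 c by (rule hardy2_criterion[OF assms])
qed

section \<open>Composition operators on the Hardy space\<close>

lemma hardy2_eqI:
  assumes "\<And>z. z \<in> unit_disc \<Longrightarrow> h2_fun f z = h2_fun h z"
  shows "f = h"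
proof -
  have "h2_fun f z = h2_fun h z" for z
    using assms[of z] h2_fun[of f] h2_fun[of h] by (cases "z \<in> unit_disc") auto
  then show ?thesis by (metis ext h2_fun_inject)
qed

lemma h2_fun_diff: "h2_fun (f - h) z = h2_fun f z - h2_fun h z"
  unfolding minus_hardy2_def plus_hardy2.rep_eq uminus_hardy2.rep_eq by simp

lemma maclaurin_coeff_h2_diff:
  "maclaurin_coeff (h2_fun (f - h)) n = maclaurin_coeff (h2_fun f) n - maclaurin_coeff (h2_fun h) n"
proof -
  have "h2_fun (f - h) = (\<lambda>z. h2_fun f z + - h2_fun h z)"
    by (auto simp: h2_fun_diff)
  then have "maclaurin_coeff (h2_fun (f - h)) n
      = maclaurin_coeff (h2_fun f) n + maclaurin_coeff (\<lambda>z. - h2_fun h z) n"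
    by (simp only: maclaurin_coeff_add[OF h2_fun_holomorphic holomorphic_on_minus[OF h2_fun_holomorphic]])
  then show ?thesis by (simp add: maclaurin_coeff_uminus)
qed

lemma partial_sum_le_norm: "(\<Sum>k<(K::nat). (cmod (maclaurin_coeff (h2_fun f) k))\<^sup>2) \<le> (norm f)\<^sup>2"
  unfolding norm_hardy2_power2 by (rule sum_le_suminf) auto

lemma maclaurin_coeff_le_norm: "cmod (maclaurin_coeff (h2_fun f) k) \<le> norm f"
proof -
  have "(cmod (maclaurin_coeff (h2_fun f) k))\<^sup>2 \<le> (\<Sum>j<Suc k. (cmod (maclaurin_coeff (h2_fun f) j))\<^sup>2)"
    by (rule member_le_sum) auto
  also have "\<dots> \<le> (norm f)\<^sup>2" by (rule partial_sum_le_norm)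
  finally show ?thesis by (rule power2_le_imp_le) simp
qed

text \<open>A square-summable sequence is bounded, so its power series converges in the whole disc.
  This produces the limit in the completeness proof.\<close>

lemma hardy2_with_coeffs:
  fixes a :: "nat \<Rightarrow> complex"
  assumes a: "summable (\<lambda>n. (cmod (a n))\<^sup>2)"
  obtains f where "\<And>n. maclaurin_coeff (h2_fun f) n = a n"
proof -
  have "(\<lambda>n. (cmod (a n))\<^sup>2) \<longlonglongrightarrow> 0" by (rule summable_LIMSEQ_zero[OF a])
  then have "Bseq (\<lambda>n. (cmod (a n))\<^sup>2)" by (rule convergentI[THEN convergent_imp_Bseq])
  then obtain M where M: "\<And>n. (cmod (a n))\<^sup>2 \<le> M" unfolding Bseq_def by auto
  have le: "cmod (a n) \<le> 1 + M" for n
  proof -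
    have "2 * cmod (a n) \<le> 1 + (cmod (a n))\<^sup>2"
      using zero_le_power2[of "cmod (a n) - 1"] by (simp add: power2_diff)
    with M[of n] norm_ge_zero[of "a n"] show ?thesis by linarith
  qed
  have R: "fps_conv_radius (Abs_fps a) \<ge> 1"
    unfolding fps_conv_radius_def
  proof (rule conv_radius_geI_ex)
    fix r :: real assume r: "0 < r" "ereal r < 1"
    have "summable (\<lambda>n. a n * complex_of_real r ^ n)"
    proof (rule summable_comparison_test')
      show "summable (\<lambda>n. (1 + M) * r ^ n)" using r by (intro summable_mult summable_geometric) auto
      show "norm (a n * complex_of_real r ^ n) \<le> (1 + M) * r ^ n" for n
        using r le[of n] by (simp add: norm_mult norm_power mult_right_mono)
    qed
    with r show "\<exists>z. norm z = r \<and> summable (\<lambda>n. fps_nth (Abs_fps a) n * z ^ n)"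
      by (intro exI[of _ "complex_of_real r"]) auto
  qed
  define F where "F = (\<lambda>z. if z \<in> unit_disc then eval_fps (Abs_fps a) z else 0)"
  have coeff: "maclaurin_coeff F n = a n" for n
  proof -
    have "maclaurin_coeff F n = maclaurin_coeff (eval_fps (Abs_fps a)) n"
      by (rule maclaurin_coeff_cong) (simp add: F_def)
    moreover have "fps_conv_radius (Abs_fps a) > 0" by (rule less_le_trans[OF _ R]) simp
    from fps_nth_conv_deriv[OF this, of n] have "maclaurin_coeff (eval_fps (Abs_fps a)) n = a n"
      by (simp add: maclaurin_coeff_def)
    ultimately show ?thesis by simp
  qed
  have "unit_disc \<subseteq> eball 0 (fps_conv_radius (Abs_fps a))"
    using R by (intro ball_eball_mono) (simp add: one_ereal_def)
  then have "eval_fps (Abs_fps a) holomorphic_on unit_disc"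
    by (rule holomorphic_on_subset[rotated]) (rule holomorphic_on_eval_fps, simp)
  then have "F holomorphic_on unit_disc"
    by (rule holomorphic_transform) (simp add: F_def)
  then have "h2_fun (Abs_hardy2 F) = F"
    using a coeff by (intro Abs_hardy2_inverse) (auto simp: F_def)
  then show ?thesis using coeff that[of "Abs_hardy2 F"] by simp
qed

text \<open>Limits are taken coefficient by coefficient, as for square-summable sequences. The
  Neumann series and the Baire argument below both rely on completeness.\<close>

instance hardy2 :: banach
proof
  fix X :: "nat \<Rightarrow> hardy2" assume X: "Cauchy X"
  define c where "c n k = maclaurin_coeff (h2_fun (X n)) k" for n k
  have "Cauchy (\<lambda>n. c n k)" for k
  proof (rule metric_CauchyI)
    fix e :: real assume "e > 0"
    then obtain N where N: "\<And>m n. m \<ge> N \<Longrightarrow> n \<ge> N \<Longrightarrow> dist (X m) (X n) < e"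
      using metric_CauchyD[OF X] by blast
    have "dist (c m k) (c n k) \<le> dist (X m) (X n)" for m n
      using maclaurin_coeff_le_norm[of "X m - X n" k]
      by (simp add: maclaurin_coeff_h2_diff c_def dist_norm)
    with N show "\<exists>N. \<forall>m\<ge>N. \<forall>n\<ge>N. dist (c m k) (c n k) < e" by (meson le_less_trans)
  qed
  then have "\<exists>l. (\<lambda>n. c n k) \<longlonglongrightarrow> l" for k using Cauchy_convergent convergentD by blast
  then obtain l where l: "\<And>k. (\<lambda>n. c n k) \<longlonglongrightarrow> l k" by metis
  \<comment> \<open>The bound is uniform in \<open>K\<close>, so \<open>m\<close> can tend to
    infinity inside a finite sum and \<open>K\<close> afterwards.\<close>
  have est: "\<exists>N. \<forall>n\<ge>N. \<forall>K. (\<Sum>k<K. (cmod (c n k - l k))\<^sup>2) \<le> e\<^sup>2" if "e > 0" for e :: real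
  proof -
    from that obtain N where N: "\<And>m n. m \<ge> N \<Longrightarrow> n \<ge> N \<Longrightarrow> dist (X m) (X n) < e"
      using metric_CauchyD[OF X] by blast
    have "(\<Sum>k<K. (cmod (c n k - l k))\<^sup>2) \<le> e\<^sup>2" if n: "n \<ge> N" for n K
    proof (rule LIMSEQ_le_const2)
      show "(\<lambda>m. \<Sum>k<K. (cmod (c n k - c m k))\<^sup>2) \<longlonglongrightarrow> (\<Sum>k<K. (cmod (c n k - l k))\<^sup>2)"
        by (intro tendsto_intros l)
      have "(\<Sum>k<K. (cmod (c n k - c m k))\<^sup>2) \<le> e\<^sup>2" if "m \<ge> N" for m
      proof -
        have "(\<Sum>k<K. (cmod (c n k - c m k))\<^sup>2) \<le> (norm (X n - X m))\<^sup>2"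
          using partial_sum_le_norm[of "X n - X m" K] by (simp add: maclaurin_coeff_h2_diff c_def)
        also have "\<dots> \<le> e\<^sup>2" using N[OF n that] by (intro power_mono) (auto simp: dist_norm)
        finally show ?thesis .
      qed
      then show "\<exists>N. \<forall>m\<ge>N. (\<Sum>k<K. (cmod (c n k - c m k))\<^sup>2) \<le> e\<^sup>2" by blast
    qed
    then show ?thesis by blast
  qed
  obtain N where N: "\<And>K. (\<Sum>k<K. (cmod (c N k - l k))\<^sup>2) \<le> 1\<^sup>2" using est[of 1] by auto
  have "summable (\<lambda>k. (cmod (c N k - l k))\<^sup>2)"
    by (rule summableI_nonneg_bounded[where x = "1\<^sup>2"]) (use N in auto)
  moreover have "summable (\<lambda>k. (cmod (c N k))\<^sup>2)" by (simp add: c_def)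
  ultimately have "summable (\<lambda>k. (cmod (c N k + - (c N k - l k)))\<^sup>2)"
    by (intro square_summable_add) (simp_all only: norm_minus_cancel)
  then have "summable (\<lambda>k. (cmod (l k))\<^sup>2)" by simp
  then obtain f where f: "\<And>k. maclaurin_coeff (h2_fun f) k = l k" using hardy2_with_coeffs by blast
  have "X \<longlonglongrightarrow> f"
  proof (rule metric_LIMSEQ_I)
    fix e :: real assume "e > 0"
    then obtain N where N: "\<And>n K. n \<ge> N \<Longrightarrow> (\<Sum>k<K. (cmod (c n k - l k))\<^sup>2) \<le> (e/2)\<^sup>2"
      using est[of "e/2"] by auto
    have "dist (X n) f < e" if "n \<ge> N" for n
    proof -
      have "(norm (X n - f))\<^sup>2 \<le> (e/2)\<^sup>2"
        unfolding norm_hardy2_power2 using N[OF that]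
        by (intro suminf_le_const) (auto simp: maclaurin_coeff_h2_diff f c_def intro!: summableI_nonneg_bounded[where x = "(e/2)\<^sup>2"])
      then have "norm (X n - f) \<le> e/2" by (rule power2_le_imp_le) (use \<open>e > 0\<close> in simp)
      with \<open>e > 0\<close> show ?thesis by (simp add: dist_norm)
    qed
    then show "\<exists>N. \<forall>n\<ge>N. dist (X n) f < e" by blast
  qed
  then show "convergent X" by (rule convergentI)
qed

section \<open>Littlewood's theorem and weighted composition operators\<close>

lemma analytic_selfmapD:
  assumes "analytic_selfmap \<phi>"
  shows "\<phi> holomorphic_on unit_disc" "cmod z < 1 \<Longrightarrow> cmod (\<phi> z) < 1"
  using assms by (auto simp: analytic_selfmap_def image_subset_iff)

text \<open>At an image point of \<open>\<phi>\<close> the squared modulus of \<open>f\<close> is at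
  most the Poisson integral of its values on a circle of radius \<open>\<rho> < 1\<close>. After
  exchanging the integrals, harmonicity of the kernel replaces the image point by
  \<open>\<phi> 0\<close>, where the kernel is at most \<open>(\<rho> + p) / (\<rho> - p)\<close>.
  Finally \<open>\<rho>\<close> tends to 1.\<close>

lemma Littlewood_subordination:
  fixes s :: real
  assumes \<phi>: "analytic_selfmap \<phi>" and s: "0 < s" "s < 1"
  shows "integral {0..2*pi} (\<lambda>t. (cmod (h2_fun f (\<phi> (s * cis t))))\<^sup>2)
      \<le> 2 * pi * ((1 + cmod (\<phi> 0)) / (1 - cmod (\<phi> 0)) * (norm f)\<^sup>2)"
proof -
  have hol: "\<phi> holomorphic_on unit_disc" and im: "\<And>z. cmod z < 1 \<Longrightarrow> cmod (\<phi> z) < 1"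
    using analytic_selfmapD[OF \<phi>] by auto
  \<comment> \<open>A radius beyond \<open>s\<close>: the mean value property on the circle of
    radius \<open>s\<close> requires holomorphy on a larger disc, and \<open>\<rho>0\<close> has to
    bound \<open>\<phi>\<close> there to keep the kernel regular.\<close>
  define s' where "s' = (1 + s) / 2"
  have s': "s < s'" "s' < 1" "0 < s'" using s by (auto simp: s'_def)
  have "continuous_on (cball 0 s') (\<lambda>z. cmod (\<phi> z))"
    using s' by (intro continuous_on_norm holomorphic_on_imp_continuous_on holomorphic_on_subset[OF hol]) auto
  from continuous_attains_sup[OF compact_cball _ this] s'
  obtain z0 where z0: "z0 \<in> cball 0 s'" "\<And>z. z \<in> cball 0 s' \<Longrightarrow> cmod (\<phi> z) \<le> cmod (\<phi> z0)" by auto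
  define \<rho>0 where "\<rho>0 = cmod (\<phi> z0)"
  have \<rho>0: "0 \<le> \<rho>0" "\<rho>0 < 1" "\<And>z. cmod z \<le> s' \<Longrightarrow> cmod (\<phi> z) \<le> \<rho>0"
    using z0 im s' by (auto simp: \<rho>0_def)
  define p where "p = cmod (\<phi> 0)"
  have p: "0 \<le> p" "p \<le> \<rho>0" using \<rho>0(3)[of 0] s' by (auto simp: p_def)
  define I where "I = integral {0..2*pi} (\<lambda>t. (cmod (h2_fun f (\<phi> (s * cis t))))\<^sup>2)"
  have main: "I \<le> 2 * pi * ((\<rho> + p) / (\<rho> - p) * (norm f)\<^sup>2)" if \<rho>: "\<rho>0 < \<rho>" "\<rho> < 1" for \<rho>
  proof -
    have \<rho>pos: "0 < \<rho>" using \<rho> \<rho>0 by simp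
    define u where "u t = \<phi> (s * cis t)" for t
    have u: "cmod (u t) < \<rho>" for t
      using \<rho>0(3)[of "s * cis t"] s s' \<rho> by (simp add: u_def norm_mult)
    have cu: "continuous_on UNIV u"
      unfolding u_def using s hol by (intro continuous_on_circle[of \<phi> 1]) auto
    define v where "v \<theta> = (cmod (h2_fun f (\<rho> * cis \<theta>)))\<^sup>2" for \<theta>
    have cv: "continuous_on UNIV v"
      unfolding v_def using \<rho> \<rho>pos by (intro continuous_intros continuous_on_circle[OF h2_fun_holomorphic]) auto
    have joint: "continuous_on S (\<lambda>x. v (snd x) * poisson \<rho> (u (fst x)) (snd x))" for S :: "(real \<times> real) set"
      unfolding poisson_def using circle_neq[OF u]
      by (intro continuous_intros continuous_on_compose2[OF cu] continuous_on_compose2[OF cv]) auto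
    have joint': "continuous_on S (\<lambda>(t, \<theta>). v \<theta> * poisson \<rho> (u t) \<theta>)" for S
      using joint[of S] by (simp add: case_prod_beta)
    have mean: "((\<lambda>t. poisson \<rho> (u t) \<theta>) has_integral 2 * pi * poisson \<rho> (\<phi> 0) \<theta>) {0..2*pi}" for \<theta>
    proof -
      define h where "h z = (\<rho> * cis \<theta> + \<phi> z) / (\<rho> * cis \<theta> - \<phi> z)" for z
      have lt: "cmod (\<phi> z) < \<rho>" if "z \<in> ball 0 s'" for z
        using \<rho>0(3)[of z] that \<rho> by auto
      have "h holomorphic_on ball 0 s'"
        unfolding h_def using circle_neq[OF lt] s'
        by (intro holomorphic_intros holomorphic_on_subset[OF hol]) auto
      from circle_mean_value[OF this s(1) s'(1)]
      have "((\<lambda>t. h (s * cis t)) has_integral 2 * pi * h 0) {0..2*pi}" .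
      from has_integral_Re[OF this] show ?thesis
        using poisson_eq_Re[OF u] poisson_eq_Re[OF lt[of 0]] s'
        by (simp add: h_def u_def flip: of_real_mult) (simp add: mult.assoc flip: times_divide_eq_right)
    qed
    have "2 * pi * I = integral {0..2*pi} (\<lambda>t. 2 * pi * (cmod (h2_fun f (u t)))\<^sup>2)"
      by (simp add: I_def u_def)
    also have "\<dots> \<le> integral {0..2*pi} (\<lambda>t. integral {0..2*pi} (\<lambda>\<theta>. v \<theta> * poisson \<rho> (u t) \<theta>))"
    proof (rule integral_le)
      show "(\<lambda>t. 2 * pi * (cmod (h2_fun f (u t)))\<^sup>2) integrable_on {0..2*pi}"
        using u \<rho>
        by (intro integrable_continuous_interval continuous_intros
            continuous_on_compose2[OF holomorphic_on_imp_continuous_on[OF h2_fun_holomorphic[of f]]]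
            continuous_on_subset[OF cu]) (use less_trans[OF u \<rho>(2)] in auto)
      show "(\<lambda>t. integral {0..2*pi} (\<lambda>\<theta>. v \<theta> * poisson \<rho> (u t) \<theta>)) integrable_on {0..2*pi}"
        using integral_integrable_2dim[of 0 0 "2*pi" "2*pi" "\<lambda>(t, \<theta>). v \<theta> * poisson \<rho> (u t) \<theta>", OF joint'] by simp
      fix t
      \<comment> \<open>Squaring \<open>f\<close> before the Poisson inequality is applied yields
        the squared modulus directly.\<close>
      have "(\<lambda>z. (h2_fun f z)\<^sup>2) holomorphic_on unit_disc" by (intro holomorphic_intros) simp
      from poisson_norm_le[OF this \<rho>pos \<rho>(2) u[of t]]
      show "2 * pi * (cmod (h2_fun f (u t)))\<^sup>2 \<le> integral {0..2*pi} (\<lambda>\<theta>. v \<theta> * poisson \<rho> (u t) \<theta>)"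
        by (simp add: norm_power v_def)
    qed
    also have "\<dots> = integral {0..2*pi} (\<lambda>\<theta>. integral {0..2*pi} (\<lambda>t. v \<theta> * poisson \<rho> (u t) \<theta>))"
      using integral_swap_continuous[of 0 0 "2*pi" "2*pi" "\<lambda>t \<theta>. v \<theta> * poisson \<rho> (u t) \<theta>", OF joint'] by simp
    also have "\<dots> = integral {0..2*pi} (\<lambda>\<theta>. v \<theta> * (2 * pi * poisson \<rho> (\<phi> 0) \<theta>))"
      using integral_unique[OF mean] by simp
    also have "\<dots> \<le> integral {0..2*pi} (\<lambda>\<theta>. (2 * pi * ((\<rho> + p) / (\<rho> - p))) * v \<theta>)"
    proof (rule integral_le)
      have "cmod (\<phi> 0) < \<rho>" using p \<rho> by (simp add: p_def)
      then show "(\<lambda>\<theta>. v \<theta> * (2 * pi * poisson \<rho> (\<phi> 0) \<theta>)) integrable_on {0..2*pi}"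
        by (intro integrable_continuous_interval continuous_intros continuous_on_subset[OF cv] continuous_on_poisson) auto
      show "(\<lambda>\<theta>. (2 * pi * ((\<rho> + p) / (\<rho> - p))) * v \<theta>) integrable_on {0..2*pi}"
        by (intro integrable_continuous_interval continuous_intros continuous_on_subset[OF cv]) auto
      show "v \<theta> * (2 * pi * poisson \<rho> (\<phi> 0) \<theta>) \<le> (2 * pi * ((\<rho> + p) / (\<rho> - p))) * v \<theta>" for \<theta>
      proof -
        have "2 * pi * poisson \<rho> (\<phi> 0) \<theta> \<le> 2 * pi * ((\<rho> + p) / (\<rho> - p))"
          using poisson_le[OF \<open>cmod (\<phi> 0) < \<rho>\<close>, of \<theta>] unfolding p_def by (intro mult_left_mono) auto
        moreover have "0 \<le> v \<theta>" by (simp add: v_def)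
        ultimately show ?thesis by (metis mult.commute mult_left_mono)
      qed
    qed
    also have "\<dots> = (2 * pi * ((\<rho> + p) / (\<rho> - p))) * integral {0..2*pi} v" by simp
    also have "\<dots> \<le> (2 * pi * ((\<rho> + p) / (\<rho> - p))) * (2 * pi * (norm f)\<^sup>2)"
      using circle_mean_le_norm[OF \<rho>pos \<rho>(2), of f] p \<rho> unfolding v_def
      by (intro mult_left_mono) auto
    finally have "(2 * pi) * I \<le> (2 * pi) * (2 * pi * ((\<rho> + p) / (\<rho> - p) * (norm f)\<^sup>2))"
      by (simp only: mult_ac)
    then show ?thesis by (subst (asm) mult_le_cancel_left_pos) auto
  qed
  have "I \<le> 2 * pi * ((1 + p) / (1 - p) * (norm f)\<^sup>2)"
  proof (rule tendsto_lowerbound)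
    show "((\<lambda>\<rho>. 2 * pi * ((\<rho> + p) / (\<rho> - p) * (norm f)\<^sup>2)) \<longlongrightarrow> 2 * pi * ((1 + p) / (1 - p) * (norm f)\<^sup>2)) (at_left 1)"
      using p \<rho>0 by (intro tendsto_intros) auto
    show "\<forall>\<^sub>F \<rho> in at_left 1. I \<le> 2 * pi * ((\<rho> + p) / (\<rho> - p) * (norm f)\<^sup>2)"
      using main \<rho>0 by (intro eventually_mono[OF eventually_at_left_real[of \<rho>0 1]]) auto
  qed simp
  then show ?thesis by (simp add: I_def p_def)
qed

definition comp_bound :: "(complex \<Rightarrow> complex) \<Rightarrow> real" where
  "comp_bound \<phi> = sqrt ((1 + cmod (\<phi> 0)) / (1 - cmod (\<phi> 0)))"

lemma comp_bound_nonneg: "analytic_selfmap \<phi> \<Longrightarrow> 0 \<le> comp_bound \<phi>"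
  using analytic_selfmapD(2)[of \<phi> 0] by (simp add: comp_bound_def)

lemma weighted_comp_op:
  assumes \<phi>: "analytic_selfmap \<phi>" and g: "g holomorphic_on unit_disc"
    and M: "\<forall>z\<in>unit_disc. cmod (g z) \<le> M"
  shows h2_fun_weighted_comp_op:
      "z \<in> unit_disc \<Longrightarrow> h2_fun (weighted_comp_op g \<phi> f) z = g z * h2_fun f (\<phi> z)"
    and norm_weighted_comp_op: "norm (weighted_comp_op g \<phi> f) \<le> M * comp_bound \<phi> * norm f"
proof -
  define K where "K = (1 + cmod (\<phi> 0)) / (1 - cmod (\<phi> 0))"
  have hol: "\<phi> holomorphic_on unit_disc" and im: "\<And>z. cmod z < 1 \<Longrightarrow> cmod (\<phi> z) < 1"
    using analytic_selfmapD[OF \<phi>] by auto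
  have M0: "0 \<le> M" using M[rule_format, of 0] norm_ge_zero[of "g 0"] by (simp del: norm_ge_zero)
  define F where "F z = g z * h2_fun f (\<phi> z)" for z
  have hc: "(\<lambda>z. h2_fun f (\<phi> z)) holomorphic_on unit_disc"
    using holomorphic_on_compose_gen[OF hol h2_fun_holomorphic[of f]] im by (auto simp: o_def image_subset_iff)
  have Fhol: "F holomorphic_on unit_disc" unfolding F_def by (intro holomorphic_intros g hc)
  have "integral {0..2*pi} (\<lambda>t. (cmod (F (r * cis t)))\<^sup>2) \<le> 2 * pi * (M\<^sup>2 * (K * (norm f)\<^sup>2))"
    if r: "0 < r" "r < 1" for r :: real
  proof -
    have "integral {0..2*pi} (\<lambda>t. (cmod (F (r * cis t)))\<^sup>2)
        \<le> integral {0..2*pi} (\<lambda>t. M\<^sup>2 * (cmod (h2_fun f (\<phi> (r * cis t))))\<^sup>2)"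
    proof (rule integral_le)
      show "(\<lambda>t. (cmod (F (r * cis t)))\<^sup>2) integrable_on {0..2*pi}"
        by (intro integrable_continuous_interval continuous_intros continuous_on_circle[OF Fhol] r)
      show "(\<lambda>t. M\<^sup>2 * (cmod (h2_fun f (\<phi> (r * cis t))))\<^sup>2) integrable_on {0..2*pi}"
        by (intro integrable_continuous_interval continuous_intros continuous_on_circle[OF hc] r)
      show "(cmod (F (r * cis t)))\<^sup>2 \<le> M\<^sup>2 * (cmod (h2_fun f (\<phi> (r * cis t))))\<^sup>2" for t
        using M[rule_format, of "r * cis t"] r unfolding F_def norm_mult power_mult_distrib
        by (intro mult_right_mono power_mono) (auto simp: norm_mult)
    qed
    also have "\<dots> = M\<^sup>2 * integral {0..2*pi} (\<lambda>t. (cmod (h2_fun f (\<phi> (r * cis t))))\<^sup>2)" by simp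
    also have "\<dots> \<le> M\<^sup>2 * (2 * pi * (K * (norm f)\<^sup>2))"
      unfolding K_def by (intro mult_left_mono Littlewood_subordination[OF \<phi> r]) auto
    finally show ?thesis by (simp add: mult_ac)
  qed
  then have Fb: "\<forall>r. 0 < (r::real) \<longrightarrow> r < 1 \<longrightarrow> integral {0..2*pi} (\<lambda>t. (cmod (F (r * cis t)))\<^sup>2) \<le> 2 * pi * (M\<^sup>2 * (K * (norm f)\<^sup>2))"
    by blast
  have eq: "weighted_comp_op g \<phi> f = hardy2_of F" unfolding weighted_comp_op_def hardy2_of_def F_def ..
  show "h2_fun (weighted_comp_op g \<phi> f) z = g z * h2_fun f (\<phi> z)" if "z \<in> unit_disc"
    unfolding eq hardy2_of(1)[OF Fhol Fb] using that by (simp add: F_def)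
  have "(norm (weighted_comp_op g \<phi> f))\<^sup>2 \<le> M\<^sup>2 * (K * (norm f)\<^sup>2)"
    unfolding eq by (rule hardy2_of(2)[OF Fhol Fb])
  also have "\<dots> = (M * comp_bound \<phi> * norm f)\<^sup>2"
    using im[of 0] by (simp add: comp_bound_def K_def power_mult_distrib)
  finally show "norm (weighted_comp_op g \<phi> f) \<le> M * comp_bound \<phi> * norm f"
    by (rule power2_le_imp_le) (simp add: M0 comp_bound_nonneg[OF \<phi>])
qed

lemma hardy_infE:
  assumes "g \<in> hardy_inf"
  obtains M where "0 < M" "g holomorphic_on unit_disc" "\<forall>z\<in>unit_disc. cmod (g z) \<le> M"
  using assms unfolding hardy_inf_def bounded_pos by auto

lemma bounded_clinear_weighted_comp_op:
  assumes \<phi>: "analytic_selfmap \<phi>" and g: "g \<in> hardy_inf"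
  shows "bounded_clinear (weighted_comp_op g \<phi>)"
proof -
  obtain M where M: "g holomorphic_on unit_disc" "\<forall>z\<in>unit_disc. cmod (g z) \<le> M"
    using hardy_infE[OF g] by metis
  note h = h2_fun_weighted_comp_op[OF \<phi> M]
  note pt = analytic_selfmapD(2)[OF \<phi>]
  show ?thesis
    unfolding bounded_clinear_def
  proof (intro conjI allI)
    show "bounded_linear (weighted_comp_op g \<phi>)"
    proof (rule bounded_linear_intro)
      show "weighted_comp_op g \<phi> (x + y) = weighted_comp_op g \<phi> x + weighted_comp_op g \<phi> y" for x y
        by (rule hardy2_eqI) (simp add: h pt plus_hardy2.rep_eq algebra_simps)
      show "weighted_comp_op g \<phi> (r *\<^sub>R x) = r *\<^sub>R weighted_comp_op g \<phi> x" for r x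
        by (rule hardy2_eqI) (simp add: h pt scaleR_hardy2.rep_eq algebra_simps)
      show "norm (weighted_comp_op g \<phi> x) \<le> norm x * (M * comp_bound \<phi>)" for x
        using norm_weighted_comp_op[OF \<phi> M, of x] by (simp add: mult_ac)
    qed
    show "weighted_comp_op g \<phi> (c *\<^sub>C x) = c *\<^sub>C weighted_comp_op g \<phi> x" for c x
      by (rule hardy2_eqI) (simp add: h pt scaleC_hardy2.rep_eq algebra_simps)
  qed
qed

lemma analytic_selfmap_funpow:
  assumes "analytic_selfmap \<phi>"
  shows "analytic_selfmap (\<phi> ^^ n)"
proof (induction n)
  case (Suc n)
  then have "(\<phi> ^^ n) holomorphic_on unit_disc" "(\<phi> ^^ n) ` unit_disc \<subseteq> unit_disc"
    and "\<phi> holomorphic_on unit_disc" "\<phi> ` unit_disc \<subseteq> unit_disc"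
    using assms by (auto simp: analytic_selfmap_def)
  then show ?case using holomorphic_on_compose_gen[of "\<phi> ^^ n" unit_disc \<phi> unit_disc]
    by (auto simp: analytic_selfmap_def image_subset_iff comp_def)
qed (simp add: analytic_selfmap_def)

lemma weighted_comp_op_funpow:
  assumes \<phi>: "analytic_selfmap \<phi>" and g: "g \<in> hardy_inf" and z: "z \<in> unit_disc"
  shows "h2_fun ((weighted_comp_op g \<phi> ^^ n) f) z = (\<Prod>k<n. g ((\<phi> ^^ k) z)) * h2_fun f ((\<phi> ^^ n) z)"
  using z
proof (induction n arbitrary: z)
  case (Suc n)
  obtain M where M: "g holomorphic_on unit_disc" "\<forall>z\<in>unit_disc. cmod (g z) \<le> M"
    using hardy_infE[OF g] by metis
  have "\<phi> z \<in> unit_disc" using analytic_selfmapD(2)[OF \<phi>, of z] Suc.prems by simp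
  then have "h2_fun ((weighted_comp_op g \<phi> ^^ Suc n) f) z
      = g z * ((\<Prod>k<n. g ((\<phi> ^^ k) (\<phi> z))) * h2_fun f ((\<phi> ^^ n) (\<phi> z)))"
    using Suc h2_fun_weighted_comp_op[OF \<phi> M, of z "(weighted_comp_op g \<phi> ^^ n) f"] by simp
  then show ?case
    by (simp add: prod.lessThan_Suc_shift funpow_Suc_right del: prod.lessThan_Suc funpow.simps)
qed simp

section \<open>Spectra and Fredholm operators\<close>

lemma bounded_clinearD:
  assumes "bounded_clinear T"
  shows "bounded_linear T" "T (c *\<^sub>C x) = c *\<^sub>C T x"
  using assms by (simp_all add: bounded_clinear_def)

lemma bounded_linear_scaleC: "bounded_linear (\<lambda>x::'a::complex_normed_vector. c *\<^sub>C x)"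
proof (rule bounded_linear_intro)
  show "c *\<^sub>C (r *\<^sub>R x) = r *\<^sub>R (c *\<^sub>C x)" for r and x :: 'a
    by (simp add: scaleR_scaleC scaleC_scaleC mult.commute)
  show "norm (c *\<^sub>C x) \<le> norm x * cmod c" for x :: 'a
    by (simp add: norm_scaleC)
qed (rule scaleC_add_right)

text \<open>The resolvent is minus the sum of T^n / l^(n+1), formed pointwise. Since the hypothesis
  bounds all powers up to a constant \<open>C\<close>, it covers operators whose norm exceeds
  \<open>cmod l\<close> while their spectral radius is smaller.\<close>

lemma Neumann_invertible:
  fixes T :: "'a::{banach, complex_normed_vector} \<Rightarrow> 'a" and C q :: real
  assumes T: "bounded_clinear T" and l: "l \<noteq> 0" and q: "0 \<le> q" "q < 1"
    and bound: "\<And>n x. norm ((T ^^ n) x) \<le> C * (cmod l * q) ^ n * norm x"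
  shows "invertible_operator (\<lambda>x. T x - l *\<^sub>C x)"
proof -
  note bl = bounded_clinearD(1)[OF T] and cl = bounded_clinearD(2)[OF T]
  interpret T: bounded_linear T by (rule bl)
  define s where "s n x = inverse (l ^ Suc n) *\<^sub>C (T ^^ n) x" for n x
  have bn: "norm (s n x) \<le> C / cmod l * norm x * q ^ n" for n x
  proof -
    have "norm (s n x) = norm ((T ^^ n) x) / cmod l ^ Suc n"
      by (simp add: s_def norm_scaleC norm_inverse norm_mult norm_power divide_inverse mult.commute)
    also have "\<dots> \<le> (C * (cmod l * q) ^ n * norm x) / cmod l ^ Suc n"
      by (intro divide_right_mono bound) auto
    also have "\<dots> = C / cmod l * norm x * q ^ n"
      using l by (simp add: power_mult_distrib field_simps)
    finally show ?thesis .
  qed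
  have sq: "summable (\<lambda>n. C / cmod l * norm x * q ^ n)" for x :: 'a
    using q by (intro summable_mult summable_geometric) auto
  have sn: "summable (\<lambda>n. norm (s n x))" for x
    by (rule summable_comparison_test'[OF sq]) (use bn in auto)
  have ss: "summable (\<lambda>n. s n x)" for x by (rule summable_norm_cancel[OF sn])
  have Tn: "(T ^^ n) (x + y) = (T ^^ n) x + (T ^^ n) y" "(T ^^ n) (x - y) = (T ^^ n) x - (T ^^ n) y"
      "(T ^^ n) (c *\<^sub>C x) = c *\<^sub>C (T ^^ n) x" for n x y c
    by (induction n) (auto simp: T.add T.diff cl)
  have ss': "summable (\<lambda>n. s (Suc n) x)" for x
    using ss[of x] summable_Suc_iff[of "\<lambda>n. s n x"] by blast
  define S where "S x = - (\<Sum>n. s n x)" for x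
  have sT: "s n (T x) = l *\<^sub>C s (Suc n) x" "T (s n x) = l *\<^sub>C s (Suc n) x" for n x
    using l by (auto simp: s_def scaleC_scaleC cl funpow_swap1)
  \<comment> \<open>Shifting the index drops the term for \<open>n = 0\<close>, which becomes
    \<open>x\<close> after multiplication by \<open>l\<close>; both inverse identities reduce to
    this.\<close>
  have tail: "(\<Sum>n. l *\<^sub>C s (Suc n) x) = l *\<^sub>C (\<Sum>n. s n x) - x" for x
  proof -
    from bounded_linear.suminf[OF bounded_linear_scaleC ss', of l]
    have "(\<Sum>n. l *\<^sub>C s (Suc n) x) = l *\<^sub>C (\<Sum>n. s (Suc n) x)" by (rule sym)
    also have "(\<Sum>n. s (Suc n) x) = (\<Sum>n. s n x) - s 0 x" by (rule suminf_split_head[OF ss])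
    also have "l *\<^sub>C \<dots> = l *\<^sub>C (\<Sum>n. s n x) - l *\<^sub>C s 0 x" by (rule complex_vector.scale_right_diff_distrib)
    also have "l *\<^sub>C s 0 x = x" using l unfolding s_def scaleC_scaleC by (simp add: scaleC_one)
    finally show ?thesis .
  qed
  have TS: "T (S x) - l *\<^sub>C S x = x" for x
  proof -
    have "T (S x) = - (\<Sum>n. T (s n x))"
      unfolding S_def linear_neg[OF bounded_linear.linear[OF bl]] bounded_linear.suminf[OF bl ss[of x]] ..
    also have "\<dots> = x - l *\<^sub>C (\<Sum>n. s n x)"
      unfolding sT tail by simp
    finally show ?thesis
      by (simp add: S_def)
  qed
  have ST: "S (T x - l *\<^sub>C x) = x" for x
  proof -
    have "s n (T x - l *\<^sub>C x) = s n (T x) - l *\<^sub>C s n x" for n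
      unfolding s_def Tn complex_vector.scale_right_diff_distrib scaleC_scaleC by (simp only: mult.commute)
    then have "S (T x - l *\<^sub>C x) = - (\<Sum>n. l *\<^sub>C s (Suc n) x - l *\<^sub>C s n x)"
      unfolding S_def sT by simp
    also have "\<dots> = - ((\<Sum>n. l *\<^sub>C s (Suc n) x) - (\<Sum>n. l *\<^sub>C s n x))"
      by (subst suminf_diff) (auto intro!: bounded_linear.summable[OF bounded_linear_scaleC] ss ss')
    also have "(\<Sum>n. l *\<^sub>C s n x) = l *\<^sub>C (\<Sum>n. s n x)"
      using bounded_linear.suminf[OF bounded_linear_scaleC ss[of x]] by simp
    finally show ?thesis by (simp add: tail)
  qed
  have "bounded_clinear S"
    unfolding bounded_clinear_def
  proof (intro conjI allI)
    show sc: "S (c *\<^sub>C x) = c *\<^sub>C S x" for c x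
    proof -
      have "s n (c *\<^sub>C x) = c *\<^sub>C s n x" for n unfolding s_def Tn scaleC_scaleC by (simp only: mult.commute)
      then show ?thesis using bounded_linear.suminf[OF bounded_linear_scaleC ss[of x], of c] by (simp add: S_def)
    qed
    show "bounded_linear S"
    proof (rule bounded_linear_intro)
      show "S (x + y) = S x + S y" for x y
      proof -
        have "s n (x + y) = s n x + s n y" for n unfolding s_def Tn scaleC_add_right ..
        then show ?thesis by (simp add: S_def suminf_add[OF ss ss, symmetric])
      qed
      show "S (r *\<^sub>R x) = r *\<^sub>R S x" for r x by (simp add: scaleR_scaleC sc)
      show "norm (S x) \<le> norm x * (C / cmod l * (\<Sum>n. q ^ n))" for x
      proof -
        have "norm (S x) \<le> (\<Sum>n. norm (s n x))" unfolding S_def norm_minus_cancel by (rule summable_norm[OF sn])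
        also have "\<dots> \<le> (\<Sum>n. C / cmod l * norm x * q ^ n)" by (rule suminf_le[OF bn sn sq])
        also have "\<dots> = C / cmod l * norm x * (\<Sum>n. q ^ n)" using q by (intro suminf_mult summable_geometric) auto
        finally show ?thesis by (simp add: mult_ac)
      qed
    qed
  qed
  moreover have "bounded_clinear (\<lambda>x. T x - l *\<^sub>C x)"
    unfolding bounded_clinear_def
    using bounded_linear_sub[OF bl bounded_linear_scaleC]
    unfolding cl complex_vector.scale_right_diff_distrib scaleC_scaleC by (simp add: mult.commute)
  ultimately show ?thesis
    unfolding invertible_operator_def using TS ST by (auto simp: fun_eq_iff intro!: exI[of _ S])
qed

section \<open>Closed range and Fredholm operators\<close>

lemma invertible_imp_Fredholm:
  assumes "invertible_operator T"
  shows "Fredholm T"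
proof -
  obtain S where S: "bounded_clinear T" "S \<circ> T = id" "T \<circ> S = id"
    using assms by (auto simp: invertible_operator_def)
  have "range T = UNIV" using S(3) by (metis comp_apply id_apply surjI)
  moreover have "x = 0" if "T x = 0" for x
  proof -
    have "T 0 = 0" using bounded_clinearD(1)[OF S(1)] by (simp add: linear_simps)
    with that S(2) show ?thesis by (metis comp_apply id_apply)
  qed
  ultimately show ?thesis
    using S(1) by (auto simp: Fredholm_def intro!: exI[of _ "{}"])
qed

text \<open>The open mapping theorem for \<open>T\<close> onto its range, which is complete because
  it is closed. When \<open>T\<close> has a kernel, a given preimage can be arbitrarily long, hence
  a new preimage \<open>x'\<close>.\<close>

lemma closed_range_lift_bounded:
  fixes T :: "'a::banach \<Rightarrow> 'b::banach"
  assumes T: "bounded_linear T" and cl: "closed (range T)"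
  obtains C where "C \<ge> 0" "\<And>x. \<exists>x'. T x' = T x \<and> norm x' \<le> C * norm (T x)"
proof -
  interpret T: bounded_linear T by (rule T)
  define R where "R = range T"
  define A where "A n = closure (T ` ball 0 (real n))" for n
  have sub: "subspace R" unfolding R_def by (rule linear_subspace_image[OF T.linear_axioms subspace_UNIV])
  have AR: "A n \<subseteq> R" for n unfolding A_def R_def using cl by (intro closure_minimal) auto
  have UN: "(\<Union>n. A n) = R"
  proof
    show "R \<subseteq> (\<Union>n. A n)"
    proof
      fix y assume "y \<in> R"
      then obtain x where x: "y = T x" by (auto simp: R_def)
      obtain n where "norm x < real n" using reals_Archimedean2 by blast
      then have "y \<in> A n" using x closure_subset[of "T ` ball 0 (real n)"] by (auto simp: A_def)
      then show "y \<in> (\<Union>n. A n)" by blast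
    qed
  qed (use AR in blast)
  have "\<exists>n. top_of_set R interior_of A n \<noteq> {}"
  proof (rule ccontr)
    assume "\<not> ?thesis"
    then have emp: "top_of_set R interior_of A n = {}" for n by blast
    have "top_of_set R interior_of \<Union>(range A) = {}"
    proof (rule Baire_category_alt)
      show "completely_metrizable_space (top_of_set R) \<or> locally_compact_space (top_of_set R) \<and> regular_space (top_of_set R)"
        using cl by (auto simp: R_def intro!: completely_metrizable_space_closedin[OF completely_metrizable_space_euclidean])
      show "closedin (top_of_set R) S \<and> top_of_set R interior_of S = {}" if "S \<in> range A" for S
        using that emp AR by (auto simp: A_def intro!: closed_subset)
    qed auto
    then have "R = {}" using UN interior_of_topspace[of "top_of_set R"] by simp
    then show False by (simp add: R_def)
  qed
  then obtain n y0 where "y0 \<in> top_of_set R interior_of A n" by blast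
  then obtain U where U: "openin (top_of_set R) U" "y0 \<in> U" "U \<subseteq> A n"
    by (auto simp: interior_of_def)
  then obtain \<epsilon> where \<epsilon>: "\<epsilon> > 0" "\<And>y. y \<in> R \<Longrightarrow> dist y y0 < \<epsilon> \<Longrightarrow> y \<in> A n"
    unfolding openin_euclidean_subtopology_iff by blast
  have y0R: "y0 \<in> R" using U AR by blast
  \<comment> \<open>\<open>y\<close> is the difference of \<open>y0 + y\<close> and
    \<open>y0\<close>, both limits of images of the ball of radius \<open>real n\<close>; this is
    the origin of \<open>2 * real n\<close>.\<close>
  have small: "\<exists>x. norm x \<le> 2 * real n \<and> norm (y - T x) \<le> e" if y: "y \<in> R" "norm y < \<epsilon>" and e: "e > 0" for y e
  proof -
    have "y0 + y \<in> A n" "y0 \<in> A n"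
      using \<epsilon> y y0R subspace_add[OF sub] by (auto simp: dist_norm)
    then obtain a b where "a \<in> T ` ball 0 (real n)" "dist a (y0 + y) < e/2" "b \<in> T ` ball 0 (real n)" "dist b y0 < e/2"
      using half_gt_zero[OF e] unfolding A_def closure_approachable by blast
    then obtain u v where u: "norm u < real n" "dist (T u) (y0 + y) < e/2" and v: "norm v < real n" "dist (T v) y0 < e/2"
      by auto
    have "norm (u - v) \<le> 2 * real n" using norm_triangle_ineq4[of u v] u v by linarith
    moreover have "y - T (u - v) = (y0 + y - T u) + (T v - y0)" by (simp add: T.diff)
    then have "norm (y - T (u - v)) \<le> norm (y0 + y - T u) + norm (T v - y0)" by (metis norm_triangle_ineq)
    then have "norm (y - T (u - v)) \<le> e" using u v by (simp add: dist_norm norm_minus_commute)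
    ultimately show ?thesis by blast
  qed
  \<comment> \<open>Scaling \<open>y\<close> to norm \<open>\<epsilon> / 2\<close> and back
    multiplies the radius \<open>2 * real n\<close> by
    \<open>2 * norm y / \<epsilon>\<close>.\<close>
  define K where "K = 4 * real n / \<epsilon>"
  have K0: "K \<ge> 0" using \<epsilon> by (simp add: K_def)
  have "\<exists>x. norm x \<le> K * norm y \<and> norm (y - T x) \<le> norm y / 2" if y: "y \<in> R" for y
  proof (cases "y = 0")
    case True then show ?thesis by (intro exI[of _ 0]) (auto simp: T.zero)
  next
    case False
    define t where "t = \<epsilon> / (2 * norm y)"
    have t: "t > 0" using False \<epsilon> by (simp add: t_def)
    have "norm (t *\<^sub>R y) < \<epsilon>" using False \<epsilon> by (simp add: t_def)
    moreover have "t *\<^sub>R y \<in> R" by (rule subspace_scale[OF sub y])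
    moreover have "t * (norm y / 2) > 0" using t False by simp
    ultimately obtain x where x: "norm x \<le> 2 * real n" "norm (t *\<^sub>R y - T x) \<le> t * (norm y / 2)"
      using small by blast
    have "norm ((1/t) *\<^sub>R x) \<le> (2 * real n) / t" using x t by (simp add: divide_right_mono)
    also have "\<dots> = K * norm y" using False \<epsilon> by (simp add: t_def K_def)
    finally have 1: "norm ((1/t) *\<^sub>R x) \<le> K * norm y" .
    have "t *\<^sub>R (y - T ((1/t) *\<^sub>R x)) = t *\<^sub>R y - T x" using t by (simp add: T.scaleR scaleR_diff_right)
    then have "t * norm (y - T ((1/t) *\<^sub>R x)) \<le> t * (norm y / 2)" using x t by (metis abs_of_pos norm_scaleR)
    then have "norm (y - T ((1/t) *\<^sub>R x)) \<le> norm y / 2" using t by simp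
    with 1 show ?thesis by blast
  qed
  then obtain f where f: "\<And>y. y \<in> R \<Longrightarrow> norm (f y) \<le> K * norm y" "\<And>y. y \<in> R \<Longrightarrow> norm (y - T (f y)) \<le> norm y / 2"
    by metis
  have "\<exists>x'. T x' = T x \<and> norm x' \<le> (2 * K) * norm (T x)" for x
  proof -
    \<comment> \<open>Successive approximation: \<open>y k\<close> is the residual after
      \<open>k\<close> corrections, at least halved each time, and the corrections add up to an
      exact preimage.\<close>
    define y where "y k = ((\<lambda>y. y - T (f y)) ^^ k) (T x)" for k
    have ySuc: "y (Suc k) = y k - T (f (y k))" for k by (simp add: y_def)
    have yR: "y k \<in> R" for k
      by (induction k) (auto simp: ySuc y_def R_def intro!: subspace_diff[OF sub, unfolded R_def])
    have yn: "norm (y k) \<le> norm (T x) * (1/2) ^ k" for k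
    proof (induction k)
      case (Suc k)
      have "norm (y (Suc k)) \<le> norm (y k) / 2" unfolding ySuc by (rule f(2)[OF yR])
      with Suc show ?case by simp
    qed (simp add: y_def)
    have fn: "norm (f (y k)) \<le> K * norm (T x) * (1/2) ^ k" for k
      using f(1)[OF yR[of k]] mult_left_mono[OF yn[of k] K0] by (simp add: mult.assoc)
    have sg: "summable (\<lambda>k. K * norm (T x) * (1/2::real) ^ k)" by (intro summable_mult summable_geometric) auto
    have sn: "summable (\<lambda>k. norm (f (y k)))" by (rule summable_comparison_test'[OF sg]) (use fn in auto)
    have s: "summable (\<lambda>k. f (y k))" by (rule summable_norm_cancel[OF sn])
    have "norm (\<Sum>k. f (y k)) \<le> (\<Sum>k. norm (f (y k)))" by (rule summable_norm[OF sn])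
    also have "\<dots> \<le> (\<Sum>k. K * norm (T x) * (1/2::real) ^ k)" by (rule suminf_le[OF fn sn sg])
    also have "\<dots> = K * norm (T x) * 2"
      by (subst suminf_mult) (auto simp: suminf_geometric)
    finally have 1: "norm (\<Sum>k. f (y k)) \<le> (2 * K) * norm (T x)" by (simp add: mult_ac)
    have "y \<longlonglongrightarrow> 0"
    proof (rule Lim_null_comparison)
      show "\<forall>\<^sub>F k in sequentially. norm (y k) \<le> norm (T x) * (1/2) ^ k" using yn by simp
      show "(\<lambda>k. norm (T x) * (1/2) ^ k) \<longlonglongrightarrow> 0"
        by (intro tendsto_mult_right_zero LIMSEQ_power_zero) auto
    qed
    then have "(\<lambda>k. y k - y (Suc k)) sums (y 0 - 0)" by (rule telescope_sums')
    then have "(\<lambda>k. T (f (y k))) sums T x" by (simp add: ySuc y_def)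
    moreover have "(\<lambda>k. T (f (y k))) sums T (\<Sum>k. f (y k))" by (rule T.sums[OF summable_sums[OF s]])
    ultimately have "T (\<Sum>k. f (y k)) = T x" by (metis sums_unique2)
    with 1 show ?thesis by blast
  qed
  moreover have "0 \<le> 2 * K" using K0 by simp
  ultimately show ?thesis using that by blast
qed

text \<open>A vector orthogonal to the kernel is the shortest preimage of its image, so a bound for
  some preimage is a bound for the vector itself.\<close>

lemma Fredholm_bounded_below:
  fixes T :: "'a::{banach, real_inner, complex_normed_vector} \<Rightarrow> 'a"
  assumes T: "Fredholm T"
  obtains B c where "finite B" "c > 0" "\<And>x. \<forall>b\<in>B. inner x b = 0 \<Longrightarrow> c * norm x \<le> norm (T x)"
proof -
  obtain B where B: "finite B" "{x. T x = 0} \<subseteq> complex_vector.span B" and bc: "bounded_clinear T" and cl: "closed (range T)"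
    using T by (auto simp: Fredholm_def)
  note bl = bounded_clinearD(1)[OF bc]
  interpret T: bounded_linear T by (rule bl)
  obtain C where C: "C \<ge> 0" "\<And>x. \<exists>x'. T x' = T x \<and> norm x' \<le> C * norm (T x)"
    using closed_range_lift_bounded[OF bl cl] by metis
  \<comment> \<open>\<open>inner\<close> is a real form, so orthogonality to the complex span of
    \<open>B\<close> needs the vectors \<open>\<i> *\<^sub>C b\<close> as well.\<close>
  define B' where "B' = B \<union> (\<lambda>b. \<i> *\<^sub>C b) ` B"
  \<comment> \<open>\<open>C + 1\<close> stays positive when \<open>C = 0\<close>.\<close>
  have "1 / (C + 1) * norm x \<le> norm (T x)" if x: "\<forall>b\<in>B'. inner x b = 0" for x
  proof -
    define V where "V = {y. inner x y = 0 \<and> inner x (\<i> *\<^sub>C y) = 0}"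
    have dec: "inner x (c *\<^sub>C y) = Re c * inner x y + Im c * inner x (\<i> *\<^sub>C y)" for c y
    proof -
      have "c *\<^sub>C y = Re c *\<^sub>R y + Im c *\<^sub>R (\<i> *\<^sub>C y)"
        unfolding scaleR_scaleC scaleC_scaleC scaleC_add_left[symmetric]
        by (rule arg_cong[of _ _ "\<lambda>c. c *\<^sub>C y"]) (simp add: complex_eq_iff)
      then show ?thesis by (simp add: inner_add_right)
    qed
    have "complex_vector.subspace V"
    proof (rule complex_vector.subspaceI)
      show "u + v \<in> V" if "u \<in> V" "v \<in> V" for u v
        using that by (simp add: V_def inner_add_right scaleC_add_right)
      show "c *\<^sub>C u \<in> V" if "u \<in> V" for c u
        using that dec[of c u] dec[of "\<i> * c" u] by (simp add: V_def scaleC_scaleC)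
    qed (simp add: V_def)
    moreover have "B \<subseteq> V" using x by (auto simp: V_def B'_def)
    ultimately have sp: "complex_vector.span B \<subseteq> V" by (intro complex_vector.span_minimal)
    obtain x' where x': "T x' = T x" "norm x' \<le> C * norm (T x)" using C by blast
    have "T (x - x') = 0" using x' by (simp add: T.diff)
    then have "x - x' \<in> V" using B sp by blast
    then have "inner x x = inner x x'" by (simp add: V_def inner_diff_right)
    also have "\<dots> \<le> norm x * norm x'" by (rule norm_cauchy_schwarz)
    finally have "norm x * norm x \<le> norm x * norm x'" by (simp add: dot_square_norm power2_eq_square)
    then have "norm x \<le> norm x'" by (cases "x = 0") auto
    also have "\<dots> \<le> (C + 1) * norm (T x)" using x' by (simp add: distrib_right add_increasing2)
    finally show ?thesis using C by (simp add: field_simps)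
  qed
  moreover have "finite B'" "1 / (C + 1) > 0" using B C by (auto simp: B'_def)
  ultimately show ?thesis using that by blast
qed

text \<open>Finitely many real linear conditions cannot exhaust an infinite-dimensional space. The
  induction proves more, divisibility by \<open>monom 1 k\<close>, in order to obtain a second
  solution that is linearly independent of the first.\<close>

lemma exists_poly_orthogonal:
  fixes L :: "complex poly \<Rightarrow> 'a::real_inner"
  assumes add: "\<And>p q. L (p + q) = L p + L q" and scale: "\<And>r p. L (smult (complex_of_real r) p) = r *\<^sub>R L p"
    and B: "finite B"
  shows "\<exists>p. p \<noteq> 0 \<and> (\<forall>b\<in>B. inner (L p) b = 0)"
proof -
  have "\<exists>p. p \<noteq> 0 \<and> monom 1 k dvd p \<and> (\<forall>b\<in>B. inner (L p) b = 0)" for k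
    using B
  proof (induction B arbitrary: k rule: finite_induct)
    case empty
    show ?case by (intro exI[of _ "monom 1 k"]) auto
  next
    case (insert b F)
    obtain p1 where p1: "p1 \<noteq> 0" "monom 1 k dvd p1" "\<forall>b\<in>F. inner (L p1) b = 0"
      using insert.IH by blast
    \<comment> \<open>A nonzero multiple of \<open>monom 1 m\<close> has degree above that of
      \<open>p1\<close>, so \<open>p2\<close> plus a multiple of \<open>p1\<close> cannot
      vanish.\<close>
    define m where "m = Suc (degree p1) + k"
    obtain p2 where p2: "p2 \<noteq> 0" "monom 1 m dvd p2" "\<forall>b\<in>F. inner (L p2) b = 0"
      using insert.IH by blast
    show ?case
    proof (cases "inner (L p1) b = 0")
      case True
      with p1 show ?thesis by auto
    next
      case False
      define t where "t = - (inner (L p2) b / inner (L p1) b)"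
      define p where "p = p2 + smult (complex_of_real t) p1"
      have "monom (1::complex) m = monom 1 k * monom 1 (Suc (degree p1))" by (simp add: mult_monom m_def add.commute)
      then have "monom 1 k dvd p2" using p2(2) by (metis dvd_trans dvd_triv_left)
      then have d: "monom 1 k dvd p" using p1(2) by (simp add: p_def dvd_smult)
      have "p \<noteq> 0"
      proof
        assume "p = 0"
        then have "p2 = - smult (complex_of_real t) p1" by (simp add: p_def eq_neg_iff_add_eq_0)
        then have "degree p2 \<le> degree p1" by (metis degree_minus degree_smult_le)
        moreover have "m \<le> degree p2" using dvd_imp_degree_le[OF p2(2,1)] by (simp add: degree_monom_eq)
        ultimately show False by (simp add: m_def)
      qed
      moreover have "\<forall>b\<in>insert b F. inner (L p) b = 0"
        using p1(3) p2(3) False unfolding p_def add scale inner_add_left inner_scaleR_left by (auto simp: t_def)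
      ultimately show ?thesis using d by blast
    qed
  qed
  then show ?thesis by blast
qed

text \<open>For each tolerance, \<open>L\<close> parametrises an infinite-dimensional space on which
  \<open>T\<close> is that small. It contains a nonzero vector orthogonal to the finite set of
  \<open>Fredholm_bounded_below\<close>, against the lower bound there. No limit of vectors is
  formed, so \<open>L\<close> may vary with \<open>\<epsilon>\<close>.\<close>

lemma not_Fredholm_if_approx_kernel:
  fixes T :: "'a::{banach, real_inner, complex_normed_vector} \<Rightarrow> 'a"
  assumes "\<And>\<epsilon>. \<epsilon> > 0 \<Longrightarrow> \<exists>L :: complex poly \<Rightarrow> 'a. (\<forall>p q. L (p + q) = L p + L q)
      \<and> (\<forall>r p. L (smult (complex_of_real r) p) = r *\<^sub>R L p)
      \<and> (\<forall>p. p \<noteq> 0 \<longrightarrow> L p \<noteq> 0) \<and> (\<forall>p. norm (T (L p)) \<le> \<epsilon> * norm (L p))"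
  shows "\<not> Fredholm T"
proof
  assume "Fredholm T"
  then obtain B c where B: "finite B" "c > 0" "\<And>x. \<forall>b\<in>B. inner x b = 0 \<Longrightarrow> c * norm x \<le> norm (T x)"
    using Fredholm_bounded_below by metis
  from B(2) assms[of "c / 2"] obtain L :: "complex poly \<Rightarrow> 'a" where L: "\<And>p q. L (p + q) = L p + L q"
    "\<And>r p. L (smult (complex_of_real r) p) = r *\<^sub>R L p"
    "\<And>p. p \<noteq> 0 \<Longrightarrow> L p \<noteq> 0" "\<And>p. norm (T (L p)) \<le> c / 2 * norm (L p)"
    by auto
  obtain p where p: "p \<noteq> 0" "\<forall>b\<in>B. inner (L p) b = 0"
    using exists_poly_orthogonal[of L B] L(1,2) B(1) by auto
  from B(3)[OF p(2)] L(4)[of p] have "c * norm (L p) \<le> c / 2 * norm (L p)" by linarith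
  moreover have "norm (L p) > 0" using L(3)[OF p(1)] by simp
  ultimately show False using B(2) by simp
qed

section \<open>Boundary limit of the weight\<close>

text \<open>Only the boundary values near 1 are used: away from 1 the Poisson kernel tends to 0
  uniformly as \<open>z\<close> tends to 1, so neither Fatou's theorem nor non-tangential approach is needed.\<close>

lemma tendsto_of_radial_limit:
  fixes g gs :: "complex \<Rightarrow> complex"
  assumes g: "g \<in> hardy_inf" and A: "open_arc A" "1 \<in> A" and rad: "radial_limit_on A g gs"
    and cont: "continuous (at 1 within A) gs"
  shows "(g \<longlongrightarrow> gs 1) (at 1 within unit_disc)"
proof -
  obtain M where hol: "g holomorphic_on unit_disc" and M: "0 < M" "\<forall>z\<in>unit_disc. cmod (g z) \<le> M"
    using hardy_infE[OF g] by metis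
  define L where "L = gs 1"
  define M' where "M' = M + cmod L"
  have M'0: "0 < M'" using M by (simp add: M'_def add_pos_nonneg)
  show ?thesis
    unfolding L_def[symmetric] tendsto_iff
  proof (intro allI impI)
    fix e :: real assume "e > 0"
    define \<epsilon> where "\<epsilon> = e / 3"
    have \<epsilon>: "\<epsilon> > 0" using \<open>e > 0\<close> by (simp add: \<epsilon>_def)
    obtain a b where ab: "A = cis ` {a<..<b}" using A(1) by (auto simp: open_arc_def)
    then obtain t0 where t0: "cis t0 = 1" "a < t0" "t0 < b" using A(2) by (metis greaterThanLessThan_iff imageE)
    obtain d1 where d1: "d1 > 0" "\<And>\<zeta>. \<zeta> \<in> A \<Longrightarrow> dist \<zeta> 1 < d1 \<Longrightarrow> dist (gs \<zeta>) L < \<epsilon>"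
      using cont \<epsilon> unfolding continuous_within_eps_delta L_def by blast
    \<comment> \<open>The parameter \<open>t0\<close> of the point 1 may be any multiple of 2 pi, so
      a nearby point of the circle is located at \<open>t0\<close> plus its
      \<open>Arg\<close>.\<close>
    define d where "d = min (t0 - a) (b - t0)"
    have d: "d > 0" "d \<le> t0 - a" "d \<le> b - t0" using t0 by (auto simp: d_def)
    obtain d2 where d2: "d2 > 0" "\<And>\<zeta>. dist \<zeta> 1 < d2 \<Longrightarrow> dist (Arg \<zeta>) (Arg 1) < d"
      using continuous_at_Arg[of 1] d(1) unfolding continuous_at_eps_delta by auto
    define \<eta> where "\<eta> = min d1 d2"
    have \<eta>: "\<eta> > 0" using d1 d2 by (simp add: \<eta>_def)
    have near: "\<zeta> \<in> A" "dist (gs \<zeta>) L < \<epsilon>" if \<zeta>: "cmod \<zeta> = 1" "cmod (\<zeta> - 1) < \<eta>" for \<zeta>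
    proof -
      have "\<bar>Arg \<zeta>\<bar> < d" using d2(2)[of \<zeta>] \<zeta> by (simp add: \<eta>_def dist_norm)
      moreover have "\<zeta> = cis (t0 + Arg \<zeta>)"
        using \<zeta> t0 rcis_cmod_Arg[of \<zeta>] by (simp add: rcis_def flip: cis_mult)
      ultimately show "\<zeta> \<in> A" using d by (auto simp: ab intro!: image_eqI)
      with d1(2)[of \<zeta>] \<zeta> show "dist (gs \<zeta>) L < \<epsilon>" by (auto simp: dist_norm \<eta>_def)
    qed
    define r where "r n = 1 - inverse (real (Suc (Suc n)))" for n :: nat
    have r: "0 < r n" "r n < 1" for n by (auto simp: r_def field_simps)
    have r1: "r \<longlonglongrightarrow> 1"
    proof -
      have "r \<longlonglongrightarrow> 1 - 0"
        unfolding r_def by (intro tendsto_intros LIMSEQ_Suc[OF LIMSEQ_inverse_real_of_nat])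
      then show ?thesis by simp
    qed
    have rl: "filterlim r (at_left 1) sequentially"
      using r r1 by (auto simp: filterlim_at intro!: always_eventually less_imp_neq)
    \<comment> \<open>Dilation makes \<open>g - L\<close> holomorphic across the unit circle, where
      the Poisson formula then applies; the radial limits enter as \<open>n\<close> tends to
      infinity.\<close>
    define h where "h n z = g (complex_of_real (r n) * z) - L" for n z
    have hh: "h n holomorphic_on ball 0 (1 / r n)" for n
    proof -
      have "cmod (complex_of_real (r n) * z) < 1" if "cmod z < 1 / r n" for z
        using that r[of n] by (simp add: norm_mult field_simps)
      then have "(g \<circ> (\<lambda>z. complex_of_real (r n) * z)) holomorphic_on ball 0 (1 / r n)"
        by (intro holomorphic_on_compose_gen[OF _ hol] holomorphic_intros) auto
      then show ?thesis
        unfolding h_def by (intro holomorphic_intros) (simp add: o_def)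
    qed
    have hb: "cmod (h n z) \<le> M'" if "cmod z \<le> 1" for n z
    proof -
      have "cmod (complex_of_real (r n) * z) < 1"
        using that r[of n] by (simp add: norm_mult) (metis le_less_trans less_imp_le mult_left_le)
      then have "cmod (g (complex_of_real (r n) * z)) \<le> M" using M by simp
      then show ?thesis using norm_triangle_ineq4[of "g (complex_of_real (r n) * z)" L] by (simp add: h_def M'_def)
    qed
    \<comment> \<open>With this constant the barrier C |zeta - 1|^2 reaches the bound
      \<open>M'\<close> at distance \<open>\<eta>\<close> from 1. On the circle, \<open>h n\<close>
      can exceed \<open>\<epsilon>\<close> plus the barrier only closer to 1, by an excess
      \<open>k n\<close> that vanishes in the limit by the radial limits of
      \<open>g\<close>.\<close>
    define C where "C = M' / \<eta>\<^sup>2"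
    have C: "C > 0" using M'0 \<eta> by (simp add: C_def)
    define k where "k n t = max 0 (cmod (h n (cis t)) - \<epsilon> - C * (cmod (cis t - 1))\<^sup>2)" for n t
    have R: "1 < 1 / r n" for n using r[of n] by (simp add: field_simps)
    have ch: "continuous_on S (\<lambda>t. h n (cis t))" for n S
      using continuous_on_circle[OF hh zero_less_one R, of S n] by simp
    have ck: "continuous_on S (k n)" for n S
      unfolding k_def by (intro continuous_intros ch)
    have k0: "(\<lambda>n. integral {0..2*pi} (k n)) \<longlonglongrightarrow> integral {0..2*pi} (\<lambda>_. 0)"
    proof (rule dominated_convergence(2)[where h = "\<lambda>_. M'"])
      show "k n integrable_on {0..2*pi}" for n by (intro integrable_continuous_interval ck)
      show "norm (k n t) \<le> M'" for n t
      proof -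
        have "0 \<le> C * (cmod (cis t - 1))\<^sup>2" using C by simp
        then show ?thesis using hb[of "cis t" n] \<epsilon> M'0 by (simp add: k_def)
      qed
      show "(\<lambda>n. k n t) \<longlonglongrightarrow> 0" for t
      proof (cases "cmod (cis t - 1) < \<eta>")
        case True
        have "(\<lambda>n. g (complex_of_real (r n) * cis t)) \<longlonglongrightarrow> gs (cis t)"
          using rad near(1)[OF _ True] filterlim_compose[OF _ rl] unfolding radial_limit_on_def by fastforce
        then have "(\<lambda>n. dist (g (complex_of_real (r n) * cis t)) L) \<longlonglongrightarrow> dist (gs (cis t)) L"
          by (intro tendsto_intros)
        then have "\<forall>\<^sub>F n in sequentially. dist (g (complex_of_real (r n) * cis t)) L < \<epsilon>"
          using near(2)[OF _ True] by (auto intro: order_tendstoD)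
        then have "\<forall>\<^sub>F n in sequentially. k n t = 0"
        proof (rule eventually_mono)
          fix n assume "dist (g (complex_of_real (r n) * cis t)) L < \<epsilon>"
          moreover have "0 \<le> C * (cmod (cis t - 1))\<^sup>2" using C by simp
          ultimately show "k n t = 0" by (simp add: k_def h_def dist_norm)
        qed
        then show ?thesis by (rule tendsto_eventually)
      next
        case False
        then have "\<eta>\<^sup>2 \<le> (cmod (cis t - 1))\<^sup>2" using \<eta> by (intro power_mono) auto
        then have "M' \<le> C * (cmod (cis t - 1))\<^sup>2" using \<eta> M'0 by (simp add: C_def field_simps)
        then have "k n t = 0" for n using hb[of "cis t" n] \<epsilon> by (simp add: k_def)
        then show ?thesis by simp
      qed
    qed auto
    have bound: "cmod (g z - L) \<le> \<epsilon> + 2 * C * cmod (z - 1)" if z: "cmod z < 1" for z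
    proof -
      have lim: "(\<lambda>n. h n z) \<longlonglongrightarrow> g z - L"
      proof -
        have "isCont g z"
          using hol z by (metis continuous_on_eq_continuous_at holomorphic_on_imp_continuous_on mem_ball_0 open_ball)
        moreover have "(\<lambda>n. complex_of_real (r n) * z) \<longlonglongrightarrow> complex_of_real 1 * z"
          by (intro tendsto_intros r1)
        ultimately have "(\<lambda>n. g (complex_of_real (r n) * z)) \<longlonglongrightarrow> g z"
          using isCont_tendsto_compose[of z g] by simp
        then show ?thesis unfolding h_def by (intro tendsto_intros)
      qed
      \<comment> \<open>\<open>K\<close> grows without bound as \<open>z\<close> approaches 1, but
        \<open>z\<close> is fixed while \<open>n\<close> tends to infinity, and \<open>K\<close>
        multiplies the integral of \<open>k n\<close>.\<close>
      define K where "K = (1 + cmod z) / (1 - cmod z)"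
      \<comment> \<open>On the unit circle |zeta - 1|^2 is the real part of 2 - 2 zeta, so its
        Poisson integral is explicit and vanishes as \<open>z\<close> tends to 1.\<close>
      have mom: "((\<lambda>t. (cmod (cis t - 1))\<^sup>2 * poisson 1 z t) has_integral 2 * pi * (2 - 2 * Re z)) {0..2*pi}"
      proof -
        have "((\<lambda>t. (2 - 2 * cis t) * complex_of_real (poisson 1 z t)) has_integral 2 * pi * (2 - 2 * z)) {0..2*pi}"
          using poisson_formula[of "\<lambda>z. 2 - 2 * z" 2 1 z] z by (simp add: holomorphic_intros)
        from has_integral_Re[OF this] show ?thesis
        proof (rule has_integral_eq_rhs[OF has_integral_eq, rotated])
          fix t
          have "(cmod (cis t - 1))\<^sup>2 = 2 - 2 * cos t"
            using sin_cos_squared_add[of t] unfolding cmod_power2 by (simp add: power2_eq_square algebra_simps)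
          then show "Re ((2 - 2 * cis t) * complex_of_real (poisson 1 z t)) = (cmod (cis t - 1))\<^sup>2 * poisson 1 z t"
            by simp
        qed simp
      qed
      have step: "2 * pi * cmod (h n z) \<le> 2 * pi * \<epsilon> + C * (2 * pi * (2 - 2 * Re z)) + K * integral {0..2*pi} (k n)" for n
      proof -
        have "2 * pi * cmod (h n z) \<le> integral {0..2*pi} (\<lambda>t. cmod (h n (cis t)) * poisson 1 z t)"
          using poisson_norm_le[OF hh zero_less_one R z] by simp
        also have "\<dots> \<le> integral {0..2*pi} (\<lambda>t. \<epsilon> * poisson 1 z t + C * ((cmod (cis t - 1))\<^sup>2 * poisson 1 z t) + K * k n t)"
        proof (rule integral_le)
          show "(\<lambda>t. cmod (h n (cis t)) * poisson 1 z t) integrable_on {0..2*pi}"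
            "(\<lambda>t. \<epsilon> * poisson 1 z t + C * ((cmod (cis t - 1))\<^sup>2 * poisson 1 z t) + K * k n t) integrable_on {0..2*pi}"
            by (intro integrable_continuous_interval continuous_intros ch ck continuous_on_poisson z)+
          fix t
          have P: "0 \<le> poisson 1 z t" "poisson 1 z t \<le> K"
            using poisson_nonneg[OF z] poisson_le[OF z] by (auto simp: K_def)
          have "cmod (h n (cis t)) \<le> \<epsilon> + C * (cmod (cis t - 1))\<^sup>2 + k n t" by (simp add: k_def)
          then have "cmod (h n (cis t)) * poisson 1 z t \<le> (\<epsilon> + C * (cmod (cis t - 1))\<^sup>2 + k n t) * poisson 1 z t"
            using P by (intro mult_right_mono) auto
          also have "k n t * poisson 1 z t \<le> K * k n t"
            using P mult_left_mono[of "poisson 1 z t" K "k n t"] by (simp add: k_def mult.commute)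
          then have "(\<epsilon> + C * (cmod (cis t - 1))\<^sup>2 + k n t) * poisson 1 z t
              \<le> \<epsilon> * poisson 1 z t + C * ((cmod (cis t - 1))\<^sup>2 * poisson 1 z t) + K * k n t"
            by (simp add: algebra_simps)
          finally show "cmod (h n (cis t)) * poisson 1 z t
              \<le> \<epsilon> * poisson 1 z t + C * ((cmod (cis t - 1))\<^sup>2 * poisson 1 z t) + K * k n t" .
        qed
        also have "\<dots> = \<epsilon> * (2 * pi) + C * (2 * pi * (2 - 2 * Re z)) + K * integral {0..2*pi} (k n)"
          by (intro integral_unique has_integral_add has_integral_mult_right integral_poisson mom z
              integrable_integral integrable_continuous_interval ck)
        finally show ?thesis by (simp add: mult_ac)
      qed
      have lim1: "(\<lambda>n. 2 * pi * cmod (h n z)) \<longlonglongrightarrow> 2 * pi * cmod (g z - L)"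
        by (intro tendsto_mult_left tendsto_norm lim)
      have lim2: "(\<lambda>n. 2 * pi * \<epsilon> + C * (2 * pi * (2 - 2 * Re z)) + K * integral {0..2*pi} (k n))
          \<longlonglongrightarrow> 2 * pi * \<epsilon> + C * (2 * pi * (2 - 2 * Re z)) + K * integral {0..2*pi} (\<lambda>_::real. 0::real)"
        by (rule tendsto_add[OF tendsto_const tendsto_mult_left[OF k0]])
      have "2 * pi * cmod (g z - L)
          \<le> 2 * pi * \<epsilon> + C * (2 * pi * (2 - 2 * Re z)) + K * integral {0..2*pi} (\<lambda>_::real. 0::real)"
        by (rule LIMSEQ_le[OF lim1 lim2]) (use step in blast)
      then have "(2 * pi) * cmod (g z - L) \<le> (2 * pi) * (\<epsilon> + C * (2 - 2 * Re z))" by (simp add: algebra_simps)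
      then have "cmod (g z - L) \<le> \<epsilon> + C * (2 - 2 * Re z)"
        by (subst (asm) mult_le_cancel_left_pos) auto
      also have "1 - Re z \<le> cmod (z - 1)" using complex_Re_le_cmod[of "1 - z"] by (simp add: norm_minus_commute)
      then have "\<epsilon> + C * (2 - 2 * Re z) \<le> \<epsilon> + 2 * C * cmod (z - 1)"
        using C by simp
      finally show ?thesis .
    qed
    have "\<forall>\<^sub>F z in at 1 within unit_disc. z \<in> unit_disc \<and> dist z 1 < \<epsilon> / (2 * C)"
      using \<epsilon> C unfolding eventually_at by (intro exI[of _ "\<epsilon> / (2 * C)"]) auto
    then show "\<forall>\<^sub>F z in at 1 within unit_disc. dist (g z) L < e"
    proof (rule eventually_mono)
      fix z assume z: "z \<in> unit_disc \<and> dist z 1 < \<epsilon> / (2 * C)"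
      then have "2 * C * cmod (z - 1) < \<epsilon>" using C by (simp add: dist_norm field_simps)
      with bound[of z] z have "cmod (g z - L) < 2 * \<epsilon>" by simp
      then show "dist (g z) L < e" using \<open>e > 0\<close> by (simp add: dist_norm \<epsilon>_def)
    qed
  qed
qed

section \<open>The angular derivative\<close>

text \<open>Maps the disc onto the right half-plane and sends 1 to infinity; the level lines of its
  real part are the horocycles at 1.\<close>

definition cayley :: "complex \<Rightarrow> complex" where
  "cayley z = (1 + z) / (1 - z)"

lemma Re_cayley: "Re (cayley z) = (1 - (cmod z)\<^sup>2) / (cmod (1 - z))\<^sup>2"
proof -
  have "Re (cayley z) = Re ((1 + z) * cnj (1 - z)) / (cmod (1 - z))\<^sup>2"
    unfolding cayley_def by (subst complex_div_cnj) (simp add: Re_divide_of_real)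
  also have "Re ((1 + z) * cnj (1 - z)) = 1 - (cmod z)\<^sup>2"
    unfolding cmod_power2 by (simp add: algebra_simps power2_eq_square)
  finally show ?thesis .
qed

lemma Re_cayley_pos: "cmod z < 1 \<Longrightarrow> 0 < Re (cayley z)"
  unfolding Re_cayley by (intro divide_pos_pos) (auto simp: power_less_one_iff abs_square_less_1)

section \<open>The Schwarz-Pick and Julia inequalities\<close>

lemma Moebius_identity:
  assumes "1 - cnj w * z \<noteq> 0"
  shows "1 - (cmod (Moebius_function 0 w z))\<^sup>2
      = (1 - (cmod w)\<^sup>2) * (1 - (cmod z)\<^sup>2) / (cmod (1 - cnj w * z))\<^sup>2"
proof -
  have "(cmod (1 - cnj w * z))\<^sup>2 - (cmod (z - w))\<^sup>2 = (1 - (cmod w)\<^sup>2) * (1 - (cmod z)\<^sup>2)"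
    unfolding cmod_power2 by (simp add: algebra_simps power2_eq_square)
  then show ?thesis using assms
    by (simp add: Moebius_function_simple norm_divide power_divide divide_simps)
qed

lemma one_minus_cnj_mult_nonzero:
  assumes "cmod w < 1" "cmod z < 1"
  shows "1 - cnj w * z \<noteq> 0"
proof
  assume "1 - cnj w * z = 0"
  then have "cmod (cnj w * z) = 1" by (metis eq_iff_diff_eq_0 norm_one)
  moreover have "cmod w * cmod z \<le> cmod w" using assms by (intro mult_left_le) auto
  ultimately show False using assms by (simp add: norm_mult)
qed

text \<open>Moebius maps move \<open>v\<close> and \<open>\<phi> v\<close> to 0, where the Schwarz
  lemma applies. The result is kept as 1 minus the squared pseudohyperbolic distance because this
  factors, and can be divided by \<open>1 - r\<close> when \<open>v = r\<close> tends to 1.\<close>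

lemma Schwarz_Pick:
  assumes \<phi>: "analytic_selfmap \<phi>" and z: "cmod z < 1" and v: "cmod v < 1"
  shows "(1 - (cmod v)\<^sup>2) * (1 - (cmod z)\<^sup>2) / (cmod (1 - cnj v * z))\<^sup>2
    \<le> (1 - (cmod (\<phi> v))\<^sup>2) * (1 - (cmod (\<phi> z))\<^sup>2) / (cmod (1 - cnj (\<phi> v) * \<phi> z))\<^sup>2"
proof -
  note hol = analytic_selfmapD(1)[OF \<phi>] and im = analytic_selfmapD(2)[OF \<phi>]
  define F where "F = Moebius_function 0 (\<phi> v) \<circ> (\<phi> \<circ> Moebius_function 0 (- v))"
  have v': "cmod (- v) < 1" using v by simp
  have m: "cmod (Moebius_function 0 (- v) \<xi>) < 1" if "cmod \<xi> < 1" for \<xi>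
    using Moebius_function_norm_lt_1[OF v' that] .
  have F: "F holomorphic_on ball 0 1"
    unfolding F_def
    by (intro holomorphic_on_compose_gen[OF holomorphic_on_compose_gen[OF Moebius_function_holomorphic[OF v'] hol]
          Moebius_function_holomorphic[OF im[OF v]]]) (use m im in auto)
  have F0: "F 0 = 0" by (simp add: F_def Moebius_function_of_zero Moebius_function_eq_zero)
  have F1: "cmod (F \<xi>) < 1" if "cmod \<xi> < 1" for \<xi>
    unfolding F_def o_def using that by (intro Moebius_function_norm_lt_1 im v m)
  define \<xi> where "\<xi> = Moebius_function 0 v z"
  have \<xi>: "cmod \<xi> < 1" unfolding \<xi>_def by (rule Moebius_function_norm_lt_1[OF v z])
  have "F \<xi> = Moebius_function 0 (\<phi> v) (\<phi> z)"
    unfolding F_def \<xi>_def o_def using Moebius_function_compose[of "- v" v z] v z by simp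
  with Schwarz_Lemma(1)[OF F F0 F1 \<xi>] have "cmod (Moebius_function 0 (\<phi> v) (\<phi> z)) \<le> cmod \<xi>" by simp
  then have "1 - (cmod (Moebius_function 0 v z))\<^sup>2 \<le> 1 - (cmod (Moebius_function 0 (\<phi> v) (\<phi> z)))\<^sup>2"
    unfolding \<xi>_def by (simp add: power_mono)
  then show ?thesis
    unfolding Moebius_identity[OF one_minus_cnj_mult_nonzero[OF v z]]
      Moebius_identity[OF one_minus_cnj_mult_nonzero[OF im[OF v] im[OF z]]] .
qed

text \<open>Schwarz-Pick with one point \<open>r\<close> on the radius, divided by
  \<open>1 - r\<close>, in the limit \<open>r\<close> to 1. Before that, 1 - |phi(r)|^2 is enlarged
  to 2 |1 - phi(r)|, whose quotient by \<open>1 - r\<close> has a limit by assumption.\<close>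

lemma Julia:
  fixes \<alpha> :: complex
  assumes \<phi>: "analytic_selfmap \<phi>" and z: "cmod z < 1"
    and \<phi>1: "((\<lambda>r. \<phi> (complex_of_real r)) \<longlongrightarrow> 1) (at_left 1)"
    and \<alpha>: "((\<lambda>r. (1 - \<phi> (complex_of_real r)) / complex_of_real (1 - r)) \<longlongrightarrow> \<alpha>) (at_left 1)"
  shows "Re (cayley z) \<le> cmod \<alpha> * Re (cayley (\<phi> z))"
proof -
  note im = analytic_selfmapD(2)[OF \<phi>]
  have nz: "1 - z \<noteq> 0" "1 - \<phi> z \<noteq> 0" using z im[OF z] by auto
  define f where "f r = (1 - (cmod z)\<^sup>2) * (1 + r) / (cmod (1 - complex_of_real r * z))\<^sup>2" for r
  define g where "g r = (1 - (cmod (\<phi> z))\<^sup>2) * (2 * cmod ((1 - \<phi> (complex_of_real r)) / complex_of_real (1 - r)))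
      / (cmod (1 - cnj (\<phi> (complex_of_real r)) * \<phi> z))\<^sup>2" for r
  have "(f \<longlongrightarrow> (1 - (cmod z)\<^sup>2) * (1 + 1) / (cmod (1 - complex_of_real 1 * z))\<^sup>2) (at_left 1)"
    unfolding f_def using nz by (intro tendsto_intros) auto
  moreover have "(g \<longlongrightarrow> (1 - (cmod (\<phi> z))\<^sup>2) * (2 * cmod \<alpha>) / (cmod (1 - cnj 1 * \<phi> z))\<^sup>2) (at_left 1)"
    unfolding g_def using nz by (intro tendsto_intros \<alpha> \<phi>1) auto
  moreover have "f r \<le> g r" if r: "r \<in> {0<..<1}" for r
  proof -
    define R where "R = complex_of_real r"
    define W where "W = (cmod (1 - cnj (\<phi> R) * \<phi> z))\<^sup>2"
    have R: "cmod R < 1" using r by (simp add: R_def)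
    have "cmod (\<phi> R) < 1" using im[OF R] .
    have W: "W > 0" using one_minus_cnj_mult_nonzero[OF im[OF R] im[OF z]] by (simp add: W_def)
    have "1 - (cmod (\<phi> R))\<^sup>2 = (1 + cmod (\<phi> R)) * (1 - cmod (\<phi> R))"
      by (simp add: power2_eq_square algebra_simps)
    also have "\<dots> \<le> 2 * cmod (1 - \<phi> R)"
      using norm_triangle_ineq2[of 1 "\<phi> R"] \<open>cmod (\<phi> R) < 1\<close> by (intro mult_mono) auto
    finally have 1: "1 - (cmod (\<phi> R))\<^sup>2 \<le> 2 * cmod (1 - \<phi> R)" .
    have p: "0 \<le> 1 - (cmod (\<phi> z))\<^sup>2" using im[OF z] by (simp add: power_le_one)
    have "(1 - r\<^sup>2) * (1 - (cmod z)\<^sup>2) / (cmod (1 - R * z))\<^sup>2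
        \<le> (1 - (cmod (\<phi> R))\<^sup>2) * (1 - (cmod (\<phi> z))\<^sup>2) / W"
      using Schwarz_Pick[OF \<phi> z R] r by (simp add: R_def W_def)
    also have "\<dots> \<le> (2 * cmod (1 - \<phi> R)) * (1 - (cmod (\<phi> z))\<^sup>2) / W"
      using W p 1 by (intro divide_right_mono mult_right_mono) auto
    finally have "(1 - r) * f r \<le> (2 * cmod (1 - \<phi> R)) * (1 - (cmod (\<phi> z))\<^sup>2) / W"
      by (simp add: f_def R_def power2_eq_square algebra_simps)
    also have "\<dots> = (1 - r) * g r"
    proof -
      have "g r = (1 - (cmod (\<phi> z))\<^sup>2) * (2 * (cmod (1 - \<phi> R) / (1 - r))) / W"
        using r by (simp add: g_def W_def R_def norm_divide del: of_real_diff)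
      then have "(1 - r) * g r = ((1 - r) / (1 - r)) * ((2 * cmod (1 - \<phi> R)) * (1 - (cmod (\<phi> z))\<^sup>2) / W)"
        by (simp add: mult_ac)
      then show ?thesis using r by simp
    qed
    finally show ?thesis using r by simp
  qed
  then have "\<forall>\<^sub>F r in at_left 1. f r \<le> g r"
    by (intro eventually_mono[OF eventually_at_left_real[of 0 1]]) auto
  ultimately have "(1 - (cmod z)\<^sup>2) * (1 + 1) / (cmod (1 - complex_of_real 1 * z))\<^sup>2
      \<le> (1 - (cmod (\<phi> z))\<^sup>2) * (2 * cmod \<alpha>) / (cmod (1 - cnj 1 * \<phi> z))\<^sup>2"
    by (intro tendsto_le[of "at_left 1" g _ f]) auto
  then have "2 * Re (cayley z) \<le> 2 * (cmod \<alpha> * Re (cayley (\<phi> z)))"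
    unfolding Re_cayley by (simp only: mult_ac one_add_one complex_cnj_one of_real_1 mult_1 times_divide_eq_right)
  then show ?thesis by simp
qed

text \<open>Julia's inequality at 0 excludes \<open>\<alpha> = 0\<close>. At real points it bounds
  the squared modulus of the difference quotient by \<open>cmod \<alpha>\<close> times its real
  part, up to a factor tending to 1; in the limit the real part of \<open>\<alpha>\<close> is at
  least its modulus.\<close>

lemma angular_derivative_positive:
  fixes \<alpha> :: complex
  assumes \<phi>: "analytic_selfmap \<phi>"
    and \<phi>1: "((\<lambda>r. \<phi> (complex_of_real r)) \<longlongrightarrow> 1) (at_left 1)"
    and \<alpha>: "((\<lambda>r. (1 - \<phi> (complex_of_real r)) / complex_of_real (1 - r)) \<longlongrightarrow> \<alpha>) (at_left 1)"
  shows "\<alpha> = complex_of_real (cmod \<alpha>)" "0 < cmod \<alpha>"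
proof -
  note im = analytic_selfmapD(2)[OF \<phi>] and J = Julia[OF \<phi> _ \<phi>1 \<alpha>]
  show pos: "0 < cmod \<alpha>"
    using J[of 0] Re_cayley_pos[OF im[of 0]] by (cases "\<alpha> = 0") (auto simp: cayley_def)
  define q where "q r = (1 - \<phi> (complex_of_real r)) / complex_of_real (1 - r)" for r
  have "(1 + r) / 2 * (cmod (q r))\<^sup>2 \<le> cmod \<alpha> * Re (q r)" if r: "r \<in> {0<..<1}" for r
  proof -
    define R where "R = complex_of_real r"
    have R: "cmod R < 1" using r by (simp add: R_def)
    have 1: "cmod (\<phi> R) < 1" using im[OF R] .
    then have nz: "1 - \<phi> R \<noteq> 0" by auto
    have "cayley R = complex_of_real ((1 + r) / (1 - r))"
      by (simp add: cayley_def R_def)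
    then have "(1 + r) / (1 - r) = Re (cayley R)" by (metis Re_complex_of_real)
    also have "\<dots> \<le> cmod \<alpha> * Re (cayley (\<phi> R))" by (rule J[OF R])
    also have "Re (cayley (\<phi> R)) \<le> 2 * Re (1 - \<phi> R) / (cmod (1 - \<phi> R))\<^sup>2"
      unfolding Re_cayley
    proof (rule divide_right_mono)
      have "1 - (cmod (\<phi> R))\<^sup>2 = (1 + cmod (\<phi> R)) * (1 - cmod (\<phi> R))"
        by (simp add: power2_eq_square algebra_simps)
      also have "\<dots> \<le> 2 * Re (1 - \<phi> R)"
        using complex_Re_le_cmod[of "\<phi> R"] 1 by (intro mult_mono) auto
      finally show "1 - (cmod (\<phi> R))\<^sup>2 \<le> 2 * Re (1 - \<phi> R)" .
    qed simp
    finally have 2: "(1 + r) / (1 - r) \<le> cmod \<alpha> * (2 * Re (1 - \<phi> R) / (cmod (1 - \<phi> R))\<^sup>2)"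
      using pos by simp
    define s where "s = 1 - r"
    have s: "s > 0" using r by (simp add: s_def)
    have c: "cmod (1 - \<phi> R) = s * cmod (q r)"
      using s unfolding q_def R_def s_def[symmetric] by (simp add: norm_divide)
    have d: "Re (1 - \<phi> R) = s * Re (q r)"
      using s unfolding q_def R_def s_def[symmetric] Re_divide_of_real by simp
    have e: "cmod (q r) > 0" using nz c by auto
    have "cmod \<alpha> * (2 * (s * Re (q r)) / (s * cmod (q r))\<^sup>2) = (2 * (cmod \<alpha> * Re (q r)) / (cmod (q r))\<^sup>2) / s"
      using s by (simp add: power2_eq_square mult_ac)
    with 2 have "(1 + r) / s \<le> (2 * (cmod \<alpha> * Re (q r)) / (cmod (q r))\<^sup>2) / s"
      unfolding c d s_def[symmetric] by simp
    then have "1 + r \<le> 2 * (cmod \<alpha> * Re (q r)) / (cmod (q r))\<^sup>2"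
      using s by (subst (asm) divide_le_cancel) auto
    then have "(1 + r) * (cmod (q r))\<^sup>2 \<le> 2 * (cmod \<alpha> * Re (q r))"
      using e by (simp add: pos_le_divide_eq)
    then show ?thesis by simp
  qed
  then have ev: "\<forall>\<^sub>F r in at_left 1. (1 + r) / 2 * (cmod (q r))\<^sup>2 \<le> cmod \<alpha> * Re (q r)"
    by (intro eventually_mono[OF eventually_at_left_real[of 0 1]]) auto
  have q: "(q \<longlongrightarrow> \<alpha>) (at_left 1)" using \<alpha> by (simp add: q_def[abs_def])
  have L1: "((\<lambda>r. (1 + r) / 2 * (cmod (q r))\<^sup>2) \<longlongrightarrow> (1 + 1) / 2 * (cmod \<alpha>)\<^sup>2) (at_left 1)"
    by (intro tendsto_intros q) auto
  have L2: "((\<lambda>r. cmod \<alpha> * Re (q r)) \<longlongrightarrow> cmod \<alpha> * Re \<alpha>) (at_left 1)"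
    by (intro tendsto_intros q)
  have "(1 + 1) / 2 * (cmod \<alpha>)\<^sup>2 \<le> cmod \<alpha> * Re \<alpha>"
    by (rule tendsto_le[OF trivial_limit_at_left_real L2 L1 ev])
  then have "cmod \<alpha> \<le> Re \<alpha>" using pos by (simp add: power2_eq_square)
  then have "Re \<alpha> = cmod \<alpha>" using complex_Re_le_cmod[of \<alpha>] by simp
  then show "\<alpha> = complex_of_real (cmod \<alpha>)"
    using cmod_power2[of \<alpha>] by (simp add: complex_eq_iff)
qed

text \<open>A disc internally tangent at 1 is a horodisc, so \<open>cayley\<close> maps it to a
  half-plane; as the subdisc is proper, the level of its edge is positive. Having 1 in the closure
  identifies the point of tangency.\<close>

lemma tangent_subdisc_cayley:
  assumes D: "tangent_subdisc D \<eta>" and 1: "1 \<in> closure D"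
  obtains c where "\<eta> = 1" "c > 0" "\<And>z. z \<in> D \<Longrightarrow> c < Re (cayley z)"
proof -
  obtain x r where r: "r > 0" "D = ball x r" "D \<subset> unit_disc" "sphere x r \<inter> sphere 0 1 = {\<eta>}"
    using D by (auto simp: tangent_subdisc_def)
  have "ball x r \<subseteq> ball 0 1" using r by auto
  then have xr: "cmod x + r \<le> 1" using r(1) by (simp add: ball_subset_ball_iff)
  have "closure D = cball x r" using r by simp
  then have d: "cmod (x - 1) \<le> r" using 1 by (simp add: dist_norm)
  have "1 \<le> cmod x + cmod (x - 1)" using norm_triangle_ineq4[of x "x - 1"] by simp
  with d xr have eq: "cmod (x - 1) = r" "cmod x = 1 - r" by auto
  have "1 \<in> sphere x r \<inter> sphere 0 1" using eq by (simp add: dist_norm)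
  then have \<eta>: "\<eta> = 1" using r by auto
  have "(Re x)\<^sup>2 + (Im x)\<^sup>2 = (1 - r)\<^sup>2" "(Re x - 1)\<^sup>2 + (Im x)\<^sup>2 = r\<^sup>2"
    using eq cmod_power2[of x] cmod_power2[of "x - 1"] by simp_all
  then have "Re x = 1 - r" by (simp add: power2_eq_square algebra_simps)
  moreover from this have "Im x = 0" using \<open>(Re x)\<^sup>2 + (Im x)\<^sup>2 = (1 - r)\<^sup>2\<close> by simp
  ultimately have x: "x = complex_of_real (1 - r)" by (simp add: complex_eq_iff)
  have "r \<noteq> 1"
  proof
    assume "r = 1"
    then have "D = unit_disc" using r(2) x by simp
    with r(3) show False by simp
  qed
  moreover have "r \<le> 1" using xr norm_ge_zero[of x] by linarith
  ultimately have r1: "r < 1" by simp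
  \<comment> \<open>The bound is the value of \<open>cayley\<close> at 1 - 2r, the end of the
    diameter opposite to 1.\<close>
  have "(1 - r) / r < Re (cayley z)" if z: "z \<in> D" for z
  proof -
    have "cmod (complex_of_real (1 - r) - z) < r" using z r x by (simp add: dist_norm)
    then have "(cmod (complex_of_real (1 - r) - z))\<^sup>2 < r\<^sup>2" by (intro power_strict_mono) auto
    then have lt: "(1 - r - Re z)\<^sup>2 + (Im z)\<^sup>2 < r\<^sup>2" unfolding cmod_power2 by simp
    have "z \<noteq> 1" using z r by auto
    then have p: "(cmod (1 - z))\<^sup>2 > 0" by simp
    have "(1 - r) * (cmod (1 - z))\<^sup>2 < (1 - (cmod z)\<^sup>2) * r"
      using lt unfolding cmod_power2 by (simp add: power2_eq_square algebra_simps)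
    then show ?thesis using p r(1) unfolding Re_cayley by (simp add: field_simps)
  qed
  moreover have "(1 - r) / r > 0" using r1 r(1) by simp
  ultimately show ?thesis using that \<eta> by blast
qed

section \<open>Hyperbolic selfmaps\<close>

lemma at_1_within_disc [simp]: "at 1 within unit_disc \<noteq> bot"
  by (simp add: trivial_limit_within islimpt_ball)

lemma filterlim_of_real_disc: "filterlim complex_of_real (at 1 within unit_disc) (at_left 1)"
proof -
  have "\<forall>\<^sub>F r in at_left (1::real). complex_of_real r \<in> unit_disc \<and> complex_of_real r \<noteq> 1"
    by (rule eventually_mono[OF eventually_at_left_real[of 0 1]]) auto
  moreover have "(complex_of_real \<longlongrightarrow> complex_of_real 1) (at_left 1)" by (intro tendsto_intros)
  ultimately show ?thesis by (simp add: filterlim_at)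
qed

text \<open>A bound on the third derivative is passed down by the mean value inequality: the second
  derivative is bounded, the first is Lipschitz, and the tangent map has a quadratic error. The
  inequality is used on the convex intersections of the disc with balls about 1; the point 1 itself
  is reached by limits.\<close>

lemma second_order_at_1:
  fixes \<alpha> :: complex
  assumes hol: "\<phi> holomorphic_on unit_disc" and ext: "extends_continuously ((deriv ^^ 3) \<phi>) (unit_disc \<union> {1})"
    and \<phi>1: "(\<phi> \<longlongrightarrow> 1) (at 1 within unit_disc)" and \<alpha>: "(deriv \<phi> \<longlongrightarrow> \<alpha>) (at 1 within unit_disc)"
  obtains B \<rho> where "B \<ge> 0" "\<rho> > 0"
    "\<forall>z\<in>unit_disc. cmod (1 - z) < \<rho> \<longrightarrow> cmod (1 - \<phi> z - \<alpha> * (1 - z)) \<le> B * (cmod (1 - z))\<^sup>2"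
proof -
  obtain h where h: "continuous_on (unit_disc \<union> {1}) h" "\<And>z. z \<in> unit_disc \<Longrightarrow> h z = (deriv ^^ 3) \<phi> z"
    using ext by (auto simp: extends_continuously_def)
  have "\<exists>d>0. \<forall>z\<in>unit_disc \<union> {1}. dist z 1 < d \<longrightarrow> dist (h z) (h 1) < 1"
    using h(1) unfolding continuous_on_iff by (metis Un_iff insertI1 zero_less_one)
  then obtain \<rho> where \<rho>: "\<rho> > 0" "\<And>z. z \<in> unit_disc \<Longrightarrow> dist z 1 < \<rho> \<Longrightarrow> dist (h z) (h 1) < 1" by blast
  define S where "S t = unit_disc \<inter> ball 1 t" for t :: real
  have S: "convex (S t)" "open (S t)" "S t \<subseteq> unit_disc" for t by (auto simp: S_def intro: convex_Int)
  define B3 where "B3 = cmod (h 1) + 1"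
  have b3: "cmod ((deriv ^^ 3) \<phi> z) \<le> B3" if "z \<in> S \<rho>" for z
  proof -
    have "cmod (h z - h 1) < 1" using \<rho>(2)[of z] that by (simp add: S_def dist_norm norm_minus_commute)
    then show ?thesis using norm_triangle_ineq2[of "h z" "h 1"] h(2)[of z] that by (simp add: B3_def S_def)
  qed
  have der: "((deriv ^^ n) \<phi> has_field_derivative (deriv ^^ Suc n) \<phi> z) (at z within A)" if "z \<in> S t" for n z t A
    using holomorphic_derivI[OF holomorphic_higher_deriv[OF hol open_ball, of n] open_ball] that by (simp add: S_def)
  have lip2: "cmod ((deriv ^^ 2) \<phi> x - (deriv ^^ 2) \<phi> y) \<le> B3 * cmod (x - y)" if "x \<in> S \<rho>" "y \<in> S \<rho>" for x y
  proof (rule field_differentiable_bound[OF S(1) _ _ that])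
    show "((deriv ^^ 2) \<phi> has_field_derivative (deriv ^^ 3) \<phi> z) (at z within S \<rho>)" if "z \<in> S \<rho>" for z
      using der[OF that, of 2] by (simp add: numeral_3_eq_3 numeral_2_eq_2)
  qed (rule b3)
  \<comment> \<open>A reference point in the region: the Lipschitz bound on the second derivative
    becomes a bound by comparison with its value here.\<close>
  define z0 where "z0 = complex_of_real (1 - min \<rho> 1 / 2)"
  have z0: "z0 \<in> S \<rho>"
  proof -
    have "cmod z0 < 1" using \<rho>(1) by (simp add: z0_def del: of_real_diff)
    moreover have "1 - z0 = complex_of_real (min \<rho> 1 / 2)" by (simp add: z0_def)
    then have "cmod (1 - z0) = min \<rho> 1 / 2" using \<rho>(1) by (simp only: norm_of_real)
    then have "cmod (1 - z0) < \<rho>" using \<rho>(1) by simp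
    ultimately show ?thesis by (simp add: S_def dist_norm)
  qed
  define B2 where "B2 = cmod ((deriv ^^ 2) \<phi> z0) + B3 * 2"
  have B30: "B3 \<ge> 0" by (simp add: B3_def)
  have b2: "cmod ((deriv ^^ 2) \<phi> z) \<le> B2" if "z \<in> S \<rho>" for z
  proof -
    have "cmod (z - z0) \<le> 2" using norm_triangle_ineq4[of z z0] that z0 by (simp add: S_def)
    then have "B3 * cmod (z - z0) \<le> B3 * 2" using B30 by (intro mult_left_mono)
    then show ?thesis using lip2[OF that z0] norm_triangle_ineq2[of "(deriv ^^ 2) \<phi> z" "(deriv ^^ 2) \<phi> z0"]
      by (simp add: B2_def)
  qed
  have B20: "B2 \<ge> 0" using B30 by (simp add: B2_def)
  have lip1: "cmod (deriv \<phi> x - deriv \<phi> y) \<le> B2 * cmod (x - y)" if "x \<in> S \<rho>" "y \<in> S \<rho>" for x y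
  proof (rule field_differentiable_bound[OF S(1) _ _ that])
    show "(deriv \<phi> has_field_derivative (deriv ^^ 2) \<phi> z) (at z within S \<rho>)" if "z \<in> S \<rho>" for z
      using der[OF that, of 1] by (simp add: numeral_2_eq_2)
  qed (rule b2)
  have evS: "\<forall>\<^sub>F w in at 1 within unit_disc. w \<in> S t" if "t > 0" for t
    using that unfolding eventually_at by (intro exI[of _ t]) (auto simp: S_def dist_commute)
  have d1: "cmod (deriv \<phi> z - \<alpha>) \<le> B2 * cmod (z - 1)" if z: "z \<in> S \<rho>" for z
  proof (rule tendsto_le[OF at_1_within_disc])
    show "((\<lambda>w. B2 * cmod (z - w)) \<longlongrightarrow> B2 * cmod (z - 1)) (at 1 within unit_disc)" by (intro tendsto_intros)
    show "((\<lambda>w. cmod (deriv \<phi> z - deriv \<phi> w)) \<longlongrightarrow> cmod (deriv \<phi> z - \<alpha>)) (at 1 within unit_disc)"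
      by (intro tendsto_intros \<alpha>)
    show "\<forall>\<^sub>F w in at 1 within unit_disc. cmod (deriv \<phi> z - deriv \<phi> w) \<le> B2 * cmod (z - w)"
      using evS[OF \<rho>(1)] by (rule eventually_mono) (rule lip1[OF z])
  qed
  have "cmod (1 - \<phi> z - \<alpha> * (1 - z)) \<le> (2 * B2) * (cmod (1 - z))\<^sup>2"
    if z: "z \<in> unit_disc" "cmod (1 - z) < \<rho>" for z
  proof -
    have z1: "cmod (1 - z) > 0" using z by auto
    \<comment> \<open>A ball about 1 of radius at most \<open>2 * cmod (1 - z)\<close> that still
      contains \<open>z\<close>. On it \<open>deriv \<phi>\<close> differs from
      \<open>\<alpha>\<close> by at most \<open>B2 * (2 * cmod (1 - z))\<close>, and the distance
      from \<open>z\<close> to 1 supplies the second factor of the quadratic error.\<close>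
    define t where "t = min \<rho> (2 * cmod (1 - z))"
    have t: "t > 0" "t \<le> \<rho>" "t \<le> 2 * cmod (1 - z)" using z1 \<rho> by (auto simp: t_def)
    have zS: "z \<in> S t" using z z1 by (simp add: S_def t_def dist_norm)
    define \<psi> where "\<psi> w = \<phi> w - \<alpha> * w" for w
    have lip: "cmod (\<psi> z - \<psi> w) \<le> (B2 * (2 * cmod (1 - z))) * cmod (z - w)" if w: "w \<in> S t" for w
    proof (rule field_differentiable_bound[OF S(1) _ _ zS w])
      show "(\<psi> has_field_derivative deriv \<phi> u - \<alpha>) (at u within S t)" if "u \<in> S t" for u
        unfolding \<psi>_def using der[OF that, of 0] by (auto intro!: derivative_eq_intros)
      show "cmod (deriv \<phi> u - \<alpha>) \<le> B2 * (2 * cmod (1 - z))" if "u \<in> S t" for u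
      proof -
        have "u \<in> S \<rho>" "cmod (u - 1) \<le> 2 * cmod (1 - z)"
          using that t by (auto simp: S_def dist_norm norm_minus_commute)
        then show ?thesis using d1[of u] mult_left_mono[OF _ B20, of "cmod (u - 1)" "2 * cmod (1 - z)"] by linarith
      qed
    qed
    have "cmod (\<psi> z - (1 - \<alpha> * 1)) \<le> (B2 * (2 * cmod (1 - z))) * cmod (z - 1)"
    proof (rule tendsto_le[OF at_1_within_disc])
      show "((\<lambda>w. (B2 * (2 * cmod (1 - z))) * cmod (z - w)) \<longlongrightarrow> (B2 * (2 * cmod (1 - z))) * cmod (z - 1)) (at 1 within unit_disc)"
        by (intro tendsto_intros)
      show "((\<lambda>w. cmod (\<psi> z - \<psi> w)) \<longlongrightarrow> cmod (\<psi> z - (1 - \<alpha> * 1))) (at 1 within unit_disc)"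
        unfolding \<psi>_def by (intro tendsto_intros \<phi>1)
      show "\<forall>\<^sub>F w in at 1 within unit_disc. cmod (\<psi> z - \<psi> w) \<le> (B2 * (2 * cmod (1 - z))) * cmod (z - w)"
        using evS[OF t(1)] by (rule eventually_mono) (rule lip)
    qed
    moreover have "cmod (\<psi> z - (1 - \<alpha> * 1)) = cmod (1 - \<phi> z - \<alpha> * (1 - z))"
    proof -
      have "1 - \<phi> z - \<alpha> * (1 - z) = - (\<psi> z - (1 - \<alpha> * 1))" by (simp add: \<psi>_def algebra_simps)
      then show ?thesis by (metis norm_minus_cancel)
    qed
    ultimately show ?thesis by (simp add: norm_minus_commute power2_eq_square mult_ac)
  qed
  then show ?thesis using that[of "2 * B2" \<rho>] B20 \<rho>(1) by simp
qed

text \<open>Three estimates carry the iteration: after one step the real part in the half-plane is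
  at least \<open>c\<close>, every step multiplies it by at least \<open>1 / a\<close>, and near 1
  the map is linear up to a quadratic error.\<close>

locale hyperbolic_selfmap =
  fixes \<phi> :: "complex \<Rightarrow> complex" and a c B \<rho> :: real
  assumes selfmap: "analytic_selfmap \<phi>"
    and a: "0 < a" "a < 1" and c: "0 < c" and \<rho>: "0 < \<rho>" and B: "0 \<le> B"
    and horodisc: "cmod (z::complex) < 1 \<Longrightarrow> c \<le> Re (cayley (\<phi> z))"
    and Julia: "cmod (z::complex) < 1 \<Longrightarrow> Re (cayley z) \<le> a * Re (cayley (\<phi> z))"
    and tangent: "cmod (z::complex) < 1 \<Longrightarrow> cmod (1 - z) < \<rho> \<Longrightarrow> cmod (1 - \<phi> z - complex_of_real a * (1 - z)) \<le> B * (cmod (1 - z))\<^sup>2"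

lemma essentially_linear_fractional_hyperbolic:
  assumes elf: "essentially_linear_fractional \<phi>" and \<phi>1: "(\<phi> \<longlongrightarrow> 1) (at 1 within unit_disc)"
    and \<delta>: "\<delta> > 0" and ext1: "extends_continuously (deriv \<phi>) {z. cmod (z - 1) < \<delta> \<and> cmod z \<le> 1}"
    and lt: "Re (boundary_value (deriv \<phi>) 1) < 1"
  obtains c B \<rho> where "hyperbolic_selfmap \<phi> (Re (boundary_value (deriv \<phi>) 1)) c B \<rho>"
proof -
  have self: "analytic_selfmap \<phi>" using elf by (simp add: essentially_linear_fractional_def)
  obtain \<eta> D \<zeta>0 where D: "tangent_subdisc D \<eta>" "\<phi> ` unit_disc \<subseteq> D"
    and \<zeta>0: "{\<zeta> \<in> sphere 0 1. \<eta> \<in> cluster_set \<phi> \<zeta>} = {\<zeta>0}"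
    and ext: "extends_continuously ((deriv ^^ 3) \<phi>) (unit_disc \<union> {\<zeta>0})"
    using elf by (auto simp: essentially_linear_fractional_def)
  \<comment> \<open>A radial sequence whose images tend to 1. It puts 1 into the closure of
    \<open>D\<close> and into the cluster set at 1, which forces both boundary points of the
    definition to be 1.\<close>
  define x where "x n = complex_of_real (1 - inverse (real (Suc n)))" for n
  have x: "x n \<in> unit_disc" "x n \<noteq> 1" for n
  proof -
    have "0 < inverse (real (Suc n))" "inverse (real (Suc n)) \<le> 1" by (auto simp: field_simps)
    then have "cmod (x n) < 1" unfolding x_def norm_of_real by linarith
    then show "x n \<in> unit_disc" "x n \<noteq> 1" by auto
  qed
  have x1: "x \<longlonglongrightarrow> 1"
  proof -
    have "x \<longlonglongrightarrow> complex_of_real (1 - 0)"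
      unfolding x_def by (intro tendsto_intros LIMSEQ_inverse_real_of_nat)
    then show ?thesis by simp
  qed
  have xf: "filterlim x (at 1 within unit_disc) sequentially"
    using x x1 by (auto simp: filterlim_at)
  have \<phi>x: "(\<lambda>n. \<phi> (x n)) \<longlonglongrightarrow> 1" by (rule filterlim_compose[OF \<phi>1 xf])
  have "1 \<in> closure D"
    unfolding closure_sequential using \<phi>x x(1) D(2) by (intro exI[of _ "\<lambda>n. \<phi> (x n)"]) auto
  then obtain c where c: "\<eta> = 1" "c > 0" "\<And>z. z \<in> D \<Longrightarrow> c < Re (cayley z)"
    using tangent_subdisc_cayley[OF D(1)] by metis
  have "1 \<in> {\<zeta> \<in> sphere 0 1. \<eta> \<in> cluster_set \<phi> \<zeta>}"
    using x(1) x1 \<phi>x by (auto simp: cluster_set_def c(1))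
  then have "\<zeta>0 = 1" using \<zeta>0 by auto
  obtain h where h: "continuous_on {z. cmod (z - 1) < \<delta> \<and> cmod z \<le> 1} h"
      "\<forall>z\<in>{z. cmod (z - 1) < \<delta> \<and> cmod z \<le> 1} \<inter> unit_disc. h z = deriv \<phi> z"
    using ext1 by (auto simp: extends_continuously_def)
  define \<alpha> where "\<alpha> = h 1"
  have d\<phi>: "(deriv \<phi> \<longlongrightarrow> \<alpha>) (at 1 within unit_disc)"
    unfolding \<alpha>_def
  proof (rule Lim_transform_eventually)
    have "(h \<longlongrightarrow> h 1) (at 1 within {z. cmod (z - 1) < \<delta> \<and> cmod z \<le> 1})"
      using h(1) \<delta> unfolding continuous_on_def by simp
    then have "(h \<longlongrightarrow> h 1) (at 1 within {z. cmod (z - 1) < \<delta> \<and> cmod z < 1})"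
      by (rule tendsto_within_subset) auto
    moreover have "at 1 within {z. cmod (z - 1) < \<delta> \<and> cmod z < 1} = at 1 within unit_disc"
      using \<delta> by (intro at_within_nhd[of _ "ball 1 \<delta>"]) (auto simp: dist_norm norm_minus_commute)
    ultimately show "(h \<longlongrightarrow> h 1) (at 1 within unit_disc)" by simp
    show "\<forall>\<^sub>F z in at 1 within unit_disc. h z = deriv \<phi> z"
      using h(2) \<delta> unfolding eventually_at by (intro exI[of _ \<delta>]) (auto simp: dist_norm)
  qed
  have bv: "boundary_value (deriv \<phi>) 1 = \<alpha>"
    unfolding boundary_value_def by (rule tendsto_Lim[OF at_1_within_disc d\<phi>])
  obtain B \<rho> where B: "B \<ge> 0" "\<rho> > 0"
    "\<forall>z\<in>unit_disc. cmod (1 - z) < \<rho> \<longrightarrow> cmod (1 - \<phi> z - \<alpha> * (1 - z)) \<le> B * (cmod (1 - z))\<^sup>2"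
    using second_order_at_1[OF analytic_selfmapD(1)[OF self] _ \<phi>1 d\<phi>] ext \<open>\<zeta>0 = 1\<close> by metis
  have rad1: "((\<lambda>r. \<phi> (complex_of_real r)) \<longlongrightarrow> 1) (at_left 1)"
    by (rule filterlim_compose[OF \<phi>1 filterlim_of_real_disc])
  have rad2: "((\<lambda>r. (1 - \<phi> (complex_of_real r)) / complex_of_real (1 - r)) \<longlongrightarrow> \<alpha>) (at_left 1)"
  proof (rule LIM_zero_cancel, rule Lim_null_comparison)
    show "((\<lambda>r. B * (1 - r)) \<longlongrightarrow> 0) (at_left 1)"
      by (rule tendsto_eq_intros refl | simp)+
    show "\<forall>\<^sub>F r in at_left 1. norm ((1 - \<phi> (complex_of_real r)) / complex_of_real (1 - r) - \<alpha>) \<le> B * (1 - r)"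
    proof (rule eventually_mono[OF eventually_at_left_real[of "max 0 (1 - \<rho>)" 1]])
      fix r assume "r \<in> {max 0 (1 - \<rho>)<..<1}"
      then have r: "0 < r" "1 - \<rho> < r" "r < 1" by auto
      define s where "s = 1 - r"
      have s: "0 < s" "s < \<rho>" using r by (auto simp: s_def)
      have e: "1 - complex_of_real r = complex_of_real s" by (simp add: s_def)
      have "cmod (1 - \<phi> (complex_of_real r) - \<alpha> * s) \<le> B * s\<^sup>2"
        using B(3)[rule_format, of "complex_of_real r"] r s by (simp add: e)
      moreover have "1 - \<phi> (complex_of_real r) - \<alpha> * s = s * ((1 - \<phi> (complex_of_real r)) / s - \<alpha>)"
        using s by (simp add: field_simps)
      ultimately have "s * cmod ((1 - \<phi> (complex_of_real r)) / s - \<alpha>) \<le> s * (B * s)"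
        using s by (simp add: norm_mult power2_eq_square mult_ac)
      then show "norm ((1 - \<phi> (complex_of_real r)) / complex_of_real (1 - r) - \<alpha>) \<le> B * (1 - r)"
        using s by (simp add: s_def[symmetric])
    qed (use B in auto)
  qed
  note pos = angular_derivative_positive[OF self rad1 rad2]
  have re: "Re \<alpha> = cmod \<alpha>" using pos(1) by (metis Re_complex_of_real)
  have "hyperbolic_selfmap \<phi> (Re \<alpha>) c B \<rho>"
  proof unfold_locales
    show "Re (cayley z) \<le> Re \<alpha> * Re (cayley (\<phi> z))" if "cmod z < 1" for z
      unfolding re by (rule Julia[OF self that rad1 rad2])
    show "c \<le> Re (cayley (\<phi> z))" if "cmod z < 1" for z
      using c(3)[of "\<phi> z"] D(2) that by (auto simp: less_imp_le image_subset_iff)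
    show "cmod (1 - \<phi> z - complex_of_real (Re \<alpha>) * (1 - z)) \<le> B * (cmod (1 - z))\<^sup>2"
      if "cmod z < 1" "cmod (1 - z) < \<rho>" for z
      using B(3) that pos(1) re by simp
  qed (use self pos re lt bv c B in auto)
  then show ?thesis using that bv by blast
qed

context hyperbolic_selfmap
begin

section \<open>Iteration in the right half-plane\<close>

lemma iterate_disc: "cmod z < 1 \<Longrightarrow> cmod ((\<phi> ^^ n) z) < 1"
  by (rule analytic_selfmapD(2)[OF analytic_selfmap_funpow[OF selfmap]])

lemma Re_cayley_iterate: "cmod z < 1 \<Longrightarrow> Re (cayley z) \<le> a ^ n * Re (cayley ((\<phi> ^^ n) z))"
proof (induction n)
  case (Suc n)
  have "a ^ n * Re (cayley ((\<phi> ^^ n) z)) \<le> a ^ n * (a * Re (cayley (\<phi> ((\<phi> ^^ n) z))))"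
    using a by (intro mult_left_mono Julia iterate_disc Suc.prems) auto
  with Suc show ?case by (simp add: mult_ac)
qed simp

text \<open>One step is spent on entering the half-plane of real part at least \<open>c\<close>;
  from there the growth is uniform over the disc. This is the shift between \<open>n\<close> and
  \<open>Suc n\<close>.\<close>

lemma Re_cayley_iterate_Suc:
  assumes "cmod z < 1"
  shows "c \<le> a ^ n * Re (cayley ((\<phi> ^^ Suc n) z))"
proof -
  have "c \<le> Re (cayley (\<phi> z))" using horodisc assms by blast
  also have "\<dots> \<le> a ^ n * Re (cayley ((\<phi> ^^ n) (\<phi> z)))"
    by (rule Re_cayley_iterate) (rule analytic_selfmapD(2)[OF selfmap assms])
  finally show ?thesis by (simp add: funpow_swap1)
qed

lemma dist_1_le_cayley:
  fixes z :: complex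
  assumes z: "cmod z < 1"
  shows "cmod (1 - z) \<le> 2 / Re (cayley z)"
proof -
  have "z \<noteq> 1" using z by auto
  then have "cayley z + 1 = 2 / (1 - z)" by (simp add: cayley_def field_simps)
  then have "cmod (cayley z + 1) = 2 / cmod (1 - z)" by (simp add: norm_divide)
  moreover have "Re (cayley z) \<le> cmod (cayley z + 1)"
    using complex_Re_le_cmod[of "cayley z + 1"] by simp
  ultimately have "Re (cayley z) \<le> 2 / cmod (1 - z)" by simp
  then show ?thesis using Re_cayley_pos[OF z] \<open>z \<noteq> 1\<close> by (simp add: field_simps)
qed

lemma iterates_uniformly_to_1:
  assumes "\<eta> > 0"
  obtains N where "\<And>n z. n \<ge> N \<Longrightarrow> cmod z < 1 \<Longrightarrow> cmod (1 - (\<phi> ^^ n) z) < \<eta>"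
proof -
  have "(\<lambda>n. 2 / c * a ^ n) \<longlonglongrightarrow> 2 / c * 0"
    using a by (intro tendsto_intros LIMSEQ_power_zero) auto
  then have "\<forall>\<^sub>F n in sequentially. 2 / c * a ^ n < \<eta>" using assms by (auto intro: order_tendstoD)
  then obtain N where N: "\<And>n. n \<ge> N \<Longrightarrow> 2 / c * a ^ n < \<eta>" by (auto simp: eventually_sequentially)
  have "cmod (1 - (\<phi> ^^ n) z) < \<eta>" if n: "n \<ge> Suc N" and z: "cmod z < 1" for n z
  proof -
    obtain m where m: "n = Suc m" "m \<ge> N" using n by (cases n) auto
    define J where "J = Re (cayley ((\<phi> ^^ n) z))"
    have J: "J > 0" unfolding J_def by (intro Re_cayley_pos iterate_disc z)
    have "c \<le> a ^ m * J" using Re_cayley_iterate_Suc[OF z, of m] m by (simp add: J_def)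
    then have "2 / J \<le> 2 / c * a ^ m" using J c by (simp add: field_simps)
    with N[OF m(2)] dist_1_le_cayley[OF iterate_disc[OF z], of n] show ?thesis by (simp add: J_def)
  qed
  then show ?thesis using that by blast
qed

text \<open>In the right half-plane \<open>\<phi>\<close> is dilation by \<open>1 / a\<close> up to a bounded error near infinity.\<close>

lemma cayley_step:
  obtains K \<eta> where "\<eta> > 0" "\<And>z. cmod z < 1 \<Longrightarrow> cmod (1 - z) < \<eta> \<Longrightarrow> cmod (a * cayley (\<phi> z) - cayley z) \<le> K"
proof -
  \<comment> \<open>The second bound keeps the quadratic error below half of
    \<open>a * cmod u\<close>, so that \<open>cmod v\<close> is at least
    \<open>a / 2 * cmod u\<close>; \<open>B + 1\<close> is positive even for
    \<open>B = 0\<close>.\<close>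
  define \<eta> where "\<eta> = min \<rho> (a / (2 * (B + 1)))"
  have \<eta>: "\<eta> > 0" using a B \<rho> by (simp add: \<eta>_def)
  have "cmod (a * cayley (\<phi> z) - cayley z) \<le> 4 * B / a + 1" if z: "cmod z < 1" "cmod (1 - z) < \<eta>" for z
  proof -
    define u where "u = 1 - z"
    define v where "v = 1 - \<phi> z"
    have u0: "u \<noteq> 0" using z by (auto simp: u_def)
    have v0: "v \<noteq> 0" using analytic_selfmapD(2)[OF selfmap z(1)] by (auto simp: v_def)
    have uv: "cmod (v - a * u) \<le> B * (cmod u)\<^sup>2"
      using tangent[OF z(1)] z(2) by (simp add: u_def v_def \<eta>_def)
    have "B * cmod u \<le> a / 2"
    proof -
      have "cmod u \<le> a / (2 * (B + 1))" using z(2) by (simp add: u_def \<eta>_def)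
      then have "B * cmod u \<le> B * (a / (2 * (B + 1)))" using B by (intro mult_left_mono)
      also have "\<dots> \<le> a / 2" using B a by (simp add: field_simps)
      finally show ?thesis .
    qed
    then have "B * (cmod u)\<^sup>2 \<le> a / 2 * cmod u"
      using mult_right_mono[of "B * cmod u" "a / 2" "cmod u"] by (simp add: power2_eq_square)
    moreover have "a * cmod u - cmod v \<le> cmod (v - a * u)"
      using norm_triangle_ineq2[of "a * u" v] a by (simp add: norm_mult norm_minus_commute)
    ultimately have v: "a / 2 * cmod u \<le> cmod v" using uv by linarith
    \<comment> \<open>Both transforms have the form \<open>2 / u - 1\<close>. Their combination has
      a numerator of second order in \<open>u\<close> and a denominator of at least that size,
      whence the constant \<open>4 * B / a\<close>.\<close>
    have "a * cayley (\<phi> z) - cayley z = 2 * (a * u - v) / (u * v) + (1 - a)"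
    proof -
      have e: "cayley z = 2 / u - 1" "cayley (\<phi> z) = 2 / v - 1"
        using u0 v0 by (auto simp: cayley_def u_def v_def field_simps)
      show ?thesis unfolding e using u0 v0 by (simp add: field_simps)
    qed
    then have "cmod (a * cayley (\<phi> z) - cayley z) \<le> cmod (2 * (a * u - v) / (u * v)) + cmod (complex_of_real (1 - a))"
      by (metis norm_triangle_ineq)
    also have "cmod (complex_of_real (1 - a)) \<le> 1" unfolding norm_of_real using a by simp
    also have "cmod (2 * (a * u - v) / (u * v)) = 2 * cmod (v - a * u) / (cmod u * cmod v)"
      unfolding norm_divide norm_mult norm_minus_commute[of _ v] by simp
    also have "\<dots> \<le> 2 * (B * (cmod u)\<^sup>2) / (cmod u * (a / 2 * cmod u))"
      using uv v u0 a B by (intro frac_le mult_left_mono) auto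
    also have "\<dots> = 4 * B / a" using u0 a by (simp add: power2_eq_square field_simps)
    finally show ?thesis by simp
  qed
  then show ?thesis using that \<eta> by blast
qed

section \<open>The Koenigs map\<close>

lemma holomorphic_cayley_iterate: "(\<lambda>z. cayley ((\<phi> ^^ n) z)) holomorphic_on unit_disc"
  unfolding cayley_def
proof (intro holomorphic_intros)
  show "(\<phi> ^^ n) holomorphic_on unit_disc" "(\<phi> ^^ n) holomorphic_on unit_disc"
    by (rule analytic_selfmapD(1)[OF analytic_selfmap_funpow[OF selfmap]])+
  show "1 - (\<phi> ^^ n) z \<noteq> 0" if "z \<in> unit_disc" for z
    using iterate_disc[of z n] that by auto
qed

text \<open>The increments of the rescaled iterates are a^n times the error of
  \<open>cayley_step\<close>, hence summable uniformly on the disc. The series starts at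
  \<open>N\<close>, the index from which all iterates lie where that error is controlled.\<close>

lemma Koenigs_ex:
  "\<exists>\<nu>. \<nu> holomorphic_on unit_disc \<and> (\<forall>z. cmod z < 1 \<longrightarrow> (\<lambda>n. complex_of_real (a ^ n) * cayley ((\<phi> ^^ n) z)) \<longlonglongrightarrow> \<nu> z)"
proof -
  define W where "W n z = complex_of_real (a ^ n) * cayley ((\<phi> ^^ n) z)" for n z
  obtain K \<eta> where \<eta>: "\<eta> > 0" and K: "\<And>z. cmod z < 1 \<Longrightarrow> cmod (1 - z) < \<eta> \<Longrightarrow> cmod (a * cayley (\<phi> z) - cayley z) \<le> K"
    using cayley_step by metis
  obtain N where N: "\<And>n z. n \<ge> N \<Longrightarrow> cmod z < 1 \<Longrightarrow> cmod (1 - (\<phi> ^^ n) z) < \<eta>"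
    using iterates_uniformly_to_1[OF \<eta>] by metis
  define f where "f k z = W (Suc (N + k)) z - W (N + k) z" for k z
  define \<nu> where "\<nu> z = W N z + (\<Sum>k. f k z)" for z
  have "uniform_limit unit_disc (\<lambda>n z. \<Sum>k<n. f k z) (\<lambda>z. \<Sum>k. f k z) sequentially"
  proof (rule Weierstrass_m_test)
    show "norm (f k z) \<le> a ^ (N + k) * K" if "z \<in> unit_disc" for k z
    proof -
      have z: "cmod z < 1" using that by simp
      have "f k z = a ^ (N + k) * (a * cayley (\<phi> ((\<phi> ^^ (N + k)) z)) - cayley ((\<phi> ^^ (N + k)) z))"
        by (simp add: f_def W_def algebra_simps)
      then have "norm (f k z) = a ^ (N + k) * cmod (a * cayley (\<phi> ((\<phi> ^^ (N + k)) z)) - cayley ((\<phi> ^^ (N + k)) z))"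
        using a by (simp add: norm_mult norm_power)
      also have "\<dots> \<le> a ^ (N + k) * K"
        using a by (intro mult_left_mono K iterate_disc N z) auto
      finally show ?thesis .
    qed
    have "summable (\<lambda>k. a ^ k)" using a by (intro summable_geometric) auto
    then have "summable (\<lambda>k. (a ^ N * K) * a ^ k)" by (rule summable_mult)
    then show "summable (\<lambda>k. a ^ (N + k) * K)" by (simp add: power_add mult_ac)
  qed
  then have ul: "uniform_limit unit_disc (\<lambda>n z. W N z + (\<Sum>k<n. f k z)) \<nu> sequentially"
    unfolding \<nu>_def by (intro uniform_limit_intros)
  have tele: "W N z + (\<Sum>k<n. f k z) = W (N + n) z" for n z
    unfolding f_def by (subst sum_lessThan_telescope[of "\<lambda>k. W (N + k) z", simplified]) simp
  have ul': "uniform_limit unit_disc (\<lambda>n. W (N + n)) \<nu> sequentially"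
    using ul unfolding tele .
  have "\<nu> holomorphic_on unit_disc"
  proof (rule holomorphic_uniform_sequence[OF open_ball])
    show "W (N + n) holomorphic_on unit_disc" for n
      unfolding W_def by (intro holomorphic_intros holomorphic_cayley_iterate)
    show "\<exists>d>0. cball z d \<subseteq> unit_disc \<and> uniform_limit (cball z d) (\<lambda>n. W (N + n)) \<nu> sequentially"
      if z: "z \<in> unit_disc" for z
    proof -
      obtain d where "d > 0" "cball z d \<subseteq> unit_disc" using z open_contains_cball[of unit_disc] by blast
      then show ?thesis using uniform_limit_on_subset[OF ul'] by blast
    qed
  qed
  moreover have "(\<lambda>n. W n z) \<longlonglongrightarrow> \<nu> z" if "cmod z < 1" for z
  proof -
    have "(\<lambda>n. W (N + n) z) \<longlonglongrightarrow> \<nu> z" using tendsto_uniform_limitI[OF ul', of z] that by simp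
    then show ?thesis using LIMSEQ_offset[of "\<lambda>n. W n z" N] by (simp add: add.commute)
  qed
  ultimately show ?thesis unfolding W_def by blast
qed

definition koenigs :: "complex \<Rightarrow> complex" where
  "koenigs = (SOME \<nu>. \<nu> holomorphic_on unit_disc
     \<and> (\<forall>z. cmod z < 1 \<longrightarrow> (\<lambda>n. complex_of_real (a ^ n) * cayley ((\<phi> ^^ n) z)) \<longlonglongrightarrow> \<nu> z))"

lemma koenigs:
  shows holomorphic_koenigs: "koenigs holomorphic_on unit_disc"
    and koenigs_tendsto: "cmod z < 1 \<Longrightarrow> (\<lambda>n. complex_of_real (a ^ n) * cayley ((\<phi> ^^ n) z)) \<longlonglongrightarrow> koenigs z"
  using someI_ex[OF Koenigs_ex] unfolding koenigs_def[symmetric] by auto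

lemma koenigs_selfmap:
  assumes z: "cmod z < 1"
  shows "koenigs (\<phi> z) = koenigs z / a"
proof (rule LIMSEQ_unique)
  show "(\<lambda>n. complex_of_real (a ^ n) * cayley ((\<phi> ^^ n) (\<phi> z))) \<longlonglongrightarrow> koenigs (\<phi> z)"
    by (intro koenigs_tendsto analytic_selfmapD(2)[OF selfmap z])
  have "(\<lambda>n. complex_of_real (a ^ Suc n) * cayley ((\<phi> ^^ Suc n) z) / a) \<longlonglongrightarrow> koenigs z / a"
    using LIMSEQ_Suc[OF koenigs_tendsto[OF z]] a by (intro tendsto_intros) auto
  then show "(\<lambda>n. complex_of_real (a ^ n) * cayley ((\<phi> ^^ n) (\<phi> z))) \<longlonglongrightarrow> koenigs z / a"
    using a by (simp add: funpow_swap1)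
qed

text \<open>The factor \<open>a\<close> pays for the one step into the half-plane of
  \<open>horodisc\<close>. A positive lower bound, and not mere positivity, controls powers whose
  exponent has negative real part.\<close>

lemma Re_koenigs:
  assumes z: "cmod z < 1"
  shows "a * c \<le> Re (koenigs z)"
proof (rule LIMSEQ_le_const)
  show "(\<lambda>n. Re (complex_of_real (a ^ n) * cayley ((\<phi> ^^ n) z))) \<longlonglongrightarrow> Re (koenigs z)"
    by (intro tendsto_intros koenigs_tendsto z)
  have R: "Re (complex_of_real x * w) = x * Re w" for x w by simp
  have "a * c \<le> Re (complex_of_real (a ^ n) * cayley ((\<phi> ^^ n) z))" if n1: "n \<ge> 1" for n
  proof -
    obtain m where n: "n = Suc m" using n1 by (cases n) auto
    have "a * c \<le> a * (a ^ m * Re (cayley ((\<phi> ^^ n) z)))"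
      using Re_cayley_iterate_Suc[OF z, of m] a n by (intro mult_left_mono) auto
    then show ?thesis unfolding R by (simp add: n mult_ac)
  qed
  then show "\<exists>N. \<forall>n\<ge>N. a * c \<le> Re (complex_of_real (a ^ n) * cayley ((\<phi> ^^ n) z))" by blast
qed

lemma Re_koenigs_pos: "cmod z < 1 \<Longrightarrow> 0 < Re (koenigs z)"
  using Re_koenigs[of z] mult_pos_pos[OF a(1) c] by linarith

text \<open>For w = cayley p the squared bound (1 + |p|) / (1 - |p|) is at most |w + 1|^2 / Re w.
  Along the orbit of 0 the numerator is of order a^(-2n), as the rescaled orbit converges, and the
  denominator is at least a^(-n).\<close>

lemma comp_bound_iterate:
  obtains C where "C > 0" "\<And>n. comp_bound (\<phi> ^^ n) \<le> C * (1 / sqrt a) ^ n"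
proof -
  define w where "w n = cayley ((\<phi> ^^ n) 0)" for n
  have "(\<lambda>n. complex_of_real (a ^ n) * (w n + 1)) \<longlonglongrightarrow> koenigs 0 + 0"
  proof -
    have "(\<lambda>n. complex_of_real (a ^ n)) \<longlonglongrightarrow> complex_of_real 0"
      using a by (intro tendsto_of_real LIMSEQ_power_zero) auto
    then have "(\<lambda>n. complex_of_real (a ^ n) * w n + complex_of_real (a ^ n)) \<longlonglongrightarrow> koenigs 0 + 0"
      using koenigs_tendsto[of 0] unfolding w_def by (intro tendsto_add) auto
    then show ?thesis by (simp add: algebra_simps)
  qed
  then have "Bseq (\<lambda>n. complex_of_real (a ^ n) * (w n + 1))" by (rule convergentI[THEN convergent_imp_Bseq])
  then obtain C where C: "C > 0" "\<And>n. norm (complex_of_real (a ^ n) * (w n + 1)) \<le> C"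
    unfolding Bseq_def by auto
  have "comp_bound (\<phi> ^^ n) \<le> C * (1 / sqrt a) ^ n" for n
  proof -
    define p where "p = (\<phi> ^^ n) 0"
    have p: "cmod p < 1" unfolding p_def by (rule iterate_disc) simp
    then have p1: "1 - p \<noteq> 0" by auto
    define J where "J = Re (w n)"
    have "1 \<le> a ^ n * J" using Re_cayley_iterate[of 0 n] by (simp add: J_def w_def cayley_def)
    then have J: "J \<ge> 1 / a ^ n" using a by (simp add: pos_divide_le_eq mult.commute)
    have J0: "J > 0" by (rule less_le_trans[OF _ J]) (use a in simp)
    have wp: "w n + 1 = 2 / (1 - p)" using p1 by (simp add: w_def p_def[symmetric] cayley_def field_simps)
    have Jp: "J = (1 - (cmod p)\<^sup>2) / (cmod (1 - p))\<^sup>2" by (simp add: J_def w_def p_def[symmetric] Re_cayley)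
    have "(1 + cmod p) / (1 - cmod p) = (1 + cmod p)\<^sup>2 / (1 - (cmod p)\<^sup>2)"
    proof -
      have "1 - (cmod p)\<^sup>2 = (1 + cmod p) * (1 - cmod p)" by (simp add: power2_eq_square algebra_simps)
      moreover have "1 + cmod p \<noteq> 0" using norm_ge_zero[of p] by linarith
      ultimately show ?thesis by (simp add: power2_eq_square)
    qed
    also have "\<dots> \<le> 2\<^sup>2 / (1 - (cmod p)\<^sup>2)"
      using p by (intro divide_right_mono power_mono) (auto simp: power_le_one)
    also have "\<dots> = (cmod (w n + 1))\<^sup>2 / J"
      unfolding wp Jp using p1 by (simp add: norm_divide power_divide)
    also have "\<dots> \<le> (cmod (w n + 1))\<^sup>2 / (1 / a ^ n)"
      using J J0 a by (intro divide_left_mono) auto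
    also have "\<dots> = (a ^ n * cmod (w n + 1))\<^sup>2 / a ^ n" using a by (simp add: power2_eq_square)
    also have "\<dots> \<le> C\<^sup>2 / a ^ n"
      using C(2)[of n] a by (intro divide_right_mono power_mono) (auto simp: norm_mult norm_power)
    finally have "(comp_bound (\<phi> ^^ n))\<^sup>2 \<le> C\<^sup>2 / a ^ n"
      using p by (simp add: comp_bound_def p_def)
    also have "\<dots> = (C * (1 / sqrt a) ^ n)\<^sup>2"
    proof -
      have "((1 / sqrt a) ^ n)\<^sup>2 = ((1 / sqrt a)\<^sup>2) ^ n"
        by (simp only: power_mult[symmetric] mult.commute)
      also have "(1 / sqrt a)\<^sup>2 = 1 / a" using a by (simp add: power_divide)
      finally show ?thesis by (simp add: power_mult_distrib power_divide)
    qed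
    finally show ?thesis by (rule power2_le_imp_le) (use C a in simp)
  qed
  then show ?thesis using that C(1) by blast
qed

lemma tendsto_1_uniformly:
  assumes g: "(g \<longlongrightarrow> L) (at 1 within unit_disc)" and e: "e > (0::real)"
  obtains N where "\<And>n z. n \<ge> N \<Longrightarrow> cmod z < 1 \<Longrightarrow> cmod (g ((\<phi> ^^ n) z) - L) < e"
proof -
  obtain d where d: "d > 0" "\<And>z. z \<in> unit_disc \<Longrightarrow> z \<noteq> 1 \<Longrightarrow> dist z 1 < d \<Longrightarrow> dist (g z) L < e"
    using g e unfolding tendsto_iff eventually_at by blast
  obtain N where N: "\<And>n z. n \<ge> N \<Longrightarrow> cmod z < 1 \<Longrightarrow> cmod (1 - (\<phi> ^^ n) z) < d"
    using iterates_uniformly_to_1[OF d(1)] by metis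
  have "cmod (g ((\<phi> ^^ n) z) - L) < e" if "n \<ge> N" "cmod z < 1" for n z
  proof -
    have "cmod ((\<phi> ^^ n) z) < 1" by (rule iterate_disc[OF that(2)])
    then have "(\<phi> ^^ n) z \<in> unit_disc" "(\<phi> ^^ n) z \<noteq> 1" by auto
    then show ?thesis using d(2)[of "(\<phi> ^^ n) z"] N[OF that] by (simp add: dist_norm norm_minus_commute)
  qed
  then show ?thesis using that by blast
qed

text \<open>At most the first \<open>N\<close> factors exceed \<open>q\<close>. Each of them costs a
  factor \<open>D\<close>, and \<open>min n N\<close> in the induction counts them.\<close>

lemma weight_product_bound:
  assumes g: "g \<in> hardy_inf" and L: "(g \<longlongrightarrow> L) (at 1 within unit_disc)" and q: "cmod L < q"
  obtains C where "C > 0" "\<And>n z. cmod z < 1 \<Longrightarrow> cmod (\<Prod>k<n. g ((\<phi> ^^ k) z)) \<le> C * q ^ n"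
proof -
  obtain M where M: "0 < M" "\<forall>z\<in>unit_disc. cmod (g z) \<le> M" using hardy_infE[OF g] by metis
  obtain N where N: "\<And>n z. n \<ge> N \<Longrightarrow> cmod z < 1 \<Longrightarrow> cmod (g ((\<phi> ^^ n) z) - L) < q - cmod L"
    using tendsto_1_uniformly[OF L, of "q - cmod L"] q by auto
  have q0: "q > 0" using q norm_ge_zero[of L] by linarith
  define D where "D = 1 + M / q"
  have D: "D \<ge> 1" "M \<le> D * q" using M q0 by (auto simp: D_def field_simps)
  have "cmod (\<Prod>k<n. g ((\<phi> ^^ k) z)) \<le> D ^ min n N * q ^ n" if z: "cmod z < 1" for n z
  proof (induction n)
    case (Suc n)
    have "cmod (g ((\<phi> ^^ n) z)) \<le> (if n < N then D else 1) * q"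
    proof (cases "n < N")
      case True
      then show ?thesis using M(2) iterate_disc[OF z, of n] D(2) by (auto intro: order_trans)
    next
      case False
      then show ?thesis
        using N[of n z] z norm_triangle_ineq2[of "g ((\<phi> ^^ n) z)" L] by simp
    qed
    then have "cmod (\<Prod>k<Suc n. g ((\<phi> ^^ k) z)) \<le> (D ^ min n N * q ^ n) * ((if n < N then D else 1) * q)"
      using Suc.IH D q0 by (simp add: norm_mult mult_mono)
    also have "\<dots> = D ^ min (Suc n) N * q ^ Suc n"
      by (cases "n < N") (auto simp: min_def mult_ac)
    finally show ?case .
  qed simp
  moreover have "D ^ min n N * q ^ n \<le> D ^ N * q ^ n" for n
    using D q0 by (intro mult_right_mono power_increasing) auto
  ultimately have "cmod (\<Prod>k<n. g ((\<phi> ^^ k) z)) \<le> D ^ N * q ^ n" if "cmod z < 1" for n z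
    using that by (meson order_trans)
  then show ?thesis using that[of "D ^ N"] D by simp
qed

lemma holomorphic_weight_product:
  assumes "g holomorphic_on unit_disc"
  shows "(\<lambda>z. \<Prod>k<n. g ((\<phi> ^^ k) z)) holomorphic_on unit_disc"
proof (intro holomorphic_intros)
  fix k
  have "(g \<circ> (\<phi> ^^ k)) holomorphic_on unit_disc"
    using iterate_disc by (intro holomorphic_on_compose_gen[OF analytic_selfmapD(1)[OF analytic_selfmap_funpow[OF selfmap]] assms]) auto
  then show "(\<lambda>z. g ((\<phi> ^^ k) z)) holomorphic_on unit_disc" by (simp add: o_def)
qed

text \<open>The \<open>n\<close>-th power is again a weighted composition operator, with the weight
  product and the \<open>n\<close>-th iterate, so the two preceding growth estimates
  multiply.\<close>

lemma weighted_comp_op_power_bound: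
  assumes g: "g \<in> hardy_inf" and L: "(g \<longlongrightarrow> L) (at 1 within unit_disc)" and q: "cmod L < q"
  obtains C where "C > 0" "\<And>n f. norm ((weighted_comp_op g \<phi> ^^ n) f) \<le> C * (q / sqrt a) ^ n * norm f"
proof -
  obtain C1 where C1: "C1 > 0" "\<And>n z. cmod z < 1 \<Longrightarrow> cmod (\<Prod>k<n. g ((\<phi> ^^ k) z)) \<le> C1 * q ^ n"
    using weight_product_bound[OF g L q] by metis
  obtain C2 where C2: "C2 > 0" "\<And>n. comp_bound (\<phi> ^^ n) \<le> C2 * (1 / sqrt a) ^ n"
    using comp_bound_iterate by metis
  have gh: "g holomorphic_on unit_disc" using g by (simp add: hardy_inf_def)
  have q0: "q > 0" using q norm_ge_zero[of L] by linarith
  have "norm ((weighted_comp_op g \<phi> ^^ n) f) \<le> (C1 * C2) * (q / sqrt a) ^ n * norm f" for n f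
  proof -
    define G where "G z = (\<Prod>k<n. g ((\<phi> ^^ k) z))" for z
    have sm: "analytic_selfmap (\<phi> ^^ n)" by (rule analytic_selfmap_funpow[OF selfmap])
    have Gh: "G holomorphic_on unit_disc" unfolding G_def by (rule holomorphic_weight_product[OF gh])
    have Gb: "\<forall>z\<in>unit_disc. cmod (G z) \<le> C1 * q ^ n" using C1(2) by (simp add: G_def)
    have "(weighted_comp_op g \<phi> ^^ n) f = weighted_comp_op G (\<phi> ^^ n) f"
    proof (rule hardy2_eqI)
      fix z :: complex assume z: "z \<in> unit_disc"
      show "h2_fun ((weighted_comp_op g \<phi> ^^ n) f) z = h2_fun (weighted_comp_op G (\<phi> ^^ n) f) z"
        unfolding weighted_comp_op_funpow[OF selfmap g z] h2_fun_weighted_comp_op[OF sm Gh Gb z] G_def ..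
    qed
    then have "norm ((weighted_comp_op g \<phi> ^^ n) f) \<le> (C1 * q ^ n) * comp_bound (\<phi> ^^ n) * norm f"
      using norm_weighted_comp_op[OF sm Gh Gb] by simp
    also have "\<dots> \<le> (C1 * q ^ n) * (C2 * (1 / sqrt a) ^ n) * norm f"
      using C1(1) q0 by (intro mult_right_mono mult_left_mono C2) auto
    also have "\<dots> = (C1 * C2) * (q / sqrt a) ^ n * norm f" by (simp add: power_divide)
    finally show ?thesis .
  qed
  then show ?thesis using that[of "C1 * C2"] C1(1) C2(1) by simp
qed

lemma spectrum_subset:
  assumes g: "g \<in> hardy_inf" and L: "(g \<longlongrightarrow> L) (at 1 within unit_disc)"
  shows "Sp (weighted_comp_op g \<phi>) \<subseteq> {l. cmod l \<le> cmod L / sqrt a}"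
proof (rule subsetI, rule ccontr)
  fix l assume l: "l \<in> Sp (weighted_comp_op g \<phi>)" "l \<notin> {l. cmod l \<le> cmod L / sqrt a}"
  then have lt: "cmod L / sqrt a < cmod l" by simp
  have sa: "sqrt a > 0" using a by simp
  have "cmod L < cmod l * sqrt a" using lt sa by (simp add: field_simps)
  then obtain q where q: "cmod L < q" "q < cmod l * sqrt a" using dense by blast
  obtain C where C: "C > 0" "\<And>n f. norm ((weighted_comp_op g \<phi> ^^ n) f) \<le> C * (q / sqrt a) ^ n * norm f"
    using weighted_comp_op_power_bound[OF g L q(1)] by metis
  have q0: "q > 0" using q norm_ge_zero[of L] by linarith
  have "0 < cmod l * sqrt a" using q0 q(2) by linarith
  then have l0: "cmod l > 0" using sa by (simp only: zero_less_mult_iff) linarith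
  \<comment> \<open>The power bound has ratio \<open>cmod l * t\<close>, and the choice of
    \<open>q\<close> makes \<open>t\<close> less than 1, as the Neumann series requires.\<close>
  define t where "t = q / (cmod l * sqrt a)"
  have "cmod l * t = q / sqrt a" using l0 by (simp add: t_def)
  with C(2) have "norm ((weighted_comp_op g \<phi> ^^ n) f) \<le> C * (cmod l * t) ^ n * norm f" for n f by simp
  moreover have "0 \<le> t" "t < 1" using q0 q(2) l0 sa by (auto simp: t_def field_simps)
  ultimately have "invertible_operator (\<lambda>x. weighted_comp_op g \<phi> x - l *\<^sub>C x)"
    using l0 by (intro Neumann_invertible[OF bounded_clinear_weighted_comp_op[OF selfmap g]]) auto
  with l(1) show False by (simp add: Sp_def)
qed

end

section \<open>Approximate eigenvectors\<close>

text \<open>The real part of \<open>V\<close> is a harmonic majorant: its mean over every circle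
  about 0 is its value at 0, which bounds the quadratic means uniformly in the radius.\<close>

lemma hardy2_of_majorant:
  assumes f: "f holomorphic_on unit_disc" and V: "V holomorphic_on unit_disc"
    and le: "\<forall>z\<in>unit_disc. (cmod (f z))\<^sup>2 \<le> Re (V z)" and z: "z \<in> unit_disc"
  shows "h2_fun (hardy2_of f) z = f z"
proof -
  have "integral {0..2*pi} (\<lambda>t. (cmod (f (r * cis t)))\<^sup>2) \<le> 2 * pi * Re (V 0)"
    if r: "0 < r" "r < 1" for r :: real
  proof -
    have m: "((\<lambda>t. Re (V (r * cis t))) has_integral 2 * pi * Re (V 0)) {0..2*pi}"
      using has_integral_Re[OF circle_mean_value[OF V r]] by simp
    have "integral {0..2*pi} (\<lambda>t. (cmod (f (r * cis t)))\<^sup>2) \<le> integral {0..2*pi} (\<lambda>t. Re (V (r * cis t)))"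
    proof (rule integral_le)
      show "(\<lambda>t. (cmod (f (r * cis t)))\<^sup>2) integrable_on {0..2*pi}"
        by (intro integrable_continuous_interval continuous_intros continuous_on_circle[OF f r])
      show "(\<lambda>t. Re (V (r * cis t))) integrable_on {0..2*pi}" using m by (rule has_integral_integrable)
      show "(cmod (f (r * cis t)))\<^sup>2 \<le> Re (V (r * cis t))" for t
        using le r by (simp add: norm_mult)
    qed
    then show ?thesis using integral_unique[OF m] by simp
  qed
  then have "h2_fun (hardy2_of f) = (\<lambda>z. if z \<in> unit_disc then f z else 0)"
    by (intro hardy2_of(1)[OF f, of "Re (V 0)"]) blast
  then show ?thesis using z by simp
qed

text \<open>In the right half-plane arguments stay below pi/2. So the imaginary part of an exponent
  costs a constant factor, and w^(2x) lies in a sector of half-angle pi x; that this is below pi/2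
  is the condition \<open>x < 1 / 2\<close>.\<close>

lemma exp_Ln_bounds:
  assumes "Re w > 0"
  shows "cmod (exp (s * Ln w)) \<le> exp (pi / 2 * \<bar>Im s\<bar>) * exp (Re s * ln (cmod w))"
    and "x \<ge> 0 \<Longrightarrow> x < 1 / 2 \<Longrightarrow> exp (2 * x * ln (cmod w)) * cos (pi * x) \<le> Re (exp (complex_of_real (2 * x) * Ln w))"
proof -
  have w: "w \<noteq> 0" using assms by auto
  have im: "\<bar>Im (Ln w)\<bar> < pi / 2" using Re_Ln_pos_lt[OF w] assms by blast
  have re: "Re (Ln w) = ln (cmod w)" using w by simp
  have "- (Im s * Im (Ln w)) \<le> \<bar>Im s\<bar> * \<bar>Im (Ln w)\<bar>" by (metis abs_ge_minus_self abs_mult)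
  also have "\<dots> \<le> \<bar>Im s\<bar> * (pi / 2)" using im by (intro mult_left_mono) auto
  finally have "Re s * ln (cmod w) - Im s * Im (Ln w) \<le> pi / 2 * \<bar>Im s\<bar> + Re s * ln (cmod w)"
    by (simp only: mult.commute)
  then have "Re (s * Ln w) \<le> pi / 2 * \<bar>Im s\<bar> + Re s * ln (cmod w)" by (simp only: times_complex.sel re)
  then show "cmod (exp (s * Ln w)) \<le> exp (pi / 2 * \<bar>Im s\<bar>) * exp (Re s * ln (cmod w))"
    by (simp only: norm_exp_eq_Re exp_add[symmetric] exp_le_cancel_iff)
  assume x: "x \<ge> 0" "x < 1 / 2"
  have "Re (exp (complex_of_real (2 * x) * Ln w)) = exp (2 * x * ln (cmod w)) * cos (2 * x * Im (Ln w))"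
    by (simp add: Re_exp re)
  moreover have "cos (pi * x) \<le> cos (2 * x * Im (Ln w))"
  proof -
    have "\<bar>2 * x * Im (Ln w)\<bar> = 2 * x * \<bar>Im (Ln w)\<bar>" using x by (simp add: abs_mult)
    also have "\<dots> \<le> 2 * x * (pi / 2)" using x im by (intro mult_left_mono) auto
    finally have "\<bar>2 * x * Im (Ln w)\<bar> \<le> pi * x" by (simp add: mult.commute)
    moreover have "pi * x \<le> pi" using x by (simp add: mult_left_le)
    ultimately have "cos (pi * x) \<le> cos \<bar>2 * x * Im (Ln w)\<bar>"
      by (intro cos_monotone_0_pi_le) auto
    then show ?thesis by simp
  qed
  ultimately show "exp (2 * x * ln (cmod w)) * cos (pi * x) \<le> Re (exp (complex_of_real (2 * x) * Ln w))"
    by (simp add: mult_left_mono)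
qed

text \<open>\<open>\<bar>F\<bar>\<close> to an exponent less than 1 is dominated by the real part of the same power of \<open>F\<close>, whose
  circle means are constant.\<close>

lemma h2_fun_hardy2_of_power:
  assumes F: "F holomorphic_on unit_disc" and m: "m > 0" "\<forall>z\<in>unit_disc. m \<le> Re (F z)"
    and s: "Re s < 1 / 2" and b: "b holomorphic_on unit_disc" "\<forall>z\<in>unit_disc. cmod (b z) \<le> M"
    and z: "z \<in> unit_disc"
  shows "h2_fun (hardy2_of (\<lambda>z. b z * exp (s * Ln (F z)))) z = b z * exp (s * Ln (F z))"
proof -
  \<comment> \<open>A negative real part of the exponent is raised to 0; as \<open>F\<close> is
    bounded away from 0, this costs the constant factor \<open>D\<close>.\<close>
  define x where "x = max 0 (Re s)"
  have x: "0 \<le> x" "x < 1 / 2" "Re s \<le> x" using s by (auto simp: x_def)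
  define E where "E = exp (pi / 2 * \<bar>Im s\<bar>)"
  define D where "D = exp ((Re s - x) * ln m)"
  have F0: "Re (F z) > 0" if "z \<in> unit_disc" for z using m that by (meson less_le_trans)
  have Fnr: "F z \<notin> \<real>\<^sub>\<le>\<^sub>0" if "z \<in> unit_disc" for z
    using F0[OF that] by (auto simp: complex_nonpos_Reals_iff)
  have LnF: "(\<lambda>z. Ln (F z)) holomorphic_on unit_disc"
    using Fnr by (intro holomorphic_intros F) auto
  have cx: "cos (pi * x) > 0"
    using x by (intro cos_gt_zero_pi) (auto simp: field_simps intro: less_le_trans[of _ 0])
  \<comment> \<open>Division by the cosine turns the lower bound for the real part of the power into
    a majorant of its modulus.\<close>
  define K where "K = (M * (E * D))\<^sup>2 / cos (pi * x)"
  have K: "K \<ge> 0" using cx by (simp add: K_def)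
  show ?thesis
  proof (rule hardy2_of_majorant[OF _ _ _ z])
    show "(\<lambda>z. b z * exp (s * Ln (F z))) holomorphic_on unit_disc"
      by (intro holomorphic_intros LnF b)
    show "(\<lambda>z. complex_of_real K * exp (complex_of_real (2 * x) * Ln (F z))) holomorphic_on unit_disc"
      by (intro holomorphic_intros LnF)
    show "\<forall>z\<in>unit_disc. (cmod (b z * exp (s * Ln (F z))))\<^sup>2
        \<le> Re (complex_of_real K * exp (complex_of_real (2 * x) * Ln (F z)))"
    proof
      fix z assume z: "z \<in> unit_disc"
      define y where "y = ln (cmod (F z))"
      have "m \<le> cmod (F z)" using m(2) z complex_Re_le_cmod[of "F z"] by (meson order_trans)
      then have "ln m \<le> y" unfolding y_def using m(1) by (intro ln_mono) auto
      then have "(Re s - x) * y \<le> (Re s - x) * ln m" using x by (intro mult_left_mono_neg) auto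
      then have "exp (Re s * y) \<le> D * exp (x * y)"
        unfolding D_def exp_add[symmetric] by (simp add: algebra_simps)
      then have "E * exp (Re s * y) \<le> E * (D * exp (x * y))"
        by (intro mult_left_mono) (auto simp: E_def)
      then have "cmod (exp (s * Ln (F z))) \<le> E * (D * exp (x * y))"
        using exp_Ln_bounds(1)[OF F0[OF z], of s] unfolding E_def[symmetric] y_def[symmetric]
        by linarith
      moreover have "M \<ge> 0" using b(2) z order_trans[OF norm_ge_zero[of "b z"]] by blast
      ultimately have "cmod (b z * exp (s * Ln (F z))) \<le> M * (E * (D * exp (x * y)))"
        unfolding norm_mult using b(2) z by (intro mult_mono) auto
      then have "(cmod (b z * exp (s * Ln (F z))))\<^sup>2 \<le> (M * (E * (D * exp (x * y))))\<^sup>2"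
        by (intro power_mono) auto
      also have "\<dots> = K * (exp (2 * x * y) * cos (pi * x))"
      proof -
        have "(exp (x * y))\<^sup>2 = exp (2 * x * y)" by (simp add: power2_eq_square flip: exp_add)
        then show ?thesis using cx by (simp add: K_def power_mult_distrib)
      qed
      also have "\<dots> \<le> K * Re (exp (complex_of_real (2 * x) * Ln (F z)))"
        using exp_Ln_bounds(2)[OF F0[OF z] x(1,2)] K by (intro mult_left_mono) (auto simp: y_def)
      finally show "(cmod (b z * exp (s * Ln (F z))))\<^sup>2 \<le> Re (complex_of_real K * exp (complex_of_real (2 * x) * Ln (F z)))"
        by simp
    qed
  qed
qed

text \<open>Multiplication is weighted composition with the identity map, whose
  \<open>comp_bound\<close> is 1.\<close>

lemma norm_multiplication:
  assumes m: "m holomorphic_on unit_disc" "\<forall>z\<in>unit_disc. cmod (m z) \<le> M"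
    and eq: "\<And>z. z \<in> unit_disc \<Longrightarrow> h2_fun f z = m z * h2_fun h z"
  shows "norm f \<le> M * norm h"
proof -
  have sm: "analytic_selfmap (\<lambda>z. z)" by (simp add: analytic_selfmap_def)
  have "f = weighted_comp_op m (\<lambda>z. z) h"
    by (rule hardy2_eqI) (simp add: eq h2_fun_weighted_comp_op[OF sm m])
  then show ?thesis using norm_weighted_comp_op[OF sm m, of h] by (simp add: comp_bound_def)
qed

lemma poly_bounded_on:
  fixes p :: "complex poly"
  assumes "\<And>z. z \<in> A \<Longrightarrow> cmod (X z) \<le> R"
  obtains M where "\<And>z. z \<in> A \<Longrightarrow> cmod (poly p (X z)) \<le> M"
proof -
  have "bounded (poly p ` cball 0 R)"
    by (intro compact_imp_bounded compact_continuous_image continuous_intros compact_cball)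
  then obtain M where "\<forall>w\<in>cball 0 R. cmod (poly p w) \<le> M" unfolding bounded_iff by auto
  then show ?thesis using that[of M] assms by auto
qed

section \<open>The invariant function and the approximate eigenvectors\<close>

context hyperbolic_selfmap
begin

lemma Ln_koenigs_selfmap:
  assumes "cmod z < 1"
  shows "Ln (koenigs (\<phi> z)) = Ln (koenigs z) - complex_of_real (ln a)"
proof -
  have "koenigs z \<noteq> 0" using Re_koenigs_pos[OF assms] by auto
  then show ?thesis
    unfolding koenigs_selfmap[OF assms] using Ln_divide_of_real[of a "koenigs z"] a by (simp add: Ln_of_real)
qed

text \<open>Under \<open>\<phi>\<close> the logarithm of the Koenigs map changes by
  \<open>- ln a\<close>, so this factor produces a shift by a full period of \<open>exp\<close>. It
  is purely imaginary, which makes \<open>invariant\<close> bounded.\<close>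

definition period :: complex where
  "period = 2 * of_real pi * \<i> / of_real (ln a)"

definition invariant :: "complex \<Rightarrow> complex" where
  "invariant z = exp (period * Ln (koenigs z))"

lemma ln_a: "ln a < 0"
  using a by simp

lemma invariant_selfmap:
  assumes "cmod z < 1"
  shows "invariant (\<phi> z) = invariant z"
proof -
  have "period * Ln (koenigs (\<phi> z)) = period * Ln (koenigs z) - 2 * of_real pi * \<i>"
    using ln_a unfolding Ln_koenigs_selfmap[OF assms] by (simp add: period_def right_diff_distrib)
  then show ?thesis unfolding invariant_def by (simp add: exp_diff)
qed

lemma koenigs_not_nonpos: "cmod z < 1 \<Longrightarrow> koenigs z \<notin> \<real>\<^sub>\<le>\<^sub>0"
  using Re_koenigs_pos[of z] by (auto simp: complex_nonpos_Reals_iff)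

lemma holomorphic_Ln_koenigs: "(\<lambda>z. Ln (koenigs z)) holomorphic_on unit_disc"
  using koenigs_not_nonpos by (intro holomorphic_intros holomorphic_koenigs) auto

lemma holomorphic_invariant: "invariant holomorphic_on unit_disc"
  unfolding invariant_def by (intro holomorphic_intros holomorphic_Ln_koenigs)

lemma invariant_bounded:
  assumes "cmod z < 1"
  shows "cmod (invariant z) \<le> exp (pi / 2 * \<bar>Im period\<bar>)"
proof -
  have "Re period = 0" by (simp add: period_def Re_divide_of_real)
  then show ?thesis using exp_Ln_bounds(1)[OF Re_koenigs_pos[OF assms], of period] by (simp add: invariant_def)
qed

lemma filterlim_iterate:
  assumes "filterlim \<phi> (at 1 within unit_disc) (at 1 within unit_disc)"
  shows "filterlim (\<phi> ^^ n) (at 1 within unit_disc) (at 1 within unit_disc)"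
proof (induction n)
  case (Suc n)
  then show ?case using filterlim_compose[OF assms Suc] by (simp add: o_def)
qed (simp add: filterlim_ident id_def)

lemma filterlim_selfmap_at_1: "filterlim \<phi> (at 1 within unit_disc) (at 1 within unit_disc)"
proof -
  have "(\<phi> \<longlongrightarrow> 1) (at 1 within unit_disc)"
  proof (rule LIM_zero_cancel, rule Lim_null_comparison)
    show "((\<lambda>z. a * cmod (1 - z) + B * (cmod (1 - z))\<^sup>2) \<longlongrightarrow> 0) (at 1 within unit_disc)"
      by (rule tendsto_eq_intros refl | simp)+
    have "\<forall>\<^sub>F z in at 1 within unit_disc. z \<in> unit_disc \<and> cmod (1 - z) < \<rho>"
      using \<rho> unfolding eventually_at by (intro exI[of _ \<rho>]) (auto simp: dist_norm norm_minus_commute)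
    then show "\<forall>\<^sub>F z in at 1 within unit_disc. norm (\<phi> z - 1) \<le> a * cmod (1 - z) + B * (cmod (1 - z))\<^sup>2"
    proof (rule eventually_mono)
      fix z assume z: "z \<in> unit_disc \<and> cmod (1 - z) < \<rho>"
      have "norm (\<phi> z - 1) \<le> cmod (1 - \<phi> z - a * (1 - z)) + cmod (a * (1 - z))"
        using norm_triangle_ineq[of "1 - \<phi> z - a * (1 - z)" "a * (1 - z)"] by (simp add: norm_minus_commute)
      with tangent[of z] z a show "norm (\<phi> z - 1) \<le> a * cmod (1 - z) + B * (cmod (1 - z))\<^sup>2"
        by (simp add: norm_mult)
    qed
  qed
  moreover have "\<forall>\<^sub>F z in at 1 within unit_disc. \<phi> z \<in> unit_disc \<and> \<phi> z \<noteq> 1"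
  proof -
    have "\<forall>\<^sub>F z in at 1 within unit_disc. z \<in> unit_disc" by (simp add: eventually_at_filter)
    then show ?thesis
    proof (rule eventually_mono)
      fix z assume "z \<in> unit_disc"
      then have "cmod (\<phi> z) < 1" using analytic_selfmapD(2)[OF selfmap] by simp
      then show "\<phi> z \<in> unit_disc \<and> \<phi> z \<noteq> 1" by auto
    qed
  qed
  ultimately show ?thesis by (simp add: filterlim_at)
qed

text \<open>Otherwise the invariant would take finitely many values on a convex piece of the disc
  near 1, so it and the Koenigs map would be constant there. But the piece contains a point together
  with its image, at which the Koenigs values differ by the factor \<open>1 / a\<close>.\<close>

lemma poly_invariant_nonzero_near_1:
  assumes p: "p \<noteq> 0" and ev: "\<forall>\<^sub>F z in at 1 within unit_disc. P z"
  obtains z where "z \<in> unit_disc" "P z" "poly p (invariant z) \<noteq> 0"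
proof -
  obtain d where d: "d > 0" "\<And>z. z \<in> unit_disc \<Longrightarrow> z \<noteq> 1 \<Longrightarrow> dist z 1 < d \<Longrightarrow> P z"
    using ev unfolding eventually_at by blast
  define S where "S = unit_disc \<inter> ball 1 d"
  have S: "convex S" "open S" "S \<subseteq> unit_disc" by (auto simp: S_def intro: convex_Int)
  have PS: "P z" if z: "z \<in> S" for z
  proof -
    have "z \<noteq> 1" using z by (auto simp: S_def)
    then show ?thesis using d(2)[of z] z by (simp add: S_def dist_commute)
  qed
  have evS: "\<forall>\<^sub>F z in at 1 within unit_disc. z \<in> S"
    using d(1) unfolding eventually_at by (intro exI[of _ d]) (auto simp: S_def dist_commute)
  then have "\<forall>\<^sub>F z in at 1 within unit_disc. \<phi> z \<in> S"
    using filterlim_selfmap_at_1 unfolding filterlim_iff by blast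
  with evS have "\<forall>\<^sub>F z in at 1 within unit_disc. z \<in> S \<and> \<phi> z \<in> S" by (rule eventually_conj)
  then obtain z0 where z0: "z0 \<in> S" "\<phi> z0 \<in> S"
    using eventually_happens'[OF at_1_within_disc] by blast
  have "\<exists>z\<in>S. poly p (invariant z) \<noteq> 0"
  proof (rule ccontr)
    assume "\<not> ?thesis"
    then have "invariant ` S \<subseteq> {x. poly p x = 0}" by auto
    then have fin: "finite (invariant ` S)" using poly_roots_finite[OF p] finite_subset by blast
    have "connected (invariant ` S)"
      by (intro connected_continuous_image[OF _ convex_connected[OF S(1)]]
          holomorphic_on_imp_continuous_on holomorphic_on_subset[OF holomorphic_invariant S(3)])
    then have "is_singleton (invariant ` S)"
      using fin z0 connected_finite_iff_sing[of "invariant ` S"] by (auto simp: is_singleton_def)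
    then have const: "invariant z = invariant z0" if "z \<in> S" for z
      using z0 that by (metis imageI is_singletonE singletonD)
    have dk: "(koenigs has_field_derivative deriv koenigs z) (at z)" if "z \<in> S" for z
      using that S by (intro holomorphic_derivI[OF holomorphic_koenigs open_ball]) auto
    have "deriv koenigs z = 0" if z: "z \<in> S" for z
    proof -
      have z1: "cmod z < 1" using z S by auto
      have k0: "koenigs z \<noteq> 0" using Re_koenigs_pos[OF z1] by auto
      have "(invariant has_field_derivative exp (period * Ln (koenigs z)) * (period * (inverse (koenigs z) * deriv koenigs z))) (at z)"
        unfolding invariant_def using dk[OF z] koenigs_not_nonpos[OF z1]
        by (auto intro!: derivative_eq_intros)
      moreover have "(invariant has_field_derivative 0) (at z)"
      proof (rule has_field_derivative_transform_within_open[OF _ S(2) z])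
        show "((\<lambda>_. invariant z0) has_field_derivative 0) (at z)" by simp
      qed (use const in auto)
      ultimately have "exp (period * Ln (koenigs z)) * (period * (inverse (koenigs z) * deriv koenigs z)) = 0"
        by (rule DERIV_unique)
      moreover have "period \<noteq> 0" using ln_a by (simp add: period_def)
      ultimately show ?thesis using k0 by simp
    qed
    then have "\<exists>c. \<forall>z\<in>S. koenigs z = c"
      using dk by (intro has_field_derivative_zero_constant[OF S(1)]) (metis has_field_derivative_at_within)
    then have "koenigs (\<phi> z0) = koenigs z0" using z0 by metis
    moreover have "cmod z0 < 1" using z0 S by auto
    ultimately have "koenigs z0 = koenigs z0 / a" using koenigs_selfmap by simp
    moreover have "koenigs z0 \<noteq> 0" using Re_koenigs_pos[OF \<open>cmod z0 < 1\<close>] by auto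
    ultimately show False using a by (simp add: field_simps)
  qed
  then show ?thesis using that PS S by blast
qed


text \<open>For constant \<open>G\<close>, all nonzero members are eigenvectors of composition with
  \<open>\<phi>\<close> for the one eigenvalue exp (- sigma ln a), whatever \<open>p\<close> is;
  this freedom supplies the infinite dimension.\<close>

definition eigenfamily :: "(complex \<Rightarrow> complex) \<Rightarrow> complex \<Rightarrow> complex poly \<Rightarrow> hardy2" where
  "eigenfamily G \<sigma> p = hardy2_of (\<lambda>z. (G z * poly p (invariant z)) * exp (\<sigma> * Ln (koenigs z)))"

lemma h2_fun_eigenfamily:
  assumes G: "G holomorphic_on unit_disc" "\<forall>z\<in>unit_disc. cmod (G z) \<le> M" and \<sigma>: "Re \<sigma> < 1 / 2"
    and z: "z \<in> unit_disc"
  shows "h2_fun (eigenfamily G \<sigma> p) z = (G z * poly p (invariant z)) * exp (\<sigma> * Ln (koenigs z))"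
proof -
  have "cmod (invariant z) \<le> exp (pi / 2 * \<bar>Im period\<bar>)" if "z \<in> unit_disc" for z
    using invariant_bounded that by simp
  then obtain M' where M': "\<And>z. z \<in> unit_disc \<Longrightarrow> cmod (poly p (invariant z)) \<le> M'"
    using poly_bounded_on[of unit_disc invariant] by metis
  have "M \<ge> 0" using G(2) z order_trans[OF norm_ge_zero[of "G z"]] by blast
  show ?thesis
    unfolding eigenfamily_def
  proof (rule h2_fun_hardy2_of_power[OF holomorphic_koenigs _ _ \<sigma> _ _ z])
    show "a * c > 0" using a c by simp
    show "\<forall>z\<in>unit_disc. a * c \<le> Re (koenigs z)" using Re_koenigs by simp
    show "(\<lambda>z. G z * poly p (invariant z)) holomorphic_on unit_disc"
      by (intro holomorphic_intros G holomorphic_on_compose_gen[OF holomorphic_invariant, of "poly p" UNIV, unfolded o_def]) auto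
    show "\<forall>z\<in>unit_disc. cmod (G z * poly p (invariant z)) \<le> M * M'"
      unfolding norm_mult using G(2) M' \<open>M \<ge> 0\<close> by (intro ballI mult_mono) auto
  qed
qed

lemma eigenfamily_linear:
  assumes G: "G holomorphic_on unit_disc" "\<forall>z\<in>unit_disc. cmod (G z) \<le> M" and \<sigma>: "Re \<sigma> < 1 / 2"
  shows "eigenfamily G \<sigma> (p + q) = eigenfamily G \<sigma> p + eigenfamily G \<sigma> q"
    and "eigenfamily G \<sigma> (smult (complex_of_real r) p) = r *\<^sub>R eigenfamily G \<sigma> p"
  by (rule hardy2_eqI, simp only: h2_fun_eigenfamily[OF G \<sigma>] plus_hardy2.rep_eq scaleR_hardy2.rep_eq
      poly_add poly_smult, simp only: algebra_simps)+

lemma eigenfamily_nonzero: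
  assumes G: "G holomorphic_on unit_disc" "\<forall>z\<in>unit_disc. cmod (G z) \<le> M" and \<sigma>: "Re \<sigma> < 1 / 2"
    and ev: "\<forall>\<^sub>F z in at 1 within unit_disc. G z \<noteq> 0" and p: "p \<noteq> 0"
  shows "eigenfamily G \<sigma> p \<noteq> 0"
proof
  assume 0: "eigenfamily G \<sigma> p = 0"
  obtain z where z: "z \<in> unit_disc" "G z \<noteq> 0" "poly p (invariant z) \<noteq> 0"
    using poly_invariant_nonzero_near_1[OF p ev] by metis
  have "h2_fun (eigenfamily G \<sigma> p) z = 0" by (simp add: 0 zero_hardy2.rep_eq)
  with z show False unfolding h2_fun_eigenfamily[OF G \<sigma> z(1)] by simp
qed

text \<open>With \<open>G\<close> the product of the first \<open>n\<close> factors \<open>g \<circ> \<phi>\<^sup>k\<close>, the members of the family are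
  eigenvectors up to a factor \<open>g (\<phi>\<^sup>n z) / L\<close>, which is uniformly close to 1 for large \<open>n\<close>; so no
  convergence of the infinite product is required.\<close>

lemma not_Fredholm_nonzero_limit:
  assumes g: "g \<in> hardy_inf" and L: "(g \<longlongrightarrow> L) (at 1 within unit_disc)" and L0: "L \<noteq> 0"
    and l: "cmod l \<le> cmod L / sqrt a"
  shows "\<not> Fredholm (\<lambda>x. weighted_comp_op g \<phi> x - l *\<^sub>C x)"
proof (rule not_Fredholm_if_approx_kernel)
  fix \<epsilon> :: real assume \<epsilon>: "\<epsilon> > 0"
  define R where "R = cmod L / sqrt a"
  have R: "R > 0" using L0 a by (simp add: R_def)
  \<comment> \<open>The exponent exists for nonzero values of modulus below \<open>R\<close>. The
    point 0 and the bounding circle are reached by moving \<open>l\<close> by at most half the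
    tolerance; the other half is left for the weight.\<close>
  obtain \<mu> where \<mu>: "\<mu> \<noteq> 0" "cmod \<mu> < R" "cmod (\<mu> - l) \<le> \<epsilon> / 2"
  proof (cases "l = 0")
    case True
    define x where "x = min (\<epsilon> / 2) (R / 2)"
    have "x > 0" "x < R" "x \<le> \<epsilon> / 2" using \<epsilon> R by (auto simp: x_def)
    then show ?thesis using that[of "complex_of_real x"] True by simp
  next
    case False
    define x where "x = min (1 / 2) (\<epsilon> / (2 * cmod l))"
    have x: "0 < x" "x \<le> 1 / 2" "x \<le> \<epsilon> / (2 * cmod l)" using \<epsilon> False by (auto simp: x_def)
    have "cmod (complex_of_real (1 - x) * l) = (1 - x) * cmod l"
      unfolding norm_mult norm_of_real using x by simp
    also have "\<dots> < cmod l" using x False by (simp add: algebra_simps)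
    finally have 1: "cmod (complex_of_real (1 - x) * l) < R" using l by (simp only: R_def)
    have "complex_of_real (1 - x) * l - l = - (complex_of_real x * l)" by (simp add: algebra_simps)
    then have "cmod (complex_of_real (1 - x) * l - l) = x * cmod l"
      using x by (simp only: norm_minus_cancel norm_mult norm_of_real)
    also have "\<dots> \<le> \<epsilon> / 2" using x(3) False by (simp add: field_simps)
    finally have 2: "cmod (complex_of_real (1 - x) * l - l) \<le> \<epsilon> / 2" .
    have "complex_of_real (1 - x) \<noteq> 0" unfolding of_real_eq_0_iff using x by simp
    then show ?thesis by (intro that[OF no_zero_divisors[OF _ False] 1 2])
  qed
  \<comment> \<open>The solution of a^(-sigma) = mu / L. As \<open>ln a\<close> is negative,
    \<open>Re \<sigma> < 1 / 2\<close> amounts to \<open>cmod \<mu> < R\<close>.\<close>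
  define \<sigma> where "\<sigma> = - Ln (\<mu> / L) / complex_of_real (ln a)"
  have \<sigma>: "Re \<sigma> < 1 / 2"
  proof -
    have "cmod \<mu> / cmod L < 1 / sqrt a" using \<mu>(2) L0 a by (simp add: R_def field_simps)
    moreover have "cmod \<mu> / cmod L > 0" using \<mu>(1) L0 by simp
    ultimately have "ln (cmod \<mu> / cmod L) < ln (1 / sqrt a)"
      using a by (subst ln_less_cancel_iff) auto
    also have "ln (1 / sqrt a) = - ln a / 2" using a by (simp add: ln_div ln_sqrt)
    finally have "ln (cmod \<mu> / cmod L) < - ln a / 2" .
    moreover have "Re (Ln (\<mu> / L)) = ln (cmod \<mu> / cmod L)" using \<mu>(1) L0 by (simp add: norm_divide)
    ultimately show ?thesis
      using ln_a unfolding \<sigma>_def Re_divide_of_real by (simp add: divide_less_eq field_simps)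
  qed
  have \<sigma>\<mu>: "exp (- (\<sigma> * complex_of_real (ln a))) = \<mu> / L"
    using \<mu>(1) L0 ln_a by (simp add: \<sigma>_def exp_Ln)
  \<comment> \<open>Multiplication by \<open>\<mu> / L\<close> will turn this tolerance into
    \<open>\<epsilon> / 2\<close>.\<close>
  have "cmod L * \<epsilon> / (2 * cmod \<mu>) > 0" using \<epsilon> L0 \<mu>(1) by simp
  then obtain n where n: "\<And>z. cmod z < 1 \<Longrightarrow> cmod (g ((\<phi> ^^ n) z) - L) < cmod L * \<epsilon> / (2 * cmod \<mu>)"
    using tendsto_1_uniformly[OF L] by (metis order_refl)
  have gh: "g holomorphic_on unit_disc" using g by (simp add: hardy_inf_def)
  define G where "G z = (\<Prod>k<n. g ((\<phi> ^^ k) z))" for z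
  have Gh: "G holomorphic_on unit_disc" unfolding G_def by (rule holomorphic_weight_product[OF gh])
  obtain M where GM: "\<forall>z\<in>unit_disc. cmod (G z) \<le> M"
    using weight_product_bound[OF g L, of "cmod L + 1"] unfolding G_def by (metis less_add_one mem_ball_0)
  \<comment> \<open>Zeros of \<open>g\<close> may produce zeros of \<open>G\<close> inside the disc,
    but at 1 it tends to L^n, which is not 0; nonvanishing near 1 is enough for
    \<open>eigenfamily_nonzero\<close>.\<close>
  have Gne: "\<forall>\<^sub>F z in at 1 within unit_disc. G z \<noteq> 0"
  proof -
    have "((\<lambda>z. g ((\<phi> ^^ k) z)) \<longlongrightarrow> L) (at 1 within unit_disc)" for k
      by (rule filterlim_compose[OF L filterlim_iterate[OF filterlim_selfmap_at_1]])
    then have "(G \<longlongrightarrow> (\<Prod>k<n. L)) (at 1 within unit_disc)"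
      unfolding G_def by (intro tendsto_prod)
    then show ?thesis by (rule tendsto_imp_eventually_ne) (use L0 in simp)
  qed
  define E where "E = eigenfamily G \<sigma>"
  note hE = h2_fun_eigenfamily[OF Gh GM \<sigma>, folded E_def]
  have "norm (weighted_comp_op g \<phi> (E p) - l *\<^sub>C E p) \<le> \<epsilon> * norm (E p)" for p
  proof (rule norm_multiplication)
    \<comment> \<open>On every member of the family the operator minus \<open>l\<close> is
      multiplication by this one function, which does not depend on \<open>p\<close>.\<close>
    define m where "m z = \<mu> / L * g ((\<phi> ^^ n) z) - l" for z
    have "(g \<circ> (\<phi> ^^ n)) holomorphic_on unit_disc"
      using iterate_disc
      by (intro holomorphic_on_compose_gen[OF analytic_selfmapD(1)[OF analytic_selfmap_funpow[OF selfmap]] gh]) auto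
    then show "m holomorphic_on unit_disc" unfolding m_def by (intro holomorphic_intros) (simp add: o_def)
    show "\<forall>z\<in>unit_disc. cmod (m z) \<le> \<epsilon>"
    proof
      fix z :: complex assume "z \<in> unit_disc"
      then have z: "cmod z < 1" by simp
      have "m z = \<mu> / L * (g ((\<phi> ^^ n) z) - L) + (\<mu> - l)" using L0 by (simp add: m_def field_simps)
      then have "cmod (m z) \<le> cmod (\<mu> / L * (g ((\<phi> ^^ n) z) - L)) + cmod (\<mu> - l)" by (metis norm_triangle_ineq)
      also have "cmod (\<mu> / L * (g ((\<phi> ^^ n) z) - L)) \<le> cmod \<mu> / cmod L * (cmod L * \<epsilon> / (2 * cmod \<mu>))"
        unfolding norm_mult norm_divide using n[OF z] by (intro mult_left_mono) auto
      also have "\<dots> = \<epsilon> / 2" using L0 \<mu>(1) by simp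
      finally show "cmod (m z) \<le> \<epsilon>" using \<mu>(3) by simp
    qed
    fix z :: complex assume z: "z \<in> unit_disc"
    have z1: "cmod z < 1" using z by simp
    have \<phi>z: "\<phi> z \<in> unit_disc" using analytic_selfmapD(2)[OF selfmap z1] by simp
    obtain M' where M': "\<forall>z\<in>unit_disc. cmod (g z) \<le> M'" using hardy_infE[OF g] by metis
    \<comment> \<open>Composing with \<open>\<phi>\<close> shifts the indices of the product up by
      one: \<open>g z\<close> restores the first factor, and one factor remains at the end.\<close>
    have GG: "g z * G (\<phi> z) = G z * g ((\<phi> ^^ n) z)"
    proof -
      have "(\<Prod>k<Suc n. g ((\<phi> ^^ k) z)) = g z * G (\<phi> z)"
        unfolding prod.lessThan_Suc_shift G_def by (simp add: funpow_swap1)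
      then show ?thesis by (simp add: G_def)
    qed
    have ex: "exp (\<sigma> * Ln (koenigs (\<phi> z))) = \<mu> / L * exp (\<sigma> * Ln (koenigs z))"
    proof -
      have "\<sigma> * Ln (koenigs (\<phi> z)) = - (\<sigma> * complex_of_real (ln a)) + \<sigma> * Ln (koenigs z)"
        unfolding Ln_koenigs_selfmap[OF z1] by (simp add: right_diff_distrib)
      then show ?thesis by (simp only: exp_add \<sigma>\<mu>)
    qed
    have "h2_fun (weighted_comp_op g \<phi> (E p)) z
        = (g z * G (\<phi> z)) * poly p (invariant z) * (\<mu> / L * exp (\<sigma> * Ln (koenigs z)))"
      unfolding h2_fun_weighted_comp_op[OF selfmap gh M' z] hE[OF \<phi>z] invariant_selfmap[OF z1] ex
      by (simp only: mult.assoc)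
    also have "\<dots> = (\<mu> / L * g ((\<phi> ^^ n) z)) * h2_fun (E p) z"
      unfolding GG hE[OF z] by (simp only: mult_ac)
    finally show "h2_fun (weighted_comp_op g \<phi> (E p) - l *\<^sub>C E p) z = m z * h2_fun (E p) z"
      by (simp add: h2_fun_diff scaleC_hardy2.rep_eq m_def left_diff_distrib)
  qed
  then show "\<exists>E :: complex poly \<Rightarrow> hardy2. (\<forall>p q. E (p + q) = E p + E q)
      \<and> (\<forall>r p. E (smult (complex_of_real r) p) = r *\<^sub>R E p) \<and> (\<forall>p. p \<noteq> 0 \<longrightarrow> E p \<noteq> 0)
      \<and> (\<forall>p. norm (weighted_comp_op g \<phi> (E p) - l *\<^sub>C E p) \<le> \<epsilon> * norm (E p))"
    using eigenfamily_linear[OF Gh GM \<sigma>] eigenfamily_nonzero[OF Gh GM \<sigma> Gne]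
    by (intro exI[of _ E]) (simp add: E_def)
qed

section \<open>Weights with limit 0 at 1, and the two spectra\<close>

lemma constant_eigenfamily:
  shows "eigenfamily (\<lambda>_. 1) 0 (p + q) = eigenfamily (\<lambda>_. 1) 0 p + eigenfamily (\<lambda>_. 1) 0 q"
    and "eigenfamily (\<lambda>_. 1) 0 (smult (complex_of_real r) p) = r *\<^sub>R eigenfamily (\<lambda>_. 1) 0 p"
    and "p \<noteq> 0 \<Longrightarrow> eigenfamily (\<lambda>_. 1) 0 p \<noteq> 0"
  by (simp_all add: eigenfamily_linear[where M = 1] eigenfamily_nonzero[where M = 1])

text \<open>Where \<open>g\<close> is nonzero the composition of \<open>f\<close> with
  \<open>\<phi>\<close> vanishes, hence on the whole disc. The image of \<open>\<phi>\<close> is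
  open, so analytic continuation applies a second time, now to \<open>f\<close>.\<close>

lemma weighted_comp_op_injective:
  assumes g: "g \<in> hardy_inf" and z0: "z0 \<in> unit_disc" "g z0 \<noteq> 0" and f: "weighted_comp_op g \<phi> f = 0"
  shows "f = 0"
proof (rule hardy2_eqI)
  fix z :: complex assume z: "z \<in> unit_disc"
  obtain M where M: "g holomorphic_on unit_disc" "\<forall>z\<in>unit_disc. cmod (g z) \<le> M" using hardy_infE[OF g] by metis
  have \<phi>h: "\<phi> holomorphic_on unit_disc" by (rule analytic_selfmapD(1)[OF selfmap])
  have \<phi>U: "\<phi> ` unit_disc \<subseteq> unit_disc" using selfmap by (simp add: analytic_selfmap_def)
  have fh: "(\<lambda>z. h2_fun f (\<phi> z)) holomorphic_on unit_disc"
    using holomorphic_on_compose_gen[OF \<phi>h h2_fun_holomorphic[of f] \<phi>U] by (simp add: o_def)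
  define W where "W = {z \<in> unit_disc. g z \<noteq> 0}"
  have "open W"
  proof -
    have "open (unit_disc \<inter> g -` (- {0}))"
      by (intro continuous_open_preimage holomorphic_on_imp_continuous_on M) auto
    moreover have "W = unit_disc \<inter> g -` (- {0})" by (auto simp: W_def)
    ultimately show ?thesis by simp
  qed
  have W0: "h2_fun f (\<phi> z) = 0" if "z \<in> W" for z
  proof -
    have zU: "z \<in> unit_disc" and "g z \<noteq> 0" using that by (auto simp: W_def)
    have "g z * h2_fun f (\<phi> z) = 0"
      using f h2_fun_weighted_comp_op[OF selfmap M zU, of f] by (simp add: zero_hardy2.rep_eq)
    with \<open>g z \<noteq> 0\<close> show ?thesis by simp
  qed
  have comp0: "h2_fun f (\<phi> z) = 0" if "z \<in> unit_disc" for z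
  proof (rule analytic_continuation_open[of W unit_disc "\<lambda>z. h2_fun f (\<phi> z)" "\<lambda>_. 0"])
    show "W \<noteq> {}" using z0 by (auto simp: W_def)
  qed (use \<open>open W\<close> fh W0 that in \<open>auto simp: W_def\<close>)
  \<comment> \<open>A constant value would have to be the limit 1 at 1, which is not in the
    disc.\<close>
  have nconst: "\<not> \<phi> constant_on unit_disc"
  proof
    assume "\<phi> constant_on unit_disc"
    then obtain w where w: "\<And>z. z \<in> unit_disc \<Longrightarrow> \<phi> z = w" by (auto simp: constant_on_def)
    have "\<forall>\<^sub>F z in at 1 within unit_disc. \<phi> z = w" using w by (simp add: eventually_at_filter)
    then have "(\<phi> \<longlongrightarrow> w) (at 1 within unit_disc)" by (rule tendsto_eventually)
    moreover have "(\<phi> \<longlongrightarrow> 1) (at 1 within unit_disc)" using filterlim_selfmap_at_1 by (simp add: filterlim_at)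
    ultimately have "w = 1" using tendsto_unique[OF at_1_within_disc] by blast
    with w[of 0] analytic_selfmapD(2)[OF selfmap, of 0] show False by simp
  qed
  have op: "open (\<phi> ` unit_disc)"
    by (rule open_mapping_thm[OF \<phi>h open_ball connected_ball open_ball subset_refl nconst])
  have "h2_fun f z = 0"
    by (rule analytic_continuation_open[of "\<phi> ` unit_disc" unit_disc "h2_fun f" "\<lambda>_. 0"])
      (use op \<phi>U comp0 z in auto)
  then show "h2_fun f z = h2_fun 0 z" by (simp add: zero_hardy2.rep_eq)
qed

text \<open>The previous construction divides by the limit of the weight. Here a lower bound for the
  operator would let its powers decay no faster than a fixed geometric rate, which the power bound
  with arbitrarily small \<open>q\<close> contradicts. For a weight that vanishes identically the
  operator is 0 and annihilates an infinite-dimensional family.\<close>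

lemma not_Fredholm_zero_limit:
  assumes g: "g \<in> hardy_inf" and L: "(g \<longlongrightarrow> 0) (at 1 within unit_disc)"
  shows "\<not> Fredholm (weighted_comp_op g \<phi>)"
proof (cases "\<exists>z0\<in>unit_disc. g z0 \<noteq> 0")
  case False
  obtain M where M: "g holomorphic_on unit_disc" "\<forall>z\<in>unit_disc. cmod (g z) \<le> M" using hardy_infE[OF g] by metis
  have "weighted_comp_op g \<phi> f = 0" for f
    by (rule hardy2_eqI) (use False in \<open>simp add: h2_fun_weighted_comp_op[OF selfmap M] zero_hardy2.rep_eq\<close>)
  then show ?thesis
    by (intro not_Fredholm_if_approx_kernel exI[of _ "eigenfamily (\<lambda>_. 1) 0"])
      (auto simp: constant_eigenfamily)
next
  case True
  then obtain z0 where z0: "z0 \<in> unit_disc" "g z0 \<noteq> 0" by blast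
  define T where "T = weighted_comp_op g \<phi>"
  have bc: "bounded_clinear T" unfolding T_def by (rule bounded_clinear_weighted_comp_op[OF selfmap g])
  interpret T: bounded_linear T by (rule bounded_clinearD(1)[OF bc])
  show ?thesis
    unfolding T_def[symmetric]
  proof
    assume "Fredholm T"
    then have "closed (range T)" by (simp add: Fredholm_def)
    then obtain C where C: "C \<ge> 0" "\<And>x. \<exists>x'. T x' = T x \<and> norm x' \<le> C * norm (T x)"
      using closed_range_lift_bounded[OF bounded_clinearD(1)[OF bc]] by metis
    have lb: "norm x \<le> C * norm (T x)" for x
    proof -
      obtain x' where x': "T x' = T x" "norm x' \<le> C * norm (T x)" using C by blast
      have "T (x' - x) = 0" using x' by (simp add: T.diff)
      then have "x' - x = 0" unfolding T_def by (rule weighted_comp_op_injective[OF g z0])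
      with x' show ?thesis by simp
    qed
    have lbn: "norm x \<le> C ^ n * norm ((T ^^ n) x)" for n x
    proof (induction n)
      case (Suc n)
      have "C ^ n * norm ((T ^^ n) x) \<le> C ^ n * (C * norm (T ((T ^^ n) x)))"
        using C(1) by (intro mult_left_mono lb) auto
      with Suc show ?case by (simp add: mult_ac)
    qed simp
    \<comment> \<open>Makes \<open>C * (q / sqrt a)\<close> at most 1/2, also for
      \<open>C = 0\<close>.\<close>
    define q where "q = sqrt a / (2 * (C + 1))"
    have "cmod 0 < q" using a C(1) by (simp add: q_def)
    then obtain K where K: "K > 0" "\<And>n f. norm ((T ^^ n) f) \<le> K * (q / sqrt a) ^ n * norm f"
      using weighted_comp_op_power_bound[OF g L] unfolding T_def by metis
    have qa: "q / sqrt a = 1 / (2 * (C + 1))" using a by (simp add: q_def)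
    define x where "x = eigenfamily (\<lambda>_. 1) 0 1"
    have x: "norm x > 0" unfolding x_def zero_less_norm_iff by (rule constant_eigenfamily(3)) simp
    have est: "1 \<le> K * (1 / 2) ^ n" for n
    proof -
      have "norm x \<le> C ^ n * (K * (1 / (2 * (C + 1))) ^ n * norm x)"
        using lbn[of x n] mult_left_mono[OF K(2)[of n x], of "C ^ n"] C(1) by (simp add: qa)
      also have "\<dots> = K * (C * (1 / (2 * (C + 1)))) ^ n * norm x" by (simp add: power_mult_distrib power_divide)
      also have "\<dots> \<le> K * (1 / 2) ^ n * norm x"
        using K(1) C(1) by (intro mult_right_mono mult_left_mono power_mono) (auto simp: field_simps)
      finally show ?thesis using x by simp
    qed
    have "(\<lambda>n. K * (1 / 2) ^ n) \<longlonglongrightarrow> K * 0" by (intro tendsto_intros LIMSEQ_power_zero) auto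
    then have "1 \<le> K * 0" by (rule LIMSEQ_le_const) (use est in blast)
    then show False by simp
  qed
qed

text \<open>A cycle of inclusions, from the disc to the essential spectrum, the spectrum and back to
  the disc, gives both equalities at once. For \<open>L = 0\<close> the disc is the single point
  0.\<close>

lemma spectra:
  assumes g: "g \<in> hardy_inf" and L: "(g \<longlongrightarrow> L) (at 1 within unit_disc)"
  shows "Sp (weighted_comp_op g \<phi>) = {l. cmod l \<le> cmod L / sqrt a}"
    and "Sp_ess (weighted_comp_op g \<phi>) = {l. cmod l \<le> cmod L / sqrt a}"
proof -
  let ?T = "weighted_comp_op g \<phi>" and ?D = "{l. cmod l \<le> cmod L / sqrt a}"
  have 1: "Sp_ess ?T \<subseteq> Sp ?T"
    using invertible_imp_Fredholm by (auto simp: Sp_def Sp_ess_def)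
  have 2: "?D \<subseteq> Sp_ess ?T"
  proof
    fix l assume l: "l \<in> ?D"
    show "l \<in> Sp_ess ?T"
    proof (cases "L = 0")
      case True
      with l have "l = 0" by simp
      then show ?thesis using not_Fredholm_zero_limit[OF g] L True by (simp add: Sp_ess_def)
    next
      case False
      then show ?thesis using not_Fredholm_nonzero_limit[OF g L False] l by (simp add: Sp_ess_def)
    qed
  qed
  show "Sp ?T = ?D" "Sp_ess ?T = ?D" using 1 2 spectrum_subset[OF g L] by blast+
qed

end

theorem theorem5p5:
  fixes \<phi> g gs :: "complex \<Rightarrow> complex" and \<delta> :: real and A :: "complex set"
  assumes "essentially_linear_fractional \<phi>"
    and "(\<phi> \<longlongrightarrow> 1) (at 1 within unit_disc)"
    and "\<delta> > 0"
    and "extends_continuously (deriv \<phi>) {z. cmod (z - 1) < \<delta> \<and> cmod z \<le> 1}"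
    and "g \<in> hardy_inf"
    and "open_arc A" and "1 \<in> A"
    and "radial_limit_on A g gs"
    and "gs field_differentiable (at 1 within A)"
    and "Re (boundary_value (deriv \<phi>) 1) < 1"
  shows "Sp (weighted_comp_op g \<phi>) = Sp_ess (weighted_comp_op g \<phi>)
       \<and> Sp_ess (weighted_comp_op g \<phi>)
           = {z. cmod z \<le> cmod (gs 1) * Re (boundary_value (deriv \<phi>) 1) powr (-1/2)}"
proof -
  define a where "a = Re (boundary_value (deriv \<phi>) 1)"
  obtain c B \<rho> where "hyperbolic_selfmap \<phi> a c B \<rho>"
    using essentially_linear_fractional_hyperbolic[OF assms(1-4,10)] unfolding a_def by metis
  then interpret hyperbolic_selfmap \<phi> a c B \<rho> .
  have "(g \<longlongrightarrow> gs 1) (at 1 within unit_disc)"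
    by (rule tendsto_of_radial_limit[OF assms(5-8) field_differentiable_imp_continuous_at[OF assms(9)]])
  note spectra[OF assms(5) this]
  moreover have "cmod (gs 1) * a powr (-1/2) = cmod (gs 1) / sqrt a"
    using a by (simp add: powr_minus_divide powr_half_sqrt)
  ultimately show ?thesis unfolding a_def[symmetric] by simp
qed

end
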